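(* In the setting of the context, suppose that $$C^{\mathsf{DF}}_{\mathsf d,\boldsymbol u_h}\bigl(\|\boldsymbol f(0)\|_{0,\Omega}+C^{\mathsf{ADR}}_{\mathsf d}\,\alpha_1\,\|m\|_{0,6/5,\Omega}\bigr)<\tfrac12\qquad\text{and}\qquad L^{\mathsf d}_{\mathcal S}<1 .$$ Then there is a unique $(\boldsymbol u_h,p_h,\boldsymbol\zeta_h,\varphi_h)\in\mathbf V_h\times\mathrm Q_h\times\mathbf W_h\times\Psi_h$ such that $$\int_\Omega\kappa^{-1}\boldsymbol u_h\cdot\boldsymbol v_h+\int_\Omega\mathtt F|\boldsymbol u_h|\boldsymbol u_h\cdot\boldsymbol v_h-\int_\Omega p_h\operatorname{div}\boldsymbol v_h=\int_\Omega\boldsymbol f(\varphi_h)\cdot\boldsymbol v_h,\qquad -\int_\Omega q_h\operatorname{div}\boldsymbol u_h=0,$$ $$\int_\Omega\alpha^{-1}\boldsymbol\zeta_h\cdot\boldsymbol w_h+\int_\Omega\varphi_h\operatorname{div}\boldsymbol w_h+\int_\Omega\alpha^{-1}(\boldsymbol u_h\cdot\boldsymbol w_h)\varphi_h=0,\qquad \int_\Omega\psi_h\operatorname{div}\boldsymbol\zeta_h-\int_\Omega\varrho_0\varphi_h\psi_h=-\int_\Omega m\psi_h$$ for all $(\boldsymbol v_h,q_h,\boldsymbol w_h,\psi_h)\in\mathbf V_h\times\mathrm Q_h\times\mathbf W_h\times\Psi_h$. Moreover, with $D:=C^{\mathsf{DF}}_{\mathsf d,\boldsymbol u_h}\bigl[\|\boldsymbol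 f(0)\|_{0,\Omega}+C^{\mathsf{ADR}}_{\mathsf d}\alpha_1\|m\|_{0,6/5,\Omega}\bigr]$, $$\|\boldsymbol u_h\|_{\mathbf V}+\|p_h\|_{\widehat{\mathrm Q}(\mathcal T_h)}+\|\boldsymbol\zeta_h\|_{\mathbf W}+\|\varphi_h\|_{\widehat\Psi(\mathcal T_h)}\le C^{\mathsf{ADR}}_{\mathsf d}\|m\|_{0,6/5,\Omega}+C^{\mathsf{DF}}_{\mathsf d,\boldsymbol u_h}\max[D,D^2],$$ where the constants do not depend on the model parameters $\kappa,\mathtt F,\varrho_0$, nor on the discretisation parameter $h$.
   Context: $\Omega\subset\mathbb R^d$, $d\in\{2,3\}$, is a bounded Lipschitz domain with outward unit normal $\boldsymbol n$; $\partial\Omega$ is decomposed into $\Gamma_{\boldsymbol u}$ and $\Gamma_p$, both of positive $(d-1)$-dimensional Hausdorff measure. $\kappa,\mathtt F,\alpha,\varrho_0>0$ are parameters, $m\in L^{6/5}(\Omega)$, and $\boldsymbol f$ is a concentration-dependent forcing with values in $L^2(\Omega)^d$ and $\|\boldsymbol f(\varphi)\|_{0,\Omega}\le\|\boldsymbol f(0)\|_{0,\Omega}+\alpha_1\|\varphi\|_{0,6,\Omega}$ for a constant $\alpha_1>0$. $\|\cdot\|_{0,r,\Omega}$ is the $L^r$ norm and $\|\cdot\|_{0,\Omega}=\|\cdot\|_{0,2,\Omega}$. $\mathcal T_h$ is a regular simplicial mesh of $\Omega$ with elements $K$ of diameter $h_K$, $h=\max_K h_K$; $\mathcal F_h$ is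 its set of facets, $h_F$ the facet diameter, $[\![\cdot]\!]$ the usual jump. $k\ge0$ is an integer; $\mathbb P_k(\mathcal T_h)$: (discontinuous) piecewise polynomials of degree at most $k$; $\mathbb{RT}_k(\mathcal T_h)$: Raviart--Thomas space of order $k$ (locally $[\mathbb P_k(K)]^d\oplus\widetilde{\mathbb P}_k(K)\boldsymbol x$, $\widetilde{\mathbb P}_k(K)$ the polynomials of degree exactly $k$, $\operatorname{div}$-conforming). Broken spaces: $W^{1,r}_{\Gamma}(\mathcal T_h)$ is the space of $L^2(\Omega)$ functions that are $W^{1,r}$ on each $K$ and vanish on the boundary part $\Gamma$, with $|\xi|_{1,r,\mathcal T_h}:=\bigl(\sum_K\|\nabla\xi\|_{0,r,K}^r+\sum_{F\in\mathcal F_h}h_F^{1-r}\|[\![\xi]\!]\|_{0,r,F}^r\bigr)^{1/r}$; $H^1_\Gamma(\mathcal T_h)$ and $|\cdot|_{1,\mathcal T_h}$ are the case $r=2$. Discrete spaces: $\mathbf V_h$: $\boldsymbol v_h\in\mathbb{RT}_k(\mathcal T_h)$, $\boldsymbol v_h\cdot\boldsymbol n=0$ on $\Gamma_{\boldsymbol u}$, norm $\|\boldsymbol v\|_{\mathbf V}=\kappa^{-1/2}\|\boldsymbol v\|_{0,\Omega}+\|\operatorname{div}\boldsymbol v\|_{0,\Omega}+\mathtt F^{1/3}\|\boldsymbol v\|_{0,3,\Omega}$. $\mathbf W_h$: $\boldsymbol w_h\in\mathbb{RT}_k(\mathcal T_h)$, $\boldsymbol w_h\cdot\boldsymbol n=0$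 on $\Gamma_p$, norm $\|\boldsymbol w\|_{\mathbf W}=\alpha^{-1/2}\|\boldsymbol w\|_{0,\Omega}+\|\operatorname{div}\boldsymbol w\|_{0,6/5,\Omega}$. $\mathrm Q_h$: $\mathbb P_k(\mathcal T_h)$ with norm $\|q\|_{\widehat{\mathrm Q}(\mathcal T_h)}:=\inf\bigl(\|q_1\|_{0,\Omega}+\kappa^{1/2}|q_2|_{1,\mathcal T_h}+\mathtt F^{-1/3}|q_3|_{1,3/2,\mathcal T_h}\bigr)$ over $q=q_1+q_2+q_3$, $q_1\in L^2(\Omega)$, $q_2\in H^1_{\Gamma_p}(\mathcal T_h)$, $q_3\in W^{1,3/2}_{\Gamma_p}(\mathcal T_h)$. $\Psi_h$: $\mathbb P_k(\mathcal T_h)$ with norm $\|\psi\|_{\widehat\Psi(\mathcal T_h)}:=\inf\bigl(\|\psi_1\|_{0,6,\Omega}+\alpha^{1/2}|\psi_2|_{1,\mathcal T_h}\bigr)$ over $\psi=\psi_1+\psi_2$, $\psi_1\in L^6(\Omega)$, $\psi_2\in H^1_{\Gamma_{\boldsymbol u}}(\mathcal T_h)$. Maps and constants. For $\hat\varphi_h\in\Psi_h$ the discrete Darcy--Forchheimer problem (first two equations of the claim with $\boldsymbol f(\hat\varphi_h)$) is known to have a unique solution $(\boldsymbol u_h,p_h)$, with $\|\boldsymbol u_h\|_{\mathbf V}+\|p_h\|_{\widehat{\mathrm Q}(\mathcal T_h)}\le C^{\mathsf{DF}}_{\mathsf d}\max(\|\boldsymbol f(\hat\varphi_h)\|_{0,\Omega},\|\boldsymbol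 f(\hat\varphi_h)\|_{0,\Omega}^2)$ and $\|\boldsymbol u_h\|_{\mathbf V}\le C^{\mathsf{DF}}_{\mathsf d,\boldsymbol u_h}\|\boldsymbol f(\hat\varphi_h)\|_{0,\Omega}$, constants independent of $\kappa,\mathtt F,h$; set $\mathcal S^{\mathsf{DF}}_{1,h}(\hat\varphi_h):=\boldsymbol u_h$. For $\hat{\boldsymbol u}_h\in\mathbf V_h$, $\mathcal S^{\mathsf{ADR}}_{2,h}(\hat{\boldsymbol u}_h):=\varphi_h$, where $(\boldsymbol\zeta_h,\varphi_h)$ is the unique solution of the discrete advection-diffusion-reaction (ADR) problem (last two equations of the claim with $\boldsymbol u_h$ replaced by $\hat{\boldsymbol u}_h$). Standing convention: this problem is uniquely solvable for the advecting velocities considered (guaranteed under a smallness condition on $\|\hat{\boldsymbol u}_h\|_{0,3,\Omega}$), with $\|\boldsymbol\zeta_h\|_{\mathbf W}+\|\varphi_h\|_{\widehat\Psi(\mathcal T_h)}\le C^{\mathsf{ADR}}_{\mathsf d}\|m\|_{0,6/5,\Omega}$, $C^{\mathsf{ADR}}_{\mathsf d}$ independent of $h,\varrho_0$, so that $\mathcal S_h:=\mathcal S^{\mathsf{DF}}_{1,h}\circ\mathcal S^{\mathsf{ADR}}_{2,h}:\mathbf V_h\to\mathbf V_h$ is well defined. $L^{\mathsf d}_{\mathcal S}$ is the Lipschitz constant of $\mathcal S_h$ in the norm $\|\cdot\|_{\mathbf V}$; the paper gives it as $L^{\mathsf d}_{\mathcal S}=\frac{2C^d_\alpha}{C_d(C^d_\alpha-\mathtt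 F^{-1/3})}\|m\|_{0,6/5,\Omega}\,\alpha_{\mathsf{DF}}^{-1/2}\alpha_1$, where $C_d$ is the inf-sup constant of the discrete ADR form without advection (with respect to $\|\boldsymbol w\|_{\mathbf W}+\|\psi\|_{\widehat\Psi(\mathcal T_h)}+\varrho_0^{1/2}\|\psi\|_{0,\Omega}$), $C^d_\alpha=\alpha^{-1/2}(1+C_{\mathsf{emb}}\alpha^{-1/2})$ with $C_{\mathsf{emb}}$ a Sobolev embedding constant, and $\alpha_{\mathsf{DF}}$ is the strong monotonicity constant of $\boldsymbol u\mapsto\kappa^{-1}\boldsymbol u+\mathtt F|\boldsymbol u|\boldsymbol u$ in the $\mathbf V$-norm on discretely divergence-free fields.
   Formalization: In the final bound (and in D) the velocity stability constant is replaced by any C at least as large as it, the Darcy–Forchheimer constant, 1 and C_emb α^{-1/2}; with the velocity constant alone the bound can fail (m=0, f constant, small κ). *)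

theory Defs
  imports "HOL-Analysis.Analysis"
begin

section \<open>Lebesgue norms and Hausdorff measure\<close>

definition Lp :: "'a measure \<Rightarrow> real \<Rightarrow> ('a \<Rightarrow> 'b::real_normed_vector) \<Rightarrow> bool" where
  "Lp M r g \<longleftrightarrow> g \<in> borel_measurable M \<and> integrable M (\<lambda>x. norm (g x) powr r)"

definition Lp_norm :: "'a measure \<Rightarrow> real \<Rightarrow> ('a \<Rightarrow> 'b::real_normed_vector) \<Rightarrow> real" where
  "Lp_norm M r g = (LINT x|M. norm (g x) powr r) powr (1 / r)"

text \<open>The factor \<open>unit_ball_vol s / 2 ^ s\<close> normalises the \<open>s\<close>-dimensional Hausdorff measure
  (\<open>s \<ge> 1\<close>) so that it is the usual surface area on hypersurfaces of dimension \<open>s\<close>.\<close>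

definition hausdorff_outer :: "nat \<Rightarrow> 'a::metric_space set \<Rightarrow> ennreal" where
  "hausdorff_outer s A =
     (SUP \<delta>\<in>{0<..}.
        INF U\<in>{U :: nat \<Rightarrow> 'a set. A \<subseteq> (\<Union>i. U i) \<and> (\<forall>i. bounded (U i) \<and> diameter (U i) \<le> \<delta>)}.
          (\<Sum>i. ennreal (unit_ball_vol (real s) / 2 ^ s * diameter (U i) ^ s)))"

definition hausdorff_measure :: "nat \<Rightarrow> 'a::metric_space measure" where
  "hausdorff_measure s = measure_of UNIV (sets borel) (hausdorff_outer s)"

definition surface_measure :: "(real ^ 'n) set \<Rightarrow> (real ^ 'n) measure" where
  "surface_measure F = restrict_space (hausdorff_measure (CARD('n) - 1)) F"


section \<open>Domains and meshes\<close>

text \<open>Near every boundary point the domain is the strict epigraph, in some direction \<open>e\<close>,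
  of a Lipschitz function \<open>g\<close> of the component orthogonal to \<open>e\<close>.\<close>

definition bounded_lipschitz_domain :: "(real ^ 'n) set \<Rightarrow> bool" where
  "bounded_lipschitz_domain \<Omega> \<longleftrightarrow>
     open \<Omega> \<and> connected \<Omega> \<and> \<Omega> \<noteq> {} \<and> bounded \<Omega> \<and>
     (\<forall>x0\<in>frontier \<Omega>. \<exists>\<rho>>0. \<exists>e (g :: real ^ 'n \<Rightarrow> real) L. norm e = 1 \<and> L-lipschitz_on UNIV g \<and>
        (\<forall>x\<in>ball x0 \<rho>. x \<in> \<Omega> \<longleftrightarrow> g (x - (x \<bullet> e) *\<^sub>R e) < x \<bullet> e))"

definition boundary_decomposition ::
  "(real ^ 'n) set \<Rightarrow> (real ^ 'n) set \<Rightarrow> (real ^ 'n) set \<Rightarrow> bool" where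
  "boundary_decomposition \<Omega> \<Gamma>u \<Gamma>p \<longleftrightarrow>
     \<Gamma>u \<in> sets borel \<and> \<Gamma>p \<in> sets borel \<and> \<Gamma>u \<union> \<Gamma>p = frontier \<Omega> \<and> \<Gamma>u \<inter> \<Gamma>p = {} \<and>
     hausdorff_outer (CARD('n) - 1) \<Gamma>u > 0 \<and> hausdorff_outer (CARD('n) - 1) \<Gamma>p > 0"

text \<open>Elements are closed simplices. Conformity (two elements meet in a common face) is part of
  \<^const>\<open>triangulation\<close>; \<open>\<sigma>\<close> bounds the ratio of the diameter of an element to the diameter
  of an inscribed ball.\<close>

definition regular_simplicial_mesh :: "real \<Rightarrow> (real ^ 'n) set \<Rightarrow> (real ^ 'n) set set \<Rightarrow> bool" where
  "regular_simplicial_mesh \<sigma> \<Omega> T \<longleftrightarrow>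
     triangulation T \<and> (\<forall>K\<in>T. int CARD('n) simplex K) \<and> \<Union>T = closure \<Omega> \<and>
     (\<forall>K\<in>T. \<exists>x r. ball x r \<subseteq> K \<and> diameter K \<le> \<sigma> * (2 * r))"

definition facets :: "(real ^ 'n) set set \<Rightarrow> (real ^ 'n) set set" where
  "facets T = {F. \<exists>K\<in>T. F facet_of K}"

definition outward_normal :: "(real ^ 'n) set \<Rightarrow> (real ^ 'n) set \<Rightarrow> real ^ 'n" where
  "outward_normal K F =
     (THE \<nu>. norm \<nu> = 1 \<and> (\<exists>c. F \<subseteq> {x. \<nu> \<bullet> x = c} \<and> K \<subseteq> {x. \<nu> \<bullet> x \<le> c}))"


section \<open>Weak derivatives and traces\<close>

definition C1_function :: "(real ^ 'n \<Rightarrow> real) \<Rightarrow> (real ^ 'n \<Rightarrow> real ^ 'n) \<Rightarrow> bool" where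
  "C1_function \<phi> d\<phi> \<longleftrightarrow>
     (\<forall>x. (\<phi> has_derivative (\<lambda>h. d\<phi> x \<bullet> h)) (at x)) \<and> continuous_on UNIV d\<phi>"

definition test_function ::
  "(real ^ 'n) set \<Rightarrow> (real ^ 'n \<Rightarrow> real) \<Rightarrow> (real ^ 'n \<Rightarrow> real ^ 'n) \<Rightarrow> bool" where
  "test_function U \<phi> d\<phi> \<longleftrightarrow>
     C1_function \<phi> d\<phi> \<and> (\<exists>C. compact C \<and> C \<subseteq> U \<and> (\<forall>x. x \<notin> C \<longrightarrow> \<phi> x = 0))"

definition has_weak_gradient ::
  "(real ^ 'n) set \<Rightarrow> (real ^ 'n \<Rightarrow> real) \<Rightarrow> (real ^ 'n \<Rightarrow> real ^ 'n) \<Rightarrow> bool" where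
  "has_weak_gradient U \<xi> G \<longleftrightarrow>
     (\<forall>\<phi> d\<phi>. test_function U \<phi> d\<phi> \<longrightarrow>
        (LINT x|lebesgue_on U. \<xi> x *\<^sub>R d\<phi> x) = - (LINT x|lebesgue_on U. \<phi> x *\<^sub>R G x))"

definition has_weak_divergence ::
  "(real ^ 'n) set \<Rightarrow> (real ^ 'n \<Rightarrow> real ^ 'n) \<Rightarrow> (real ^ 'n \<Rightarrow> real) \<Rightarrow> bool" where
  "has_weak_divergence U v g \<longleftrightarrow>
     (\<forall>\<phi> d\<phi>. test_function U \<phi> d\<phi> \<longrightarrow>
        (LINT x|lebesgue_on U. v x \<bullet> d\<phi> x) = - (LINT x|lebesgue_on U. \<phi> x * g x))"

definition W1 :: "real \<Rightarrow> (real ^ 'n) set \<Rightarrow> (real ^ 'n \<Rightarrow> real) \<Rightarrow> bool" where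
  "W1 r U \<xi> \<longleftrightarrow>
     Lp (lebesgue_on U) r \<xi> \<and> (\<exists>G. Lp (lebesgue_on U) r G \<and> has_weak_gradient U \<xi> G)"

definition weak_gradient ::
  "real \<Rightarrow> (real ^ 'n) set \<Rightarrow> (real ^ 'n \<Rightarrow> real) \<Rightarrow> real ^ 'n \<Rightarrow> real ^ 'n" where
  "weak_gradient r U \<xi> = (SOME G. Lp (lebesgue_on U) r G \<and> has_weak_gradient U \<xi> G)"

text \<open>The trace of a \<open>W\<^sup>1\<^sup>,\<^sup>r\<close> function on a facet \<open>F\<close> of \<open>K\<close> is the \<open>L\<^sup>r\<close> limit of the
  restrictions to \<open>F\<close> of \<open>C\<^sup>1\<close> functions that converge to it in \<open>W\<^sup>1\<^sup>,\<^sup>r\<close> on \<open>K\<close>.\<close>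

definition has_trace ::
  "real \<Rightarrow> (real ^ 'n) set \<Rightarrow> (real ^ 'n) set \<Rightarrow> (real ^ 'n \<Rightarrow> real) \<Rightarrow> (real ^ 'n \<Rightarrow> real) \<Rightarrow> bool" where
  "has_trace r K F \<xi> g \<longleftrightarrow>
     Lp (surface_measure F) r g \<and>
     (\<exists>\<Phi> d\<Phi>. (\<forall>j :: nat. C1_function (\<Phi> j) (d\<Phi> j)) \<and>
        (\<lambda>j. Lp_norm (lebesgue_on (interior K)) r (\<lambda>x. \<Phi> j x - \<xi> x)) \<longlonglongrightarrow> 0 \<and>
        (\<lambda>j. Lp_norm (lebesgue_on (interior K)) r
               (\<lambda>x. d\<Phi> j x - weak_gradient r (interior K) \<xi> x)) \<longlonglongrightarrow> 0 \<and>
        (\<lambda>j. Lp_norm (surface_measure F) r (\<lambda>x. \<Phi> j x - g x)) \<longlonglongrightarrow> 0)"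

definition trace_on ::
  "real \<Rightarrow> (real ^ 'n) set \<Rightarrow> (real ^ 'n) set \<Rightarrow> (real ^ 'n \<Rightarrow> real) \<Rightarrow> real ^ 'n \<Rightarrow> real" where
  "trace_on r K F \<xi> = (SOME g. has_trace r K F \<xi> g)"


section \<open>Broken Sobolev spaces\<close>

text \<open>A facet belongs to one element (boundary facet: the jump is the trace) or to two elements
  (the jump is the difference of the two traces). The sign depends on an arbitrary choice of the
  first element; only the absolute value of the jump is used.\<close>

definition jump ::
  "real \<Rightarrow> (real ^ 'n) set set \<Rightarrow> (real ^ 'n) set \<Rightarrow> (real ^ 'n \<Rightarrow> real) \<Rightarrow> real ^ 'n \<Rightarrow> real" where
  "jump r T F \<xi> x =
     (let \<K> = {K \<in> T. F facet_of K}; K0 = (SOME K. K \<in> \<K>)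
      in trace_on r K0 F \<xi> x - (\<Sum>K\<in>\<K> - {K0}. trace_on r K F \<xi> x))"

definition broken_W1 ::
  "real \<Rightarrow> (real ^ 'n) set \<Rightarrow> (real ^ 'n) set \<Rightarrow> (real ^ 'n) set set \<Rightarrow> (real ^ 'n \<Rightarrow> real) set" where
  "broken_W1 r \<Omega> \<Gamma> T =
     {\<xi>. Lp (lebesgue_on \<Omega>) 2 \<xi> \<and> (\<forall>K\<in>T. W1 r (interior K) \<xi>) \<and>
         (\<forall>K\<in>T. \<forall>F. F facet_of K \<longrightarrow>
            (AE x in surface_measure F. x \<in> \<Gamma> \<longrightarrow> trace_on r K F \<xi> x = 0))}"

definition broken_seminorm :: "real \<Rightarrow> (real ^ 'n) set set \<Rightarrow> (real ^ 'n \<Rightarrow> real) \<Rightarrow> real" where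
  "broken_seminorm r T \<xi> =
     ((\<Sum>K\<in>T. Lp_norm (lebesgue_on (interior K)) r (weak_gradient r (interior K) \<xi>) powr r) +
      (\<Sum>F\<in>facets T. diameter F powr (1 - r) *
         Lp_norm (surface_measure F) r (jump r T F \<xi>) powr r)) powr (1 / r)"


section \<open>Discrete spaces\<close>

definition monomial :: "('n \<Rightarrow> nat) \<Rightarrow> real ^ 'n \<Rightarrow> real" where
  "monomial \<beta> x = (\<Prod>i\<in>UNIV. x $ i ^ \<beta> i)"

definition polynomials :: "nat \<Rightarrow> (real ^ 'n \<Rightarrow> real) set" where
  "polynomials k = {p. \<exists>c. \<forall>x. p x = (\<Sum>\<beta> | sum \<beta> UNIV \<le> k. c \<beta> * monomial \<beta> x)}"

definition homogeneous_polynomials :: "nat \<Rightarrow> (real ^ 'n \<Rightarrow> real) set" where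
  "homogeneous_polynomials k = {p. \<exists>c. \<forall>x. p x = (\<Sum>\<beta> | sum \<beta> UNIV = k. c \<beta> * monomial \<beta> x)}"

text \<open>Discrete functions are defined up to null sets. Every class is represented by its unique
  member that is polynomial on each open element and zero elsewhere, so that equality of discrete
  functions is equality in HOL.\<close>

definition piecewise ::
  "(real ^ 'n) set set \<Rightarrow> (real ^ 'n \<Rightarrow> 'b::zero) set \<Rightarrow> (real ^ 'n \<Rightarrow> 'b) set" where
  "piecewise T P =
     {v. (\<forall>K\<in>T. \<exists>p\<in>P. \<forall>x\<in>interior K. v x = p x) \<and>
         (\<forall>x. x \<notin> (\<Union>K\<in>T. interior K) \<longrightarrow> v x = 0)}"

definition Pk :: "nat \<Rightarrow> (real ^ 'n) set set \<Rightarrow> (real ^ 'n \<Rightarrow> real) set" where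
  "Pk k T = piecewise T (polynomials k)"

definition RT_local :: "nat \<Rightarrow> (real ^ 'n \<Rightarrow> real ^ 'n) set" where
  "RT_local k =
     {v. \<exists>p q. (\<forall>i. (\<lambda>x. p x $ i) \<in> polynomials k) \<and> q \<in> homogeneous_polynomials k \<and>
               (\<forall>x. v x = p x + q x *\<^sub>R x)}"

text \<open>The elementwise divergence. For a div-conforming field it is the weak divergence on the
  whole domain, and this is how div-conformity is expressed below.\<close>

definition divergence :: "(real ^ 'n) set set \<Rightarrow> (real ^ 'n \<Rightarrow> real ^ 'n) \<Rightarrow> real ^ 'n \<Rightarrow> real" where
  "divergence T v x =
     (if x \<in> (\<Union>K\<in>T. interior K)
      then \<Sum>i\<in>UNIV. frechet_derivative v (at x) (axis i 1) $ i else 0)"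

definition RT ::
  "nat \<Rightarrow> (real ^ 'n) set \<Rightarrow> (real ^ 'n) set set \<Rightarrow> (real ^ 'n \<Rightarrow> real ^ 'n) set" where
  "RT k \<Omega> T = {v \<in> piecewise T (RT_local k). has_weak_divergence \<Omega> v (divergence T v)}"

definition normal_trace ::
  "(real ^ 'n) set \<Rightarrow> (real ^ 'n) set \<Rightarrow> (real ^ 'n \<Rightarrow> real ^ 'n) \<Rightarrow> real ^ 'n \<Rightarrow> real" where
  "normal_trace K F v x = Lim (at x within interior K) v \<bullet> outward_normal K F"

text \<open>\<open>RT0 k \<Omega> \<Gamma> T\<close>: Raviart--Thomas fields with vanishing normal component on \<open>\<Gamma>\<close>. The
  velocity space is obtained for \<open>\<Gamma> = \<Gamma>u\<close>, the flux space for \<open>\<Gamma> = \<Gamma>p\<close>.\<close>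

definition RT0 ::
  "nat \<Rightarrow> (real ^ 'n) set \<Rightarrow> (real ^ 'n) set \<Rightarrow> (real ^ 'n) set set \<Rightarrow> (real ^ 'n \<Rightarrow> real ^ 'n) set" where
  "RT0 k \<Omega> \<Gamma> T =
     {v \<in> RT k \<Omega> T. \<forall>K\<in>T. \<forall>F. F facet_of K \<longrightarrow>
        (AE x in surface_measure F. x \<in> \<Gamma> \<longrightarrow> normal_trace K F v x = 0)}"

definition norm_V ::
  "(real ^ 'n) set \<Rightarrow> (real ^ 'n) set set \<Rightarrow> real \<Rightarrow> real \<Rightarrow> (real ^ 'n \<Rightarrow> real ^ 'n) \<Rightarrow> real" where
  "norm_V \<Omega> T \<kappa> F v =
     \<kappa> powr (-1/2) * Lp_norm (lebesgue_on \<Omega>) 2 v + Lp_norm (lebesgue_on \<Omega>) 2 (divergence T v) +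
     F powr (1/3) * Lp_norm (lebesgue_on \<Omega>) 3 v"

definition norm_W ::
  "(real ^ 'n) set \<Rightarrow> (real ^ 'n) set set \<Rightarrow> real \<Rightarrow> (real ^ 'n \<Rightarrow> real ^ 'n) \<Rightarrow> real" where
  "norm_W \<Omega> T \<alpha> w =
     \<alpha> powr (-1/2) * Lp_norm (lebesgue_on \<Omega>) 2 w + Lp_norm (lebesgue_on \<Omega>) (6/5) (divergence T w)"

definition norm_Q ::
  "(real ^ 'n) set \<Rightarrow> (real ^ 'n) set \<Rightarrow> (real ^ 'n) set set \<Rightarrow> real \<Rightarrow> real \<Rightarrow>
   (real ^ 'n \<Rightarrow> real) \<Rightarrow> real" where
  "norm_Q \<Omega> \<Gamma>p T \<kappa> F q =
     Inf {Lp_norm (lebesgue_on \<Omega>) 2 q1 + \<kappa> powr (1/2) * broken_seminorm 2 T q2 +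
            F powr (-1/3) * broken_seminorm (3/2) T q3 | q1 q2 q3.
          Lp (lebesgue_on \<Omega>) 2 q1 \<and> q2 \<in> broken_W1 2 \<Omega> \<Gamma>p T \<and> q3 \<in> broken_W1 (3/2) \<Omega> \<Gamma>p T \<and>
          (AE x in lebesgue_on \<Omega>. q x = q1 x + q2 x + q3 x)}"

definition norm_Psi ::
  "(real ^ 'n) set \<Rightarrow> (real ^ 'n) set \<Rightarrow> (real ^ 'n) set set \<Rightarrow> real \<Rightarrow> (real ^ 'n \<Rightarrow> real) \<Rightarrow> real" where
  "norm_Psi \<Omega> \<Gamma>u T \<alpha> \<psi> =
     Inf {Lp_norm (lebesgue_on \<Omega>) 6 \<psi>1 + \<alpha> powr (1/2) * broken_seminorm 2 T \<psi>2 | \<psi>1 \<psi>2.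
          Lp (lebesgue_on \<Omega>) 6 \<psi>1 \<and> \<psi>2 \<in> broken_W1 2 \<Omega> \<Gamma>u T \<and>
          (AE x in lebesgue_on \<Omega>. \<psi> x = \<psi>1 x + \<psi>2 x)}"


section \<open>Discrete problems\<close>

text \<open>The first two equations, with a given right-hand side \<open>g\<close>.\<close>

definition DF_equations ::
  "nat \<Rightarrow> (real ^ 'n) set \<Rightarrow> (real ^ 'n) set \<Rightarrow> (real ^ 'n) set set \<Rightarrow> real \<Rightarrow> real \<Rightarrow>
   (real ^ 'n \<Rightarrow> real ^ 'n) \<Rightarrow> (real ^ 'n \<Rightarrow> real ^ 'n) \<Rightarrow> (real ^ 'n \<Rightarrow> real) \<Rightarrow> bool" where
  "DF_equations k \<Omega> \<Gamma>u T \<kappa> F g u p \<longleftrightarrow>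
     (\<forall>v\<in>RT0 k \<Omega> \<Gamma>u T.
        (LINT x|lebesgue_on \<Omega>. inverse \<kappa> * (u x \<bullet> v x)) +
        (LINT x|lebesgue_on \<Omega>. F * norm (u x) * (u x \<bullet> v x)) -
        (LINT x|lebesgue_on \<Omega>. p x * divergence T v x) =
        (LINT x|lebesgue_on \<Omega>. g x \<bullet> v x)) \<and>
     (\<forall>q\<in>Pk k T. - (LINT x|lebesgue_on \<Omega>. q x * divergence T u x) = 0)"

text \<open>The last two equations, with a given advecting velocity \<open>u\<close>.\<close>

definition ADR_equations ::
  "nat \<Rightarrow> (real ^ 'n) set \<Rightarrow> (real ^ 'n) set \<Rightarrow> (real ^ 'n) set set \<Rightarrow> real \<Rightarrow> real \<Rightarrow>
   (real ^ 'n \<Rightarrow> real) \<Rightarrow> (real ^ 'n \<Rightarrow> real ^ 'n) \<Rightarrow>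
   (real ^ 'n \<Rightarrow> real ^ 'n) \<Rightarrow> (real ^ 'n \<Rightarrow> real) \<Rightarrow> bool" where
  "ADR_equations k \<Omega> \<Gamma>p T \<alpha> \<rho> m u \<zeta> \<phi> \<longleftrightarrow>
     (\<forall>w\<in>RT0 k \<Omega> \<Gamma>p T.
        (LINT x|lebesgue_on \<Omega>. inverse \<alpha> * (\<zeta> x \<bullet> w x)) +
        (LINT x|lebesgue_on \<Omega>. \<phi> x * divergence T w x) +
        (LINT x|lebesgue_on \<Omega>. inverse \<alpha> * (u x \<bullet> w x) * \<phi> x) = 0) \<and>
     (\<forall>\<psi>\<in>Pk k T.
        (LINT x|lebesgue_on \<Omega>. \<psi> x * divergence T \<zeta> x) -
        (LINT x|lebesgue_on \<Omega>. \<rho> * \<phi> x * \<psi> x) =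
        - (LINT x|lebesgue_on \<Omega>. m x * \<psi> x))"

definition S_DF ::
  "nat \<Rightarrow> (real ^ 'n) set \<Rightarrow> (real ^ 'n) set \<Rightarrow> (real ^ 'n) set set \<Rightarrow> real \<Rightarrow> real \<Rightarrow>
   ((real ^ 'n \<Rightarrow> real) \<Rightarrow> real ^ 'n \<Rightarrow> real ^ 'n) \<Rightarrow>
   (real ^ 'n \<Rightarrow> real) \<Rightarrow> real ^ 'n \<Rightarrow> real ^ 'n" where
  "S_DF k \<Omega> \<Gamma>u T \<kappa> F f \<phi> =
     fst (THE (u, p). u \<in> RT0 k \<Omega> \<Gamma>u T \<and> p \<in> Pk k T \<and> DF_equations k \<Omega> \<Gamma>u T \<kappa> F (f \<phi>) u p)"

definition S_ADR ::
  "nat \<Rightarrow> (real ^ 'n) set \<Rightarrow> (real ^ 'n) set \<Rightarrow> (real ^ 'n) set set \<Rightarrow> real \<Rightarrow> real \<Rightarrow>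
   (real ^ 'n \<Rightarrow> real) \<Rightarrow> (real ^ 'n \<Rightarrow> real ^ 'n) \<Rightarrow> real ^ 'n \<Rightarrow> real" where
  "S_ADR k \<Omega> \<Gamma>p T \<alpha> \<rho> m u =
     snd (THE (\<zeta>, \<phi>). \<zeta> \<in> RT0 k \<Omega> \<Gamma>p T \<and> \<phi> \<in> Pk k T \<and> ADR_equations k \<Omega> \<Gamma>p T \<alpha> \<rho> m u \<zeta> \<phi>)"

definition DF_well_posed ::
  "nat \<Rightarrow> (real ^ 'n) set \<Rightarrow> (real ^ 'n) set \<Rightarrow> (real ^ 'n) set \<Rightarrow> (real ^ 'n) set set \<Rightarrow>
   real \<Rightarrow> real \<Rightarrow> ((real ^ 'n \<Rightarrow> real) \<Rightarrow> real ^ 'n \<Rightarrow> real ^ 'n) \<Rightarrow> real \<Rightarrow> real \<Rightarrow> bool" where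
  "DF_well_posed k \<Omega> \<Gamma>u \<Gamma>p T \<kappa> F f C_DF C_DFu \<longleftrightarrow>
     (\<forall>\<phi>\<in>Pk k T.
        (\<exists>!(u, p). u \<in> RT0 k \<Omega> \<Gamma>u T \<and> p \<in> Pk k T \<and> DF_equations k \<Omega> \<Gamma>u T \<kappa> F (f \<phi>) u p) \<and>
        (\<forall>u\<in>RT0 k \<Omega> \<Gamma>u T. \<forall>p\<in>Pk k T. DF_equations k \<Omega> \<Gamma>u T \<kappa> F (f \<phi>) u p \<longrightarrow>
           norm_V \<Omega> T \<kappa> F u + norm_Q \<Omega> \<Gamma>p T \<kappa> F p
             \<le> C_DF * max (Lp_norm (lebesgue_on \<Omega>) 2 (f \<phi>)) ((Lp_norm (lebesgue_on \<Omega>) 2 (f \<phi>))\<^sup>2) \<and>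
           norm_V \<Omega> T \<kappa> F u \<le> C_DFu * Lp_norm (lebesgue_on \<Omega>) 2 (f \<phi>)))"

definition ADR_well_posed ::
  "nat \<Rightarrow> (real ^ 'n) set \<Rightarrow> (real ^ 'n) set \<Rightarrow> (real ^ 'n) set \<Rightarrow> (real ^ 'n) set set \<Rightarrow>
   real \<Rightarrow> real \<Rightarrow> (real ^ 'n \<Rightarrow> real) \<Rightarrow> real \<Rightarrow> bool" where
  "ADR_well_posed k \<Omega> \<Gamma>u \<Gamma>p T \<alpha> \<rho> m C_ADR \<longleftrightarrow>
     (\<forall>u\<in>RT0 k \<Omega> \<Gamma>u T.
        (\<exists>!(\<zeta>, \<phi>). \<zeta> \<in> RT0 k \<Omega> \<Gamma>p T \<and> \<phi> \<in> Pk k T \<and> ADR_equations k \<Omega> \<Gamma>p T \<alpha> \<rho> m u \<zeta> \<phi>) \<and>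
        (\<forall>\<zeta>\<in>RT0 k \<Omega> \<Gamma>p T. \<forall>\<phi>\<in>Pk k T. ADR_equations k \<Omega> \<Gamma>p T \<alpha> \<rho> m u \<zeta> \<phi> \<longrightarrow>
           norm_W \<Omega> T \<alpha> \<zeta> + norm_Psi \<Omega> \<Gamma>u T \<alpha> \<phi> \<le> C_ADR * Lp_norm (lebesgue_on \<Omega>) (6/5) m))"


section \<open>The constants in the Lipschitz bound\<close>

definition sobolev_embedding_constant ::
  "(real ^ 'n) set \<Rightarrow> (real ^ 'n) set \<Rightarrow> (real ^ 'n) set set \<Rightarrow> real \<Rightarrow> bool" where
  "sobolev_embedding_constant \<Omega> \<Gamma>u T C \<longleftrightarrow>
     (\<forall>\<psi>\<in>broken_W1 2 \<Omega> \<Gamma>u T. Lp_norm (lebesgue_on \<Omega>) 6 \<psi> \<le> C * broken_seminorm 2 T \<psi>)"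

definition ADR_form ::
  "(real ^ 'n) set \<Rightarrow> (real ^ 'n) set set \<Rightarrow> real \<Rightarrow> real \<Rightarrow>
   (real ^ 'n \<Rightarrow> real ^ 'n) \<Rightarrow> (real ^ 'n \<Rightarrow> real) \<Rightarrow>
   (real ^ 'n \<Rightarrow> real ^ 'n) \<Rightarrow> (real ^ 'n \<Rightarrow> real) \<Rightarrow> real" where
  "ADR_form \<Omega> T \<alpha> \<rho> \<zeta> \<phi> w \<psi> =
     (LINT x|lebesgue_on \<Omega>. inverse \<alpha> * (\<zeta> x \<bullet> w x)) +
     (LINT x|lebesgue_on \<Omega>. \<phi> x * divergence T w x) +
     (LINT x|lebesgue_on \<Omega>. \<psi> x * divergence T \<zeta> x) -
     (LINT x|lebesgue_on \<Omega>. \<rho> * \<phi> x * \<psi> x)"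

definition ADR_norm ::
  "(real ^ 'n) set \<Rightarrow> (real ^ 'n) set \<Rightarrow> (real ^ 'n) set set \<Rightarrow> real \<Rightarrow> real \<Rightarrow>
   (real ^ 'n \<Rightarrow> real ^ 'n) \<Rightarrow> (real ^ 'n \<Rightarrow> real) \<Rightarrow> real" where
  "ADR_norm \<Omega> \<Gamma>u T \<alpha> \<rho> w \<psi> =
     norm_W \<Omega> T \<alpha> w + norm_Psi \<Omega> \<Gamma>u T \<alpha> \<psi> + \<rho> powr (1/2) * Lp_norm (lebesgue_on \<Omega>) 2 \<psi>"

definition ADR_inf_sup_constant ::
  "nat \<Rightarrow> (real ^ 'n) set \<Rightarrow> (real ^ 'n) set \<Rightarrow> (real ^ 'n) set \<Rightarrow> (real ^ 'n) set set \<Rightarrow>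
   real \<Rightarrow> real \<Rightarrow> real \<Rightarrow> bool" where
  "ADR_inf_sup_constant k \<Omega> \<Gamma>u \<Gamma>p T \<alpha> \<rho> C \<longleftrightarrow>
     C > 0 \<and>
     (\<forall>\<zeta>\<in>RT0 k \<Omega> \<Gamma>p T. \<forall>\<phi>\<in>Pk k T.
        ereal (C * ADR_norm \<Omega> \<Gamma>u T \<alpha> \<rho> \<zeta> \<phi>) \<le>
        (SUP (w, \<psi>)\<in>{(w, \<psi>). w \<in> RT0 k \<Omega> \<Gamma>p T \<and> \<psi> \<in> Pk k T \<and> ADR_norm \<Omega> \<Gamma>u T \<alpha> \<rho> w \<psi> \<noteq> 0}.
           ereal (ADR_form \<Omega> T \<alpha> \<rho> \<zeta> \<phi> w \<psi> / ADR_norm \<Omega> \<Gamma>u T \<alpha> \<rho> w \<psi>)))"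

definition discretely_divergence_free ::
  "nat \<Rightarrow> (real ^ 'n) set \<Rightarrow> (real ^ 'n) set \<Rightarrow> (real ^ 'n) set set \<Rightarrow> (real ^ 'n \<Rightarrow> real ^ 'n) set" where
  "discretely_divergence_free k \<Omega> \<Gamma>u T =
     {v \<in> RT0 k \<Omega> \<Gamma>u T. \<forall>q\<in>Pk k T. (LINT x|lebesgue_on \<Omega>. q x * divergence T v x) = 0}"

definition DF_monotonicity_constant ::
  "nat \<Rightarrow> (real ^ 'n) set \<Rightarrow> (real ^ 'n) set \<Rightarrow> (real ^ 'n) set set \<Rightarrow> real \<Rightarrow> real \<Rightarrow> real \<Rightarrow> bool" where
  "DF_monotonicity_constant k \<Omega> \<Gamma>u T \<kappa> F a \<longleftrightarrow>
     a > 0 \<and>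
     (\<forall>u\<in>discretely_divergence_free k \<Omega> \<Gamma>u T. \<forall>v\<in>discretely_divergence_free k \<Omega> \<Gamma>u T.
        a * (norm_V \<Omega> T \<kappa> F (\<lambda>x. u x - v x))\<^sup>2 \<le>
        (LINT x|lebesgue_on \<Omega>.
           ((inverse \<kappa> *\<^sub>R u x + (F * norm (u x)) *\<^sub>R u x) -
            (inverse \<kappa> *\<^sub>R v x + (F * norm (v x)) *\<^sub>R v x)) \<bullet> (u x - v x)))"

definition lipschitz_factor ::
  "(real ^ 'n) set \<Rightarrow> real \<Rightarrow> real \<Rightarrow> (real ^ 'n \<Rightarrow> real) \<Rightarrow> real \<Rightarrow> real \<Rightarrow> real \<Rightarrow> real \<Rightarrow> real" where
  "lipschitz_factor \<Omega> \<alpha> F m \<alpha>1 C_emb C_d a_DF =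
     (let C\<alpha> = \<alpha> powr (-1/2) * (1 + C_emb * \<alpha> powr (-1/2))
      in 2 * C\<alpha> / (C_d * (C\<alpha> - F powr (-1/3))) * Lp_norm (lebesgue_on \<Omega>) (6/5) m *
         a_DF powr (-1/2) * \<alpha>1)"

text \<open>In the a priori bound of the theorem the constant \<open>C\<close> plays the role of the velocity
  stability constant \<open>C_DFu\<close>. Like \<open>C_DFu\<close> it is an upper bound that may be enlarged and does
  not depend on \<open>\<kappa>\<close>, \<open>F\<close>, \<open>\<rho>\<close> or the mesh. It has to dominate \<open>C_DF\<close>, because the bound includes
  the pressure, and \<open>max 1 (C_emb * \<alpha> powr (-1/2))\<close>, the constant in the estimate of the \<open>L\<^sup>6\<close>
  norm by \<^const>\<open>norm_Psi\<close>.\<close>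

end

theory Submission
  imports Defs "HOL-Library.Function_Algebras"
begin

text \<open>The solution map \<open>S = S_DF \<circ> S_ADR\<close> is a contraction of the velocity space, which is finite
  dimensional and therefore complete for the norm \<^const>\<open>norm_V\<close>. Its unique fixed point is the
  velocity of the unique solution; the other components follow from the unique solvability of the two
  decoupled problems.

  The a priori bound needs the estimate of the \<open>L\<^sup>6\<close> norm by \<^const>\<open>norm_Psi\<close>. The embedding
  constant controls every decomposition in the infimum, but there has to be one, since \<open>Inf {}\<close> is
  an arbitrary real. The decomposition \<open>\<phi> + 0\<close> is admissible because the zero function has zero trace:
  traces are limits picked by \<open>SOME\<close>, so this amounts to a trace inequality, and the Hausdorff measure
  on a facet has to be compared with the Lebesgue measure on an adjacent part of the element.\<close>

section \<open>Comparison of Hausdorff and Lebesgue measure\<close>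

text \<open>The trace inequality pushes a piece of the facet into the element along one fixed
  vector, and no such vector serves a whole facet: near some part of its relative boundary the
  shifted point leaves the simplex. The facet is therefore split into finitely many closed pieces,
  one for each of its vertices \<open>v\<close>, on which a shift by a multiple of
  \<open>u - v\<close> stays inside, \<open>u\<close> being the opposite vertex. Surface measure is
  estimated from above only, by the volume swept out by such a shift. The weak gradient of zero is
  itself picked by \<open>SOME\<close>, so it first has to be shown to vanish almost everywhere. The
  discrete spaces depend on the mesh and stay sets of functions. Their norms satisfy the norm axioms
  only on these sets, which is why completeness is derived directly, by adding one basis vector at a
  time. In the final bound the lower bounds on \<open>C\<close> have separate origins:
  \<open>C \<ge> 1\<close> and \<open>C \<ge> C_emb * \<alpha> powr (-1/2)\<close> come from the two
  summands in \<open>norm_Psi\<close>, and \<open>C \<ge> C_DF\<close> from the pressure.\<close>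

lemma cube_cover:
  fixes A :: "'a::euclidean_space set"
  assumes A: "A \<in> sets borel" "bounded A" and "\<delta> > 0" "\<epsilon> > 0"
  obtains Q :: "nat \<Rightarrow> 'a set" where
    "A \<subseteq> (\<Union>i. Q i)" "\<And>i. compact (Q i)" "\<And>i. diameter (Q i) \<le> \<delta>"
    "\<And>i. diameter (Q i) ^ DIM('a) \<le> real DIM('a) ^ DIM('a) * measure lborel (Q i)"
    "(\<Sum>i. emeasure lborel (Q i)) \<le> emeasure lborel A + ennreal \<epsilon>"
proof -
  obtain O' where O': "open O'" "A \<subseteq> O'" "emeasure lborel (O' - A) < \<epsilon>"
    using outer_regular_lborel[OF A(1) \<open>\<epsilon> > 0\<close>] by blast
  obtain r where r: "r > 0" "\<And>x. x \<in> A \<Longrightarrow> norm x \<le> r"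
    using A(2) unfolding bounded_pos by blast
  define b :: 'a where "b = r *\<^sub>R One"
  have bi: "b \<bullet> i = r" if "i \<in> Basis" for i using that by (simp add: b_def)
  have "A \<subseteq> cbox (-b) b"
  proof
    fix x assume "x \<in> A"
    then have "\<bar>x \<bullet> i\<bar> \<le> r" if "i \<in> Basis" for i
      using r(2) Basis_le_norm[OF that, of x] by force
    then show "x \<in> cbox (-b) b" by (simp add: mem_box bi abs_le_iff minus_le_iff)
  qed
  moreover have "box (-b) b \<noteq> {}" using r(1) by (simp add: box_ne_empty bi)
  \<comment> \<open>The tags lie in \<open>A\<close>, so the radius \<open>\<delta>/2\<close> bounds
    the diameter of a cell and the intersection with \<open>O'\<close> keeps the cell in the open
    superset. The value off \<open>A\<close> only makes \<open>g\<close> a gauge.\<close>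
  moreover define g where "g x = (if x \<in> A then ball x (\<delta>/2) \<inter> O' else ball x 1)" for x
  have "gauge g"
    using O' \<open>\<delta> > 0\<close> by (auto simp: gauge_def g_def)
  ultimately obtain D where D: "countable D"
      "\<And>K. K \<in> D \<Longrightarrow> interior K \<noteq> {} \<and> (\<exists>c d. K = cbox c d)"
      "pairwise (\<lambda>A B. interior A \<inter> interior B = {}) D"
      "\<And>K. K \<in> D \<Longrightarrow> \<exists>x \<in> A \<inter> K. K \<subseteq> g x"
      "\<And>u v. cbox u v \<in> D \<Longrightarrow> \<exists>n. \<forall>i \<in> Basis. v \<bullet> i - u \<bullet> i = (b \<bullet> i - (-b) \<bullet> i) / 2^n"
      "A \<subseteq> \<Union>D"
    using covering_lemma[of A "-b" b g] by metis
  \<comment> \<open>Indices that enumerate no cell give the empty set. Thus no cell is repeated, and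
    the interiors for distinct indices stay disjoint.\<close>
  define Q where "Q i = (if i \<in> to_nat_on D ` D then from_nat_into D i else {})" for i
  have Qcases: "Q i = {} \<or> Q i \<in> D" for i
    using D(1) by (auto simp: Q_def)
  have Qin: "\<exists>i. Q i = K" if "K \<in> D" for K
    using that D(1) by (intro exI[of _ "to_nat_on D K"]) (auto simp: Q_def)
  have Qdisj: "interior (Q i) \<inter> interior (Q j) = {}" if "i \<noteq> j" for i j
  proof (cases "i \<in> to_nat_on D ` D \<and> j \<in> to_nat_on D ` D")
    case True
    then obtain K L where "K \<in> D" "L \<in> D" "i = to_nat_on D K" "j = to_nat_on D L" by auto
    then show ?thesis using D(1,3) that by (auto simp: Q_def pairwise_def)
  qed (auto simp: Q_def)
  have Qsub: "Q i \<subseteq> O'" for i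
    using Qcases[of i] D(4)[of "Q i"] by (auto simp: g_def)
  have compQ: "compact (Q i)" for i
    using Qcases[of i] D(2)[of "Q i"] by (auto)
  have diam: "diameter (Q i) \<le> \<delta>" for i
  proof (cases "Q i = {}")
    case False
    then obtain x where x: "x \<in> A" "Q i \<subseteq> g x" using Qcases[of i] D(4)[of "Q i"] by auto
    then have "Q i \<subseteq> ball x (\<delta>/2)" by (auto simp: g_def)
    then have "diameter (Q i) \<le> diameter (ball x (\<delta>/2))"
      by (intro diameter_subset) auto
    then show ?thesis using \<open>\<delta> > 0\<close> by simp
  qed (use \<open>\<delta> > 0\<close> in auto)
  have cube: "diameter (Q i) ^ DIM('a) \<le> real DIM('a) ^ DIM('a) * measure lborel (Q i)
      \<and> emeasure lborel (Q i) = emeasure lborel (interior (Q i))" for i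
  proof (cases "Q i = {}")
    case False
    then have QD: "Q i \<in> D" using Qcases by blast
    then obtain u v where uv: "Q i = cbox u v" "interior (Q i) \<noteq> {}" using D(2) by blast
    obtain n where n: "\<And>k. k \<in> Basis \<Longrightarrow> v \<bullet> k - u \<bullet> k = (b \<bullet> k - (-b) \<bullet> k) / 2^n"
      using D(5)[of u v] QD uv by auto
    \<comment> \<open>All coordinates of \<open>b\<close> are equal, so a dyadic cell has the same
      side \<open>l\<close> in every direction: it is a cube of diameter at most
      \<open>DIM('a) * l\<close> and volume \<open>l ^ DIM('a)\<close>, whence the factor in the
      statement.\<close>
    define l where "l = 2 * r / 2^n"
    have l: "v \<bullet> k - u \<bullet> k = l" if "k \<in> Basis" for k using n[OF that] that by (simp add: bi l_def)
    have "l > 0" using r by (simp add: l_def)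
    then have le: "u \<bullet> k \<le> v \<bullet> k" if "k \<in> Basis" for k using l[OF that] by simp
    have "diameter (Q i) = norm (v - u)"
      unfolding uv using le by (simp add: diameter_cbox dist_norm norm_minus_commute)
    also have "\<dots> \<le> (\<Sum>k\<in>Basis. \<bar>(v - u) \<bullet> k\<bar>)" by (rule norm_le_l1)
    also have "\<dots> = real DIM('a) * l" using l \<open>l > 0\<close> by (simp add: inner_diff_left)
    finally have "diameter (Q i) ^ DIM('a) \<le> (real DIM('a) * l) ^ DIM('a)"
      by (intro power_mono diameter_ge_0) (use uv in auto)
    moreover have "measure lborel (Q i) = l ^ DIM('a)"
      unfolding uv using le l by (simp add: measure_lborel_cbox_eq inner_diff_left)
    moreover have "emeasure lborel (Q i) = emeasure lborel (interior (Q i))"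
      unfolding uv interior_cbox using le by (simp add: emeasure_lborel_cbox_eq emeasure_lborel_box_eq)
    ultimately show ?thesis by (simp add: power_mult_distrib)
  qed (simp add: power_0_left)
  \<comment> \<open>Closed cubes may share faces. Their interiors have the same volume and are
    disjoint subsets of \<open>O'\<close>, so the total volume is at most that of
    \<open>O'\<close>.\<close>
  have "(\<Sum>i. emeasure lborel (Q i)) = (\<Sum>i. emeasure lborel (interior (Q i)))"
    using cube by simp
  also have "\<dots> = emeasure lborel (\<Union>i. interior (Q i))"
    by (intro suminf_emeasure) (use Qdisj in \<open>auto simp: disjoint_family_on_def\<close>)
  also have "\<dots> \<le> emeasure lborel O'"
    using Qsub interior_subset O'(1) by (intro emeasure_mono) (blast, auto)
  also have "\<dots> = emeasure lborel A + emeasure lborel (O' - A)"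
    using A(1) O' by (subst plus_emeasure) (auto intro!: arg_cong2[where f=emeasure])
  also have "\<dots> \<le> emeasure lborel A + \<epsilon>"
    using O'(3) by (intro add_left_mono) auto
  finally have "(\<Sum>i. emeasure lborel (Q i)) \<le> emeasure lborel A + ennreal \<epsilon>" .
  moreover have "A \<subseteq> (\<Union>i. Q i)"
  proof
    fix x assume "x \<in> A"
    then obtain K where "K \<in> D" "x \<in> K" using D(6) by blast
    then show "x \<in> (\<Union>i. Q i)" using Qin[of K] by auto
  qed
  ultimately show ?thesis using that compQ diam cube by metis
qed

lemma hausdorff_outer_leI:
  assumes "\<And>\<delta> \<epsilon>. \<delta> > 0 \<Longrightarrow> \<epsilon> > 0 \<Longrightarrow>
    \<exists>U. A \<subseteq> (\<Union>i. U i) \<and> (\<forall>i. bounded (U i) \<and> diameter (U i) \<le> \<delta>) \<and>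
       (\<Sum>i. ennreal (unit_ball_vol (real s) / 2 ^ s * diameter (U i) ^ s)) \<le> B + ennreal \<epsilon>"
  shows "hausdorff_outer s A \<le> B"
  unfolding hausdorff_outer_def
proof (rule SUP_least)
  fix \<delta> :: real assume "\<delta> \<in> {0<..}"
  show "(INF U\<in>{U. A \<subseteq> (\<Union>i. U i) \<and> (\<forall>i. bounded (U i) \<and> diameter (U i) \<le> \<delta>)}.
      (\<Sum>i. ennreal (unit_ball_vol (real s) / 2 ^ s * diameter (U i) ^ s))) \<le> B"
  proof (rule ennreal_le_epsilon)
    fix \<epsilon> :: real assume "\<epsilon> > 0"
    then obtain U where "A \<subseteq> (\<Union>i. U i)" "\<forall>i. bounded (U i) \<and> diameter (U i) \<le> \<delta>"
      and "(\<Sum>i. ennreal (unit_ball_vol (real s) / 2 ^ s * diameter (U i) ^ s)) \<le> B + ennreal \<epsilon>"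
      using assms[of \<delta> \<epsilon>] \<open>\<delta> \<in> {0<..}\<close> by auto
    then show "(INF U\<in>{U. A \<subseteq> (\<Union>i. U i) \<and> (\<forall>i. bounded (U i) \<and> diameter (U i) \<le> \<delta>)}.
      (\<Sum>i. ennreal (unit_ball_vol (real s) / 2 ^ s * diameter (U i) ^ s))) \<le> B + ennreal \<epsilon>"
      by (intro INF_lower2[of U]) auto
  qed
qed

text \<open>For \<open>E\<close> in the hyperplane \<open>\<nu> \<bullet> x = c\<close> and
  \<open>\<nu> \<bullet> e = 1\<close> these are the points \<open>y + s *\<^sub>R e\<close> with
  \<open>y\<close> in \<open>E\<close> and \<open>s\<close> in the unit interval. The height
  \<open>s\<close> is recovered as \<open>\<nu> \<bullet> x - c\<close>, which makes membership a
  measurable condition instead of an image.\<close>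

definition cylinder :: "'a::real_inner \<Rightarrow> real \<Rightarrow> 'a \<Rightarrow> 'a set \<Rightarrow> 'a set" where
  "cylinder \<nu> c e E = {x. 0 \<le> \<nu> \<bullet> x - c \<and> \<nu> \<bullet> x - c \<le> 1 \<and> x - (\<nu> \<bullet> x - c) *\<^sub>R e \<in> E}"

lemma cylinder_borel [measurable]:
  fixes E :: "'a::euclidean_space set"
  assumes [measurable]: "E \<in> sets borel"
  shows "cylinder \<nu> c e E \<in> sets borel"
  unfolding cylinder_def by measurable

lemma cylinder_bounded:
  fixes E :: "'a::euclidean_space set"
  assumes "bounded E"
  shows "bounded (cylinder \<nu> c e E)"
proof -
  obtain r where r: "\<And>x. x \<in> E \<Longrightarrow> norm x \<le> r" using assms unfolding bounded_iff by blast
  have "norm x \<le> r + norm e" if "x \<in> cylinder \<nu> c e E" for x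
  proof -
    have "x = (x - (\<nu> \<bullet> x - c) *\<^sub>R e) + (\<nu> \<bullet> x - c) *\<^sub>R e" by simp
    then have "norm x \<le> norm (x - (\<nu> \<bullet> x - c) *\<^sub>R e) + norm ((\<nu> \<bullet> x - c) *\<^sub>R e)"
      by (metis norm_triangle_ineq)
    also have "\<dots> \<le> r + 1 * norm e"
      using that r unfolding cylinder_def norm_scaleR by (intro add_mono mult_right_mono) auto
    finally show ?thesis by simp
  qed
  then show ?thesis unfolding bounded_iff by blast
qed

text \<open>Almost optimal covers of the cylinder over \<open>E\<close> by small cubes are cut by the translates of
  the hyperplane containing \<open>E\<close>; the average slice is a good cover of \<open>E\<close>.\<close>

lemma hausdorff_outer_le_cylinder:
  fixes \<nu> e :: "'a::euclidean_space"
  assumes "\<nu> \<bullet> e = 1" "DIM('a) \<ge> 2"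
  obtains C :: real where "C \<ge> 0"
    "\<And>E. E \<in> sets borel \<Longrightarrow> bounded E \<Longrightarrow> E \<subseteq> {x. \<nu> \<bullet> x = c} \<Longrightarrow>
       hausdorff_outer (DIM('a) - 1) E \<le> ennreal C * emeasure lborel (cylinder \<nu> c e E)"
proof -
  define d where "d = DIM('a)"
  define w where "w = unit_ball_vol (real (d - 1)) / 2 ^ (d - 1)"
  have w: "w \<ge> 0" by (simp add: w_def)
  \<comment> \<open>\<open>w\<close> is the Hausdorff normalisation, \<open>real d ^ d\<close>
    compares the diameter of a cube with its volume, and a set of diameter \<open>l\<close> occupies
    heights in an interval of length at most \<open>2 * norm \<nu> * l\<close>.\<close>
  define C where "C = 2 * norm \<nu> * w * real d ^ d"
  have C: "C \<ge> 0" using w by (simp add: C_def)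
  have "hausdorff_outer (d - 1) E \<le> ennreal C * emeasure lborel (cylinder \<nu> c e E)"
    if E: "E \<in> sets borel" "bounded E" "E \<subseteq> {x. \<nu> \<bullet> x = c}" for E
  proof (rule hausdorff_outer_leI)
    fix \<delta> \<epsilon> :: real assume pos: "\<delta> > 0" "\<epsilon> > 0"
    define Z where "Z = cylinder \<nu> c e E"
    \<comment> \<open>Dividing by \<open>2 * (C + 1)\<close> gives the strict inequality
      \<open>C * \<epsilon>' < \<epsilon>\<close> also for \<open>C = 0\<close>; strictness is what
      later allows a good slice to be selected.\<close>
    define \<epsilon>' where "\<epsilon>' = \<epsilon> / (2 * (C + 1))"
    have \<epsilon>': "\<epsilon>' > 0" "C * \<epsilon>' < \<epsilon>" using pos C by (auto simp: \<epsilon>'_def field_simps intro!: add_nonneg_pos)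
    have "emeasure lborel Z < \<infinity>"
      using cylinder_bounded[OF E(2)] unfolding Z_def by (intro emeasure_bounded_finite)
    then have Zfin: "emeasure lborel Z = ennreal (measure lborel Z)"
      by (simp add: emeasure_eq_ennreal_measure)
    obtain Q :: "nat \<Rightarrow> 'a set" where Q: "Z \<subseteq> (\<Union>i. Q i)" "\<And>i. compact (Q i)" "\<And>i. diameter (Q i) \<le> \<delta>"
        "\<And>i. diameter (Q i) ^ d \<le> real d ^ d * measure lborel (Q i)"
        "(\<Sum>i. emeasure lborel (Q i)) \<le> emeasure lborel Z + ennreal \<epsilon>'"
      using cube_cover[of Z \<delta> \<epsilon>'] pos \<epsilon>' E cylinder_bounded[OF E(2), of \<nu> c e]
      unfolding Z_def d_def by (metis cylinder_borel)
    define J where "J i = (\<lambda>x. \<nu> \<bullet> x - c) ` Q i" for i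
    have compJ: "compact (J i)" for i
      unfolding J_def by (intro compact_continuous_image Q continuous_intros)
    then have [measurable]: "J i \<in> sets borel" for i by (intro borel_compact)
    have emJ: "emeasure lborel (J i) \<le> ennreal (2 * norm \<nu> * diameter (Q i))" for i
    proof (cases "Q i = {}")
      case False
      then obtain x where x: "x \<in> Q i" by blast
      define t where "t = \<nu> \<bullet> x - c"
      define l where "l = norm \<nu> * diameter (Q i)"
      have "J i \<subseteq> {t - l .. t + l}"
      proof
        fix s assume "s \<in> J i"
        then obtain y where y: "y \<in> Q i" "s = \<nu> \<bullet> y - c" by (auto simp: J_def)
        have "\<bar>s - t\<bar> = \<bar>\<nu> \<bullet> (y - x)\<bar>" by (simp add: y t_def inner_diff_right)
        also have "\<dots> \<le> norm \<nu> * norm (y - x)" by (rule Cauchy_Schwarz_ineq2)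
        also have "\<dots> \<le> l" unfolding l_def
          using diameter_bounded_bound[OF compact_imp_bounded[OF Q(2)] y(1) x]
          by (intro mult_left_mono) (auto simp: dist_norm)
        finally show "s \<in> {t - l .. t + l}" by (auto simp: abs_le_iff)
      qed
      then have "emeasure lborel (J i) \<le> emeasure lborel {t - l .. t + l}"
        by (intro emeasure_mono) auto
      moreover have "l \<ge> 0" unfolding l_def
        using diameter_ge_0[OF compact_imp_bounded[OF Q(2)]] by simp
      ultimately show ?thesis by (simp add: l_def mult.assoc)
    qed (simp add: J_def)
    \<comment> \<open>The Hausdorff sum of those cubes that meet the slice at height
      \<open>s\<close>. Integrating over \<open>s\<close> multiplies each term by the length of
      \<open>J i\<close>, which supplies the missing power of the diameter and turns the sum into
      one of volumes.\<close>
    define h where "h s = (\<Sum>i. ennreal (w * diameter (Q i) ^ (d - 1)) * indicator (J i) s)" for s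
    have [measurable]: "h \<in> borel_measurable borel" unfolding h_def by measurable
    have dd: "Suc (d - 1) = d" using assms(2) by (simp add: d_def)
    have "(\<integral>\<^sup>+s. h s \<partial>lborel) = (\<Sum>i. ennreal (w * diameter (Q i) ^ (d - 1)) * emeasure lborel (J i))"
      unfolding h_def by (subst nn_integral_suminf) (auto simp: nn_integral_cmult_indicator)
    also have "\<dots> \<le> (\<Sum>i. ennreal C * emeasure lborel (Q i))"
    proof (rule suminf_le)
      fix i
      have dp: "diameter (Q i) \<ge> 0" using diameter_ge_0[OF compact_imp_bounded[OF Q(2)]] by simp
      have "ennreal (w * diameter (Q i) ^ (d - 1)) * emeasure lborel (J i)
          \<le> ennreal (w * diameter (Q i) ^ (d - 1)) * ennreal (2 * norm \<nu> * diameter (Q i))"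
        by (intro mult_left_mono emJ) auto
      also have "\<dots> = ennreal (2 * norm \<nu> * w * diameter (Q i) ^ d)"
        using dp w power_Suc[of "diameter (Q i)" "d - 1", unfolded dd]
        by (subst ennreal_mult[symmetric]) (simp_all add: mult_ac)
      also have "\<dots> \<le> ennreal (C * measure lborel (Q i))"
        using mult_left_mono[OF Q(4)[of i], of "2 * norm \<nu> * w"] w
        by (intro ennreal_leI) (simp add: C_def mult_ac)
      also have "\<dots> = ennreal C * emeasure lborel (Q i)"
        using C emeasure_compact_finite[OF Q(2)[of i]]
        by (simp add: ennreal_mult emeasure_eq_ennreal_measure)
      finally show "ennreal (w * diameter (Q i) ^ (d - 1)) * emeasure lborel (J i)
          \<le> ennreal C * emeasure lborel (Q i)" .
    qed auto
    also have "\<dots> = ennreal C * (\<Sum>i. emeasure lborel (Q i))" by simp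
    also have "\<dots> \<le> ennreal C * (emeasure lborel Z + ennreal \<epsilon>')"
      by (intro mult_left_mono Q) auto
    also have "\<dots> = ennreal (C * measure lborel Z + C * \<epsilon>')"
      using C \<epsilon>' by (simp add: Zfin distrib_left ennreal_mult ennreal_plus)
    also have "\<dots> < ennreal (C * measure lborel Z + \<epsilon>)"
      using C \<epsilon>' pos by (intro ennreal_lessI) (auto intro: add_nonneg_pos)
    finally have hint: "(\<integral>\<^sup>+s. h s \<partial>lborel) < ennreal (C * measure lborel Z + \<epsilon>)" .
    \<comment> \<open>Over an interval of length 1 the function cannot be everywhere at least a
      number that exceeds its integral.\<close>
    have "\<exists>s\<in>{0..1}. h s < ennreal (C * measure lborel Z + \<epsilon>)"
    proof (rule ccontr)
      assume "\<not> ?thesis"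
      then have "(\<integral>\<^sup>+s. ennreal (C * measure lborel Z + \<epsilon>) * indicator {0..1::real} s \<partial>lborel)
          \<le> (\<integral>\<^sup>+s. h s \<partial>lborel)"
        by (intro nn_integral_mono) (auto simp: not_less indicator_def)
      with hint show False by (simp add: nn_integral_cmult_indicator)
    qed
    then obtain s where s: "0 \<le> s" "s \<le> 1" "h s < ennreal (C * measure lborel Z + \<epsilon>)" by auto
    \<comment> \<open>Cubes that meet the slice are moved back to the hyperplane. The others become
      empty, with diameter 0, and since \<open>0 ^ (d - 1) = 0\<close> for \<open>d \<ge> 2\<close>
      they drop out of the sum, which is then exactly \<open>h s\<close>.\<close>
    define U where "U i = (if s \<in> J i then (\<lambda>x. x - s *\<^sub>R e) ` Q i else {})" for i
    have diam: "diameter ((\<lambda>x. x - s *\<^sub>R e) ` Q i) = diameter (Q i)" for i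
    proof -
      have "(\<lambda>x. x - s *\<^sub>R e) ` Q i \<times> (\<lambda>x. x - s *\<^sub>R e) ` Q i
          = map_prod (\<lambda>x. x - s *\<^sub>R e) (\<lambda>x. x - s *\<^sub>R e) ` (Q i \<times> Q i)"
        by (simp add: map_prod_surj_on)
      then show ?thesis
        unfolding diameter_def by (simp add: image_image case_prod_unfold dist_norm)
    qed
    show "\<exists>U. E \<subseteq> (\<Union>i. U i) \<and> (\<forall>i. bounded (U i) \<and> diameter (U i) \<le> \<delta>) \<and>
       (\<Sum>i. ennreal (unit_ball_vol (real (d - 1)) / 2 ^ (d - 1) * diameter (U i) ^ (d - 1)))
         \<le> ennreal C * emeasure lborel (cylinder \<nu> c e E) + ennreal \<epsilon>"
    proof (intro exI[of _ U] conjI allI)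
      show "E \<subseteq> (\<Union>i. U i)"
      proof
        fix y assume y: "y \<in> E"
        then have "\<nu> \<bullet> (y + s *\<^sub>R e) - c = s"
          using E(3) assms(1) by (auto simp: inner_add_right)
        moreover from this have "y + s *\<^sub>R e \<in> Z"
          using s y by (simp add: Z_def cylinder_def)
        then obtain i where i: "y + s *\<^sub>R e \<in> Q i" using Q(1) by blast
        ultimately have "s \<in> J i" unfolding J_def by (metis image_eqI)
        then have "y \<in> U i" using i unfolding U_def by (auto simp: image_iff intro!: bexI[of _ "y + s *\<^sub>R e"])
        then show "y \<in> (\<Union>i. U i)" by blast
      qed
      show "bounded (U i)" for i
        using compact_imp_bounded[OF Q(2)[of i]] bounded_translation_minus[of "Q i" "s *\<^sub>R e"]
        by (simp add: U_def)
      show "diameter (U i) \<le> \<delta>" for i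
        using Q(3)[of i] pos by (simp add: U_def diam)
      have "(\<Sum>i. ennreal (unit_ball_vol (real (d - 1)) / 2 ^ (d - 1) * diameter (U i) ^ (d - 1))) = h s"
        unfolding h_def using dd assms(2)
        by (intro suminf_cong) (auto simp: U_def diam w_def indicator_def d_def)
      also have "\<dots> \<le> ennreal (C * measure lborel Z + \<epsilon>)" using s by simp
      also have "\<dots> = ennreal C * emeasure lborel (cylinder \<nu> c e E) + ennreal \<epsilon>"
        using C pos by (simp add: Zfin[unfolded Z_def] Z_def ennreal_mult ennreal_plus)
      finally show "(\<Sum>i. ennreal (unit_ball_vol (real (d - 1)) / 2 ^ (d - 1) * diameter (U i) ^ (d - 1)))
         \<le> ennreal C * emeasure lborel (cylinder \<nu> c e E) + ennreal \<epsilon>" .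
    qed
  qed
  then show ?thesis using that[of C] C unfolding d_def by blast
qed

section \<open>Weak gradients of the zero function\<close>

lemma C1_function_continuous: "C1_function \<phi> d\<phi> \<Longrightarrow> continuous_on UNIV \<phi>"
  unfolding C1_function_def by (rule has_derivative_continuous_on) blast

lemma C1_function_mult:
  assumes "C1_function \<phi> d\<phi>" "C1_function \<psi> d\<psi>"
  shows "C1_function (\<lambda>x. \<phi> x * \<psi> x) (\<lambda>x. \<phi> x *\<^sub>R d\<psi> x + \<psi> x *\<^sub>R d\<phi> x)"
proof -
  have d: "(\<phi> has_derivative (\<lambda>h. d\<phi> x \<bullet> h)) (at x)" "(\<psi> has_derivative (\<lambda>h. d\<psi> x \<bullet> h)) (at x)" for x
    using assms by (auto simp: C1_function_def)
  have "continuous_on UNIV \<phi>" "continuous_on UNIV \<psi>"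
    using assms by (auto intro: C1_function_continuous)
  moreover have "((\<lambda>x. \<phi> x * \<psi> x) has_derivative (\<lambda>h. (\<phi> x *\<^sub>R d\<psi> x + \<psi> x *\<^sub>R d\<phi> x) \<bullet> h)) (at x)" for x
    using has_derivative_mult[OF d] by (simp add: inner_add_left algebra_simps)
  ultimately show ?thesis
    using assms by (auto simp: C1_function_def intro!: continuous_intros)
qed

lemma C1_function_compose:
  assumes "C1_function \<phi> d\<phi>" "\<And>x. (\<theta> has_real_derivative \<theta>' (\<phi> x)) (at (\<phi> x))"
    "continuous_on (range \<phi>) \<theta>'"
  shows "C1_function (\<lambda>x. \<theta> (\<phi> x)) (\<lambda>x. \<theta>' (\<phi> x) *\<^sub>R d\<phi> x)"
proof -
  have d: "(\<phi> has_derivative (\<lambda>h. d\<phi> x \<bullet> h)) (at x)" for x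
    using assms by (auto simp: C1_function_def)
  have "continuous_on UNIV \<phi>" using assms(1) by (rule C1_function_continuous)
  then have "continuous_on UNIV (\<lambda>x. \<theta>' (\<phi> x))"
    by (rule continuous_on_compose2[OF assms(3)]) auto
  moreover have "((\<lambda>x. \<theta> (\<phi> x)) has_derivative (\<lambda>h. (\<theta>' (\<phi> x) *\<^sub>R d\<phi> x) \<bullet> h)) (at x)" for x
    using has_derivative_compose[OF d assms(2)[unfolded has_field_derivative_def]] by simp
  ultimately show ?thesis
    using assms(1) by (auto simp: C1_function_def intro!: continuous_intros)
qed

lemma C1_function_prod:
  assumes "finite I" "\<And>i. i \<in> I \<Longrightarrow> \<exists>d\<phi>. C1_function (\<phi> i) d\<phi>"
  shows "\<exists>d\<phi>. C1_function (\<lambda>x. \<Prod>i\<in>I. \<phi> i x) d\<phi>"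
  using assms
proof (induction I)
  case empty
  have "C1_function (\<lambda>x. 1) (\<lambda>x. 0)" by (simp add: C1_function_def)
  then show ?case by auto
next
  case (insert i I)
  then obtain d1 d2 where "C1_function (\<phi> i) d1" "C1_function (\<lambda>x. \<Prod>i\<in>I. \<phi> i x) d2" by blast
  from C1_function_mult[OF this] show ?case using insert.hyps by auto
qed

text \<open>Squaring removes the kink of the positive part at 0; this is what makes the bump
  function below C1 across the faces of its box.\<close>

lemma has_real_derivative_max_0_square:
  "((\<lambda>t. (max 0 t)\<^sup>2) has_real_derivative 2 * max 0 t) (at t)"
proof -
  consider "t > 0" | "t < 0" | "t = 0" by linarith
  then show ?thesis
  proof cases
    case 1
    have "((\<lambda>t. t\<^sup>2) has_real_derivative 2 * max 0 t) (at t)"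
      using 1 by (auto intro!: derivative_eq_intros)
    then show ?thesis
      by (rule DERIV_cong_ev[THEN iffD1, rotated -1])
         (use 1 in \<open>auto intro: eventually_mono[OF eventually_nhds_in_open[of "{0<..}"]]\<close>)
  next
    case 2
    have "((\<lambda>t. 0) has_real_derivative 2 * max 0 t) (at t)"
      using 2 by (auto intro!: derivative_eq_intros)
    then show ?thesis
      by (rule DERIV_cong_ev[THEN iffD1, rotated -1])
         (use 2 in \<open>auto intro: eventually_mono[OF eventually_nhds_in_open[of "{..<0}"]]\<close>)
  next
    case 3
    have "(\<lambda>h. (max 0 h)\<^sup>2 / h) \<midarrow>0\<rightarrow> (0::real)"
    proof (rule Lim_null_comparison)
      show "\<forall>\<^sub>F h in at 0. norm ((max 0 h)\<^sup>2 / h) \<le> \<bar>h::real\<bar>"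
        by (auto simp: max_def power2_eq_square intro!: always_eventually)
      show "((\<lambda>h::real. \<bar>h\<bar>) \<longlongrightarrow> 0) (at 0)" by (intro tendsto_rabs_zero tendsto_ident_at)
    qed
    then show ?thesis using 3 by (simp add: DERIV_def)
  qed
qed

text \<open>A product over the coordinates of squared distances to the two faces, each cut off at 0.
  C1 regularity is enough because \<open>test_function\<close> asks for no more.\<close>

lemma C1_bump:
  fixes a b :: "real ^ 'n"
  obtains w d where "C1_function w d" "\<And>x. w x \<ge> 0" "\<And>x. w x > 0 \<longleftrightarrow> x \<in> box a b"
proof -
  define p where "p i x = (max 0 (x $ i - a $ i))\<^sup>2 * (max 0 (b $ i - x $ i))\<^sup>2" for i and x :: "real ^ 'n"
  have "\<exists>d. C1_function (p i) d" for i
  proof -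
    have 1: "C1_function (\<lambda>x. x $ i - a $ i) (\<lambda>_. axis i 1)" "C1_function (\<lambda>x. b $ i - x $ i) (\<lambda>_. - axis i 1)"
      unfolding C1_function_def
      by (auto intro!: derivative_eq_intros bounded_linear.has_derivative[OF bounded_linear_vec_nth] simp: inner_axis' inner_minus_left)
    have 2: "C1_function (\<lambda>x. (max 0 (\<phi> x))\<^sup>2) (\<lambda>x. (2 * max 0 (\<phi> x)) *\<^sub>R d\<phi> x)"
      if "C1_function \<phi> d\<phi>" for \<phi> :: "real ^ 'n \<Rightarrow> real" and d\<phi>
      by (rule C1_function_compose[OF that has_real_derivative_max_0_square])
         (intro continuous_intros)
    show ?thesis unfolding p_def using C1_function_mult[OF 2[OF 1(1)] 2[OF 1(2)]] by blast
  qed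
  then obtain d where "C1_function (\<lambda>x. \<Prod>i\<in>UNIV. p i x) d"
    using C1_function_prod[of UNIV p] by auto
  moreover have "p i x > 0 \<longleftrightarrow> a $ i < x $ i \<and> x $ i < b $ i" for i x
    by (auto simp: p_def zero_less_mult_iff)
  moreover have "p i x \<ge> 0" for i x by (simp add: p_def)
  ultimately show ?thesis
    by (intro that[of "\<lambda>x. \<Prod>i\<in>UNIV. p i x" d])
       (auto simp: mem_box_cart prod_nonneg less_le prod_zero_iff)
qed

section \<open>The fundamental lemma of the calculus of variations\<close>

lemma sigma_finite_lebesgue: "sigma_finite_measure (lebesgue :: 'a::euclidean_space measure)"
proof
  obtain A :: "'a set set" where "countable A" "A \<subseteq> sets lborel" "\<Union>A = space lborel" "\<forall>a\<in>A. emeasure lborel a \<noteq> \<infinity>"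
    using lborel.sigma_finite_countable by metis
  then show "\<exists>A::'a set set. countable A \<and> A \<subseteq> sets lebesgue \<and> \<Union>A = space lebesgue \<and> (\<forall>a\<in>A. emeasure lebesgue a \<noteq> \<infinity>)"
    by (intro exI[of _ A]) (auto simp: subset_iff)
qed

text \<open>Dynkin's argument: the boxes are stable under intersection and generate the Borel sets,
  and the vanishing total integral serves the complement step. A Lebesgue set differs from a Borel
  subset by a null set, so all set integrals vanish.\<close>

lemma AE_eq_0_if_integral_box_eq_0:
  fixes f :: "real ^ 'n \<Rightarrow> 'b::{second_countable_topology, banach}"
  assumes f: "integrable lebesgue f" "(LINT x|lebesgue. f x) = 0"
    and box: "\<And>a b. set_lebesgue_integral lebesgue (box a b) f = 0"
  shows "AE x in lebesgue. f x = 0"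
proof (rule sigma_finite_measure.density_zero[OF sigma_finite_lebesgue f(1)])
  have int: "set_integrable lebesgue A f" if "A \<in> sets lebesgue" for A
    using that f(1) unfolding set_integrable_def by (rule integrable_mult_indicator)
  have borel: "set_lebesgue_integral lebesgue A f = 0" if "A \<in> sets borel" for A :: "(real ^ 'n) set"
  proof -
    have "Int_stable (range (\<lambda>(a, b). box a b :: (real ^ 'n) set))"
      by (auto simp: Int_stable_def box_Int_box)
    moreover have "(range (\<lambda>(a, b). box a b)) \<subseteq> Pow (UNIV :: (real ^ 'n) set)" by auto
    moreover have "A \<in> sigma_sets UNIV (range (\<lambda>(a, b). box a b))"
      using that unfolding borel_eq_box by simp
    ultimately show ?thesis
    proof (induction rule: sigma_sets_induct_disjoint)
      case (basic A)
      then show ?case using box by auto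
    next
      case empty
      then show ?case by (simp add: set_lebesgue_integral_def)
    next
      case (compl A)
      then have A: "A \<in> sets lebesgue" by (simp add: borel_eq_box)
      have "set_lebesgue_integral lebesgue (A \<union> (UNIV - A)) f =
         set_lebesgue_integral lebesgue A f + set_lebesgue_integral lebesgue (UNIV - A) f"
        using A by (intro set_integral_Un int) auto
      then show ?case using compl f(2) by (simp add: set_lebesgue_integral_def Un_absorb1)
    next
      case (union A)
      then have "A i \<in> sets borel" for i unfolding borel_eq_box by (auto simp: subset_iff)
      then have "A i \<in> sets lebesgue" for i by simp
      then have "set_lebesgue_integral lebesgue (\<Union>i. A i) f = (\<Sum>i. set_lebesgue_integral lebesgue (A i) f)"
        using union(1) int
        by (intro lebesgue_integral_countable_add) (auto simp: disjoint_family_on_def)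
      then show ?case using union by simp
    qed
  qed
  fix A :: "(real ^ 'n) set" assume A: "A \<in> sets lebesgue"
  then obtain B N N' where BN: "A = B \<union> N" "N \<subseteq> N'" "N' \<in> null_sets lborel" "B \<in> sets lborel"
    by (rule sets_completionE)
  then have "A - B \<in> null_sets lebesgue"
    using A by (intro null_sets_completion_subset[of "A - B" N']) (auto intro: null_sets_completionI)
  with BN have B: "B \<in> sets lborel" "B \<subseteq> A" "A - B \<in> null_sets lebesgue" by auto
  have "set_lebesgue_integral lebesgue A f = set_lebesgue_integral lebesgue B f"
  proof (rule set_integral_cong_set)
    show "AE x in lebesgue. (x \<in> B) = (x \<in> A)"
      using AE_not_in[OF B(3)] by eventually_elim (use B(2) in auto)
  qed (use int[of A] int[of B] A B in \<open>auto simp: set_integrable_def set_borel_measurable_def\<close>)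
  with borel B(1) show "set_lebesgue_integral lebesgue A f = 0" by simp
qed

text \<open>The weak gradient integrates to zero against every test function. Indicators of boxes
  with closure in \<open>U\<close> are bounded pointwise limits of test functions, so the integral
  over each such box vanishes as well.\<close>

lemma weak_gradient_of_zero:
  fixes G :: "real ^ 'n \<Rightarrow> real ^ 'n"
  assumes U: "open U" and G: "integrable (lebesgue_on U) G" and wg: "has_weak_gradient U (\<lambda>_. 0) G"
  shows "AE x in lebesgue_on U. G x = 0"
proof -
  have US: "U \<in> sets lebesgue" using U by auto
  have G': "integrable lebesgue (\<lambda>x. indicator U x *\<^sub>R G x)"
    using G US by (simp add: integrable_restrict_space)
  have sub: "(LINT x|lebesgue. indicator (box a b) x *\<^sub>R indicator U x *\<^sub>R G x) = 0" if ab: "cbox a b \<subseteq> U" for a b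
  proof -
    obtain w d where w: "C1_function w d" "\<And>x. w x \<ge> 0" "\<And>x. w x > 0 \<longleftrightarrow> x \<in> box a b"
      using C1_bump[of a b] by metis
    \<comment> \<open>For \<open>t \<ge> 0\<close> this vanishes at 0, is at most 1 and tends to 1
      as \<open>j\<close> grows if \<open>t > 0\<close>. Composed with the bump it increases to the
      indicator of the open box and stays C1.\<close>
    define \<theta> where "\<theta> j t = real j * t / (1 + real j * t)" for j t
    have pos: "1 + real j * w x > 0" for j x using w(2)[of x] by (intro add_pos_nonneg) auto
    have "C1_function (\<lambda>x. \<theta> j (w x)) (\<lambda>x. (real j / (1 + real j * w x)\<^sup>2) *\<^sub>R d x)" for j
    proof (rule C1_function_compose[OF w(1)])
      show "(\<theta> j has_real_derivative real j / (1 + real j * w x)\<^sup>2) (at (w x))" for x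
        unfolding \<theta>_def using pos[of j x]
        by (auto intro!: derivative_eq_intros simp: power2_eq_square field_simps)
      show "continuous_on (range w) (\<lambda>t. real j / (1 + real j * t)\<^sup>2)"
        using w(2) by (intro continuous_intros) (fastforce simp: add_nonneg_eq_0_iff)
    qed
    moreover have \<theta>0: "\<theta> j (w x) = 0" if "x \<notin> box a b" for j x
    proof -
      have "w x = 0" using that w(2)[of x] w(3)[of x] by auto
      then show ?thesis by (simp add: \<theta>_def)
    qed
    ultimately have "test_function U (\<lambda>x. \<theta> j (w x)) (\<lambda>x. (real j / (1 + real j * w x)\<^sup>2) *\<^sub>R d x)" for j
      unfolding test_function_def using ab box_subset_cbox[of a b]
      by (intro conjI exI[of _ "cbox a b"]) (simp_all add: subset_iff, metis)
    from wg[unfolded has_weak_gradient_def, rule_format, OF this]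
    have 0: "(LINT x|lebesgue. indicator U x *\<^sub>R (\<theta> j (w x) *\<^sub>R G x)) = 0" for j
      using US by (simp add: integral_restrict_space)
    have cw: "continuous_on UNIV w" using w(1) by (rule C1_function_continuous)
    have m: "(\<lambda>x. \<theta> j (w x)) \<in> borel_measurable borel" for j
      unfolding \<theta>_def using cw pos[of j]
      by (intro borel_measurable_continuous_onI continuous_intros) (auto simp: less_le)
    have "(\<lambda>j. LINT x|lebesgue. indicator U x *\<^sub>R (\<theta> j (w x) *\<^sub>R G x)) \<longlonglongrightarrow>
      (LINT x|lebesgue. indicator (box a b) x *\<^sub>R indicator U x *\<^sub>R G x)"
    proof (rule integral_dominated_convergence[where w="\<lambda>x. norm (indicator U x *\<^sub>R G x)"])
      have mG: "(\<lambda>x. indicator U x *\<^sub>R G x) \<in> borel_measurable lebesgue" using G' by simp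
      show "(\<lambda>x. indicator (box a b) x *\<^sub>R indicator U x *\<^sub>R G x) \<in> borel_measurable lebesgue"
        by (rule borel_measurable_scaleR[OF borel_measurable_indicator mG]) auto
      have mt: "(\<lambda>x. \<theta> j (w x)) \<in> borel_measurable lebesgue" for j
        using m[of j] by (intro measurable_completion) simp
      show "(\<lambda>x. indicator U x *\<^sub>R (\<theta> j (w x) *\<^sub>R G x)) \<in> borel_measurable lebesgue" for j
        using borel_measurable_scaleR[OF mt mG] by (simp add: mult.commute)
      show "integrable lebesgue (\<lambda>x. norm (indicator U x *\<^sub>R G x))" using G' by (rule integrable_norm)
      show "AE x in lebesgue. (\<lambda>j. indicator U x *\<^sub>R (\<theta> j (w x) *\<^sub>R G x)) \<longlonglongrightarrow> indicator (box a b) x *\<^sub>R indicator U x *\<^sub>R G x"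
      proof (rule AE_I2)
        fix x
        have "(\<lambda>j. \<theta> j (w x)) \<longlonglongrightarrow> indicator (box a b) x"
        proof (cases "x \<in> box a b")
          case True
          then have "w x > 0" using w(3) by simp
          then have "(\<lambda>j. \<theta> j (w x)) \<longlonglongrightarrow> 1" unfolding \<theta>_def by real_asymp
          then show ?thesis using True by simp
        qed (simp add: \<theta>0)
        then have "(\<lambda>j. \<theta> j (w x) *\<^sub>R (indicator U x *\<^sub>R G x)) \<longlonglongrightarrow> indicator (box a b) x *\<^sub>R indicator U x *\<^sub>R G x"
          by (intro tendsto_scaleR tendsto_const)
        then show "(\<lambda>j. indicator U x *\<^sub>R (\<theta> j (w x) *\<^sub>R G x)) \<longlonglongrightarrow> indicator (box a b) x *\<^sub>R indicator U x *\<^sub>R G x"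
          by (simp add: mult.commute)
      qed
      show "AE x in lebesgue. norm (indicator U x *\<^sub>R (\<theta> j (w x) *\<^sub>R G x)) \<le> norm (indicator U x *\<^sub>R G x)" for j
      proof (rule AE_I2)
        fix x
        have "\<bar>\<theta> j (w x)\<bar> \<le> 1" unfolding \<theta>_def using w(2)[of x] pos[of j x] by (simp add: divide_le_eq_1)
        then show "norm (indicator U x *\<^sub>R (\<theta> j (w x) *\<^sub>R G x)) \<le> norm (indicator U x *\<^sub>R G x)"
          by (auto simp: indicator_def mult_left_le_one_le)
      qed
    qed
    then show ?thesis unfolding 0 LIMSEQ_const_iff by simp
  qed
  have AEbox: "AE x in lebesgue. x \<in> cbox a b \<longrightarrow> G x = 0" if ab: "cbox a b \<subseteq> U" for a b
  proof -
    have "AE x in lebesgue. indicator (box a b) x *\<^sub>R indicator U x *\<^sub>R G x = 0"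
    proof (rule AE_eq_0_if_integral_box_eq_0)
      show "integrable lebesgue (\<lambda>x. indicator (box a b) x *\<^sub>R indicator U x *\<^sub>R G x)"
        by (intro integrable_mult_indicator G') auto
      show "(LINT x|lebesgue. indicator (box a b) x *\<^sub>R indicator U x *\<^sub>R G x) = 0" by (rule sub[OF ab])
      fix c e
      \<comment> \<open>The integral identity \<open>sub\<close> asks for a closed box inside
        \<open>U\<close>. A nonempty open intersection has its closure in \<open>cbox a b\<close>;
        for an empty one the closed box of the same corners says nothing, hence the separate
        case.\<close>
      obtain c' e' where ce: "box c e \<inter> box a b = box c' e'" "cbox c' e' \<subseteq> cbox a b \<or> box c' e' = {}"
      proof (cases "box c e \<inter> box a b = {}")
        case True
        then show ?thesis using that[of 0 0] by simp
      next
        case False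
        obtain c' e' where *: "box c e \<inter> box a b = box c' e'" using box_Int_box by blast
        then have "box c' e' \<noteq> {}" "box a b \<noteq> {}" "box c' e' \<subseteq> box a b" using False by auto
        then have "cbox c' e' \<subseteq> cbox a b"
          using closure_mono[of "box c' e'" "box a b"] by (simp add: closure_box)
        then show ?thesis using that * by blast
      qed
      have "(LINT x|lebesgue. indicator (box c' e') x *\<^sub>R indicator U x *\<^sub>R G x) = 0"
        using ce(2) sub[of c' e'] ab by auto
      then show "set_lebesgue_integral lebesgue (box c e) (\<lambda>x. indicator (box a b) x *\<^sub>R indicator U x *\<^sub>R G x) = 0"
        unfolding set_lebesgue_integral_def ce(1)[symmetric] by (simp add: indicator_inter_arith mult.assoc)
    qed
    moreover have "AE x in lebesgue. x \<notin> cbox a b - box a b"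
      by (rule AE_not_in) (use negligible_frontier_interval[of a b] in \<open>simp add: negligible_iff_null_sets\<close>)
    ultimately show ?thesis
      by eventually_elim (use ab in \<open>auto simp: indicator_def split: if_splits\<close>)
  qed
  \<comment> \<open>Countably many closed boxes exhaust \<open>U\<close>, so the exceptional null
    sets of the boxes combine to one.\<close>
  obtain D where D: "countable D" "D \<subseteq> Pow U" "\<And>X. X \<in> D \<Longrightarrow> \<exists>a b. X = cbox a b" "\<Union>D = U"
    using open_countable_Union_open_cbox[OF U] by metis
  have "AE x in lebesgue. \<forall>X\<in>D. x \<in> X \<longrightarrow> G x = 0"
    unfolding AE_ball_countable[OF D(1)] using D(2,3) AEbox by fast
  then have "AE x in lebesgue. x \<in> U \<longrightarrow> G x = 0"
    using D(4) by (auto elim!: eventually_mono)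
  then show ?thesis using US by (subst AE_restrict_space_iff) auto
qed

section \<open>A trace inequality\<close>

lemma sets_hausdorff_measure [simp, measurable_cong]: "sets (hausdorff_measure s) = sets borel"
  unfolding hausdorff_measure_def using sets.sigma_sets_eq[of borel] by simp

lemma space_hausdorff_measure [simp]: "space (hausdorff_measure s) = UNIV"
  unfolding hausdorff_measure_def by simp

text \<open>\<open>measure_of\<close> takes the values of its argument if that is a measure on the
  given sets and is zero otherwise; the outer measure dominates in both cases. All later estimates
  of surface measure rest on this upper bound.\<close>

lemma emeasure_hausdorff_measure_le: "emeasure (hausdorff_measure s) A \<le> hausdorff_outer s A"
  unfolding hausdorff_measure_def emeasure_measure_of_conv by simp

text \<open>Cauchy-Schwarz against the constant 1. It turns the \<open>L2\<close> convergence in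
  \<open>has_trace\<close> into convergence of integrals of absolute values, the form in which the
  trace inequality is stated.\<close>

lemma nn_integral_norm_le_Lp_norm_2:
  assumes "finite_measure M" "Lp M 2 f"
  shows "(\<integral>\<^sup>+x. ennreal (norm (f x)) \<partial>M) \<le> ennreal (sqrt (measure M (space M)) * Lp_norm M 2 f)"
proof -
  interpret finite_measure M by fact
  have [measurable]: "f \<in> borel_measurable M" and int: "integrable M (\<lambda>x. norm (f x) powr 2)"
    using assms(2) by (auto simp: Lp_def)
  define B where "B = (LINT x|M. norm (f x) powr 2)"
  have B: "B \<ge> 0" by (simp add: B_def)
  define I where "I = (\<integral>\<^sup>+x. ennreal (norm (f x)) \<partial>M)"
  have "I\<^sup>2 \<le> (\<integral>\<^sup>+x. (ennreal (norm (f x)))\<^sup>2 \<partial>M) * (\<integral>\<^sup>+x. 1\<^sup>2 \<partial>M)"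
    unfolding I_def using Cauchy_Schwarz_nn_integral[of "\<lambda>x. ennreal (norm (f x))" M "\<lambda>_. 1"] by simp
  also have "(\<integral>\<^sup>+x. (ennreal (norm (f x)))\<^sup>2 \<partial>M) = (\<integral>\<^sup>+x. ennreal (norm (f x) powr 2) \<partial>M)"
    by (intro nn_integral_cong) (simp add: ennreal_power)
  also have "\<dots> = ennreal B"
    unfolding B_def by (rule nn_integral_eq_integral[OF int]) simp
  also have "(\<integral>\<^sup>+x. 1\<^sup>2 \<partial>M) = ennreal (measure M (space M))"
    by (simp add: emeasure_eq_measure)
  finally have le: "I\<^sup>2 \<le> ennreal (measure M (space M) * B)"
    using B by (simp add: ennreal_mult mult.commute)
  also have "\<dots> < top" by simp
  finally have "I < top" by (simp add: power_less_top_ennreal)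
  then obtain i where i: "I = ennreal i" "i \<ge> 0" by (cases I) auto
  then have "i\<^sup>2 \<le> measure M (space M) * B" using le B by (simp add: ennreal_power)
  then have "i \<le> sqrt (measure M (space M) * B)" using i by (simp add: real_le_rsqrt)
  then show ?thesis
    using i B unfolding I_def[symmetric] Lp_norm_def B_def[symmetric]
    by (simp add: powr_half_sqrt real_sqrt_mult ennreal_leI)
qed

text \<open>The fundamental theorem of calculus on the segment from \<open>x - t *\<^sub>R e\<close>
  to \<open>x\<close>, with the directional derivative bounded by \<open>norm e\<close> times the
  norm of the gradient.\<close>

lemma C1_function_line_bound:
  assumes "C1_function \<Phi> d" "0 \<le> t"
  shows "ennreal \<bar>\<Phi> (x - t *\<^sub>R e)\<bar>
    \<le> ennreal \<bar>\<Phi> x\<bar> + (\<integral>\<^sup>+r\<in>{-t..0}. ennreal (norm e * norm (d (x + r *\<^sub>R e))) \<partial>lborel)"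
proof -
  define f where "f r = d (x + r *\<^sub>R e) \<bullet> e" for r
  have d: "(\<Phi> has_derivative (\<lambda>h. d y \<bullet> h)) (at y)" "continuous_on UNIV d" for y
    using assms(1) by (auto simp: C1_function_def)
  have cf: "continuous_on UNIV f"
    unfolding f_def by (intro continuous_intros continuous_on_compose2[OF d(2)]) auto
  have [measurable]: "f \<in> borel_measurable borel" by (intro borel_measurable_continuous_onI cf)
  have "((\<lambda>r. \<Phi> (x + r *\<^sub>R e)) has_vector_derivative f r) (at r within {-t..0})" for r
  proof -
    have "((\<lambda>r. x + r *\<^sub>R e) has_derivative (\<lambda>h. h *\<^sub>R e)) (at r within {-t..0})"
      by (auto intro!: derivative_eq_intros)
    from has_derivative_compose[OF this d(1)] show ?thesis
      by (simp add: has_vector_derivative_def f_def)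
  qed
  then have "(LBINT r. indicator {-t..0} r *\<^sub>R f r) = \<Phi> (x + 0 *\<^sub>R e) - \<Phi> (x + (-t) *\<^sub>R e)"
    using assms(2) continuous_on_subset[OF cf] by (intro integral_FTC_Icc) auto
  then have "\<Phi> (x - t *\<^sub>R e) = \<Phi> x - (LBINT r. indicator {-t..0} r *\<^sub>R f r)" by simp
  then have "\<bar>\<Phi> (x - t *\<^sub>R e)\<bar> \<le> \<bar>\<Phi> x\<bar> + \<bar>LBINT r. indicator {-t..0} r *\<^sub>R f r\<bar>" by linarith
  then have "ennreal \<bar>\<Phi> (x - t *\<^sub>R e)\<bar> \<le> ennreal \<bar>\<Phi> x\<bar> + ennreal (norm (LBINT r. indicator {-t..0} r *\<^sub>R f r))"
    by (simp add: ennreal_plus[symmetric] ennreal_leI del: ennreal_plus)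
  also have "ennreal (norm (LBINT r. indicator {-t..0} r *\<^sub>R f r)) \<le> (\<integral>\<^sup>+r. ennreal (norm (indicator {-t..0} r *\<^sub>R f r)) \<partial>lborel)"
  proof (rule integral_norm_bound_ennreal)
    show "integrable lborel (\<lambda>r. indicator {-t..0} r *\<^sub>R f r)"
      using borel_integrable_compact[of "{-t..0}" f] continuous_on_subset[OF cf] by auto
  qed
  also have "\<dots> \<le> (\<integral>\<^sup>+r\<in>{-t..0}. ennreal (norm e * norm (d (x + r *\<^sub>R e))) \<partial>lborel)"
  proof (intro nn_integral_mono)
    fix r
    have "\<bar>f r\<bar> \<le> norm e * norm (d (x + r *\<^sub>R e))"
      unfolding f_def using Cauchy_Schwarz_ineq2[of "d (x + r *\<^sub>R e)" e] by (simp add: mult.commute)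
    then show "ennreal (norm (indicator {-t..0} r *\<^sub>R f r))
      \<le> ennreal (norm e * norm (d (x + r *\<^sub>R e))) * indicator {-t..0} r"
      by (auto simp: indicator_def intro!: ennreal_leI)
  qed
  finally show ?thesis by (simp add: add_left_mono)
qed

text \<open>The value at the foot of a segment in direction \<open>e\<close> is bounded by the value
  at any point of the segment plus an integral of the gradient. Averaging over the cylinder gives
  volume integrals on the right; on the left, Hausdorff measure on \<open>E\<close> is dominated by
  the projected volume.\<close>

lemma hausdorff_trace_inequality:
  fixes e \<nu> :: "real ^ 'n"
  assumes e: "\<nu> \<bullet> e = 1" and n: "CARD('n) \<ge> 2"
    and E: "E \<in> sets borel" "bounded E" "E \<subseteq> {x. \<nu> \<bullet> x = c}"
  obtains C :: real where "C \<ge> 0"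
    "\<And>\<Phi> d. C1_function \<Phi> d \<Longrightarrow>
      (\<integral>\<^sup>+x\<in>E. ennreal \<bar>\<Phi> x\<bar> \<partial>hausdorff_measure (CARD('n) - 1)) \<le>
      ennreal C * ((\<integral>\<^sup>+x\<in>cylinder \<nu> c e E. ennreal \<bar>\<Phi> x\<bar> \<partial>lborel)
        + ennreal (norm e) * (\<integral>\<^sup>+x\<in>cylinder \<nu> c e E. ennreal (norm (d x)) \<partial>lborel))"
proof -
  define H where "H = (hausdorff_measure (CARD('n) - 1) :: (real ^ 'n) measure)"
  define Z where "Z = cylinder \<nu> c e E"
  define \<pi> where "\<pi> x = x - (\<nu> \<bullet> x - c) *\<^sub>R e" for x
  have setsH [measurable_cong, simp]: "sets H = sets borel" by (simp add: H_def)
  have [measurable]: "E \<in> sets borel" by fact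
  have [measurable]: "Z \<in> sets borel" unfolding Z_def by measurable
  have [measurable]: "\<pi> \<in> borel_measurable borel" unfolding \<pi>_def by measurable
  obtain C where C: "C \<ge> 0" "\<And>A. A \<in> sets borel \<Longrightarrow> bounded A \<Longrightarrow> A \<subseteq> {x. \<nu> \<bullet> x = c} \<Longrightarrow>
       hausdorff_outer (CARD('n) - 1) A \<le> ennreal C * emeasure lborel (cylinder \<nu> c e A)"
    using hausdorff_outer_le_cylinder[OF e, of c] n by auto
  \<comment> \<open>\<open>C\<close> times the image of Lebesgue measure on the cylinder under the
    projection along \<open>e\<close>. The cylinder over \<open>E \<inter> A\<close> is the part of
    \<open>Z\<close> that projects into \<open>A\<close>, so the bound on sets says that
    \<open>N\<close> dominates Hausdorff measure on \<open>E\<close>, and the domination passes to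
    integrals.\<close>
  define N where "N = scale_measure (ennreal C) (distr (density lborel (indicator Z)) borel \<pi>)"
  have "density H (indicator E) \<le> N"
  proof (subst le_measure)
    show "sets (density H (indicator E)) = sets N" by (simp add: N_def)
    show "\<forall>A\<in>sets (density H (indicator E)). emeasure (density H (indicator E)) A \<le> emeasure N A"
    proof
      fix A assume "A \<in> sets (density H (indicator E))"
      then have [measurable]: "A \<in> sets borel" by simp
      have [measurable]: "\<pi> -` A \<in> sets borel" using measurable_sets[of \<pi> borel borel A] by simp
      have "emeasure (density H (indicator E)) A = emeasure H (E \<inter> A)"
        by (simp add: emeasure_density indicator_inter_arith[symmetric])
      also have "\<dots> \<le> hausdorff_outer (CARD('n) - 1) (E \<inter> A)"
        unfolding H_def by (rule emeasure_hausdorff_measure_le)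
      also have "\<dots> \<le> ennreal C * emeasure lborel (cylinder \<nu> c e (E \<inter> A))"
        using E by (intro C(2)) (auto intro: bounded_subset)
      also have "cylinder \<nu> c e (E \<inter> A) = Z \<inter> \<pi> -` A"
        by (auto simp: cylinder_def Z_def \<pi>_def)
      also have "ennreal C * emeasure lborel (Z \<inter> \<pi> -` A) = emeasure N A"
        by (simp add: N_def emeasure_distr emeasure_density indicator_inter_arith[symmetric])
      finally show "emeasure (density H (indicator E)) A \<le> emeasure N A" .
    qed
  qed
  then have dom: "nn_integral (density H (indicator E)) f \<le> nn_integral N f" for f
    by (intro nn_integral_mono_measure) (auto simp: N_def)
  have "(\<integral>\<^sup>+x\<in>E. ennreal \<bar>\<Phi> x\<bar> \<partial>H) \<le>
      ennreal C * ((\<integral>\<^sup>+x\<in>Z. ennreal \<bar>\<Phi> x\<bar> \<partial>lborel) + ennreal (norm e) * (\<integral>\<^sup>+x\<in>Z. ennreal (norm (d x)) \<partial>lborel))"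
    if \<Phi>: "C1_function \<Phi> d" for \<Phi> d
  proof -
    have [measurable]: "\<Phi> \<in> borel_measurable borel"
      using C1_function_continuous[OF \<Phi>] by (rule borel_measurable_continuous_onI)
    have [measurable]: "d \<in> borel_measurable borel"
      using \<Phi> by (auto simp: C1_function_def intro: borel_measurable_continuous_onI)
    \<comment> \<open>The segment from \<open>x\<close> back to the hyperplane runs inside
      \<open>Z\<close>. With the gradient cut off to \<open>Z\<close>, the range
      \<open>{-t..0}\<close> can be enlarged to \<open>{-1..0}\<close>, which is the same for all
      \<open>x\<close>. After the integrals are exchanged, translation by
      \<open>r *\<^sub>R e\<close> leaves the inner one unchanged, and the range has length
      1.\<close>
    define u where "u x = ennreal (norm e * norm (d x)) * indicator Z x" for x
    have [measurable]: "u \<in> borel_measurable borel" unfolding u_def by measurable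
    have "(\<integral>\<^sup>+x\<in>E. ennreal \<bar>\<Phi> x\<bar> \<partial>H) = (\<integral>\<^sup>+x. ennreal \<bar>\<Phi> x\<bar> \<partial>density H (indicator E))"
      by (subst nn_integral_density) (auto simp: mult.commute)
    also have "\<dots> \<le> (\<integral>\<^sup>+x. ennreal \<bar>\<Phi> x\<bar> \<partial>N)" by (rule dom)
    also have "\<dots> = ennreal C * (\<integral>\<^sup>+x\<in>Z. ennreal \<bar>\<Phi> (\<pi> x)\<bar> \<partial>lborel)"
      unfolding N_def
      by (simp add: nn_integral_scale_measure nn_integral_distr nn_integral_density mult.commute)
    also have "(\<integral>\<^sup>+x\<in>Z. ennreal \<bar>\<Phi> (\<pi> x)\<bar> \<partial>lborel) \<le>
      (\<integral>\<^sup>+x. ennreal \<bar>\<Phi> x\<bar> * indicator Z x + (\<integral>\<^sup>+r. u (x + r *\<^sub>R e) * indicator {-1..0} r \<partial>lborel) \<partial>lborel)"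
    proof (intro nn_integral_mono)
      fix x
      show "ennreal \<bar>\<Phi> (\<pi> x)\<bar> * indicator Z x \<le>
        ennreal \<bar>\<Phi> x\<bar> * indicator Z x + (\<integral>\<^sup>+r. u (x + r *\<^sub>R e) * indicator {-1..0} r \<partial>lborel)"
      proof (cases "x \<in> Z")
        case True
        define t where "t = \<nu> \<bullet> x - c"
        have t: "0 \<le> t" "t \<le> 1" "x - t *\<^sub>R e \<in> E" using True by (auto simp: Z_def cylinder_def t_def)
        have "ennreal \<bar>\<Phi> (x - t *\<^sub>R e)\<bar>
            \<le> ennreal \<bar>\<Phi> x\<bar> + (\<integral>\<^sup>+r\<in>{-t..0}. ennreal (norm e * norm (d (x + r *\<^sub>R e))) \<partial>lborel)"
          by (rule C1_function_line_bound[OF \<Phi> t(1)])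
        also have "(\<integral>\<^sup>+r\<in>{-t..0}. ennreal (norm e * norm (d (x + r *\<^sub>R e))) \<partial>lborel)
            \<le> (\<integral>\<^sup>+r. u (x + r *\<^sub>R e) * indicator {-1..0} r \<partial>lborel)"
        proof (intro nn_integral_mono)
          fix r
          have "x + r *\<^sub>R e \<in> Z" if "- t \<le> r" "r \<le> 0"
          proof -
            have eq1: "\<nu> \<bullet> (x + r *\<^sub>R e) - c = t + r" using e by (simp add: t_def inner_add_right)
            have eq2: "x + r *\<^sub>R e - (t + r) *\<^sub>R e = x - t *\<^sub>R e"
              by (simp add: scaleR_add_left)
            show ?thesis
              unfolding Z_def cylinder_def mem_Collect_eq eq1 eq2 using t that by simp
          qed
          then show "ennreal (norm e * norm (d (x + r *\<^sub>R e))) * indicator {- t..0} r \<le> u (x + r *\<^sub>R e) * indicator {- 1..0} r"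
            using t by (auto simp: u_def indicator_def)
        qed
        finally show ?thesis using True by (simp add: \<pi>_def t_def add_left_mono)
      qed simp
    qed
    also have "\<dots> = (\<integral>\<^sup>+x\<in>Z. ennreal \<bar>\<Phi> x\<bar> \<partial>lborel)
        + (\<integral>\<^sup>+x. (\<integral>\<^sup>+r. u (x + r *\<^sub>R e) * indicator {-1..0} r \<partial>lborel) \<partial>lborel)"
      by (intro nn_integral_add) measurable
    also have "(\<integral>\<^sup>+x. (\<integral>\<^sup>+r. u (x + r *\<^sub>R e) * indicator {-1..0} r \<partial>lborel) \<partial>lborel)
        = (\<integral>\<^sup>+r. (\<integral>\<^sup>+x. u (x + r *\<^sub>R e) * indicator {-1..0} r \<partial>lborel) \<partial>lborel)"
      by (rule lborel_pair.Fubini') measurable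
    also have "\<dots> = (\<integral>\<^sup>+r. (\<integral>\<^sup>+x. u x \<partial>lborel) * indicator {-1..0::real} r \<partial>lborel)"
    proof (intro nn_integral_cong)
      fix r :: real
      have "(\<integral>\<^sup>+x. u (x + r *\<^sub>R e) \<partial>lborel) = (\<integral>\<^sup>+x. u x \<partial>distr lborel borel ((+) (r *\<^sub>R e)))"
        by (subst nn_integral_distr) (auto simp: add.commute)
      then show "(\<integral>\<^sup>+x. u (x + r *\<^sub>R e) * indicator {-1..0} r \<partial>lborel) = (\<integral>\<^sup>+x. u x \<partial>lborel) * indicator {-1..0} r"
        by (simp add: nn_integral_multc lborel_distr_plus)
    qed
    also have "\<dots> = (\<integral>\<^sup>+x. u x \<partial>lborel)"
      by (simp add: nn_integral_cmult_indicator)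
    also have "\<dots> = ennreal (norm e) * (\<integral>\<^sup>+x\<in>Z. ennreal (norm (d x)) \<partial>lborel)"
      unfolding u_def by (subst nn_integral_cmult[symmetric]) (auto simp: ennreal_mult mult.assoc)
    finally show ?thesis by (simp add: mult_left_mono)
  qed
  with that C(1) show ?thesis unfolding H_def Z_def by blast
qed

section \<open>Lebesgue spaces\<close>

lemma Lp_norm_nonneg: "Lp_norm M r f \<ge> 0"
  by (simp add: Lp_norm_def)

lemma Lp_bounded:
  fixes f :: "'a \<Rightarrow> 'b::{real_normed_vector, second_countable_topology}"
  assumes "finite_measure M" "f \<in> borel_measurable M" "\<And>x. x \<in> space M \<Longrightarrow> norm (f x) \<le> B" "r \<ge> 0"
  shows "Lp M r f"
proof -
  interpret finite_measure M by fact
  have "norm (f x) powr r \<le> B powr r" if "x \<in> space M" for x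
    using assms(3)[OF that] assms(4) by (intro powr_mono2) auto
  then have "integrable M (\<lambda>x. norm (f x) powr r)"
    using assms(2) by (intro integrable_const_bound[of _ "B powr r"]) auto
  then show ?thesis using assms(2) by (simp add: Lp_def)
qed

lemma Lp_add:
  fixes f g :: "'a \<Rightarrow> 'b::{real_normed_vector, second_countable_topology}"
  assumes "Lp M r f" "Lp M r g" "r \<ge> 0"
  shows "Lp M r (\<lambda>x. f x + g x)"
proof -
  have [measurable]: "f \<in> borel_measurable M" "g \<in> borel_measurable M"
    and int: "integrable M (\<lambda>x. norm (f x) powr r)" "integrable M (\<lambda>x. norm (g x) powr r)"
    using assms by (auto simp: Lp_def)
  \<comment> \<open>Comparison with twice the maximum works for every \<open>r \<ge> 0\<close>,
    including exponents below 1 where convexity fails.\<close>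
  have bound: "norm (f x + g x) powr r \<le> 2 powr r * (norm (f x) powr r + norm (g x) powr r)" for x
  proof -
    have "norm (f x + g x) \<le> 2 * max (norm (f x)) (norm (g x))"
      using norm_triangle_ineq[of "f x" "g x"] by (auto simp: max_def)
    then have "norm (f x + g x) powr r \<le> (2 * max (norm (f x)) (norm (g x))) powr r"
      using assms(3) by (intro powr_mono2) auto
    also have "\<dots> = 2 powr r * max (norm (f x)) (norm (g x)) powr r" by (simp add: powr_mult)
    also have "\<dots> \<le> 2 powr r * (norm (f x) powr r + norm (g x) powr r)"
      by (intro mult_left_mono) (auto simp: max_def)
    finally show ?thesis .
  qed
  have "integrable M (\<lambda>x. norm (f x + g x) powr r)"
  proof (rule Bochner_Integration.integrable_bound)
    show "integrable M (\<lambda>x. 2 powr r * (norm (f x) powr r + norm (g x) powr r))"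
      using int by simp
    show "AE x in M. norm (norm (f x + g x) powr r)
        \<le> norm (2 powr r * (norm (f x) powr r + norm (g x) powr r))"
      using bound by (intro AE_I2) (simp add: order_trans[OF _ abs_ge_self])
  qed measurable
  then show ?thesis by (simp add: Lp_def)
qed

lemma Lp_scaleR:
  fixes f :: "'a \<Rightarrow> 'b::{real_normed_vector, second_countable_topology}"
  assumes "Lp M r f"
  shows "Lp M r (\<lambda>x. c *\<^sub>R f x)"
  using assms by (auto simp: Lp_def powr_mult)

lemma Lp_diff:
  fixes f g :: "'a \<Rightarrow> 'b::{real_normed_vector, second_countable_topology}"
  assumes "Lp M r f" "Lp M r g" "r \<ge> 0"
  shows "Lp M r (\<lambda>x. f x - g x)"
  using Lp_add[OF assms(1) Lp_scaleR[OF assms(2), of "-1"] assms(3)] by simp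

lemma Lp_norm_scaleR:
  fixes f :: "'a \<Rightarrow> 'b::real_normed_vector"
  assumes "r > 0"
  shows "Lp_norm M r (\<lambda>x. c *\<^sub>R f x) = \<bar>c\<bar> * Lp_norm M r f"
  using assms by (simp add: Lp_norm_def powr_mult powr_powr)

lemma Lp_norm_cong_AE:
  fixes f g :: "'a \<Rightarrow> 'b::{real_normed_vector, second_countable_topology}"
  assumes "f \<in> borel_measurable M" "g \<in> borel_measurable M" "AE x in M. f x = g x"
  shows "Lp_norm M r f = Lp_norm M r g"
proof -
  have "(LINT x|M. norm (f x) powr r) = (LINT x|M. norm (g x) powr r)"
    using assms by (intro integral_cong_AE) (auto elim!: eventually_mono)
  then show ?thesis by (simp add: Lp_norm_def)
qed

lemma Lp_norm_powr:
  assumes "r > 0"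
  shows "Lp_norm M r f powr r = (LINT x|M. norm (f x) powr r)"
  using assms by (simp add: Lp_norm_def powr_powr)

lemma Lp_norm_eq_0_imp_AE:
  fixes f :: "'a \<Rightarrow> 'b::{real_normed_vector, second_countable_topology}"
  assumes "Lp M r f" "Lp_norm M r f = 0"
  shows "AE x in M. f x = 0"
proof -
  have "(LINT x|M. norm (f x) powr r) = 0" using assms(2) by (simp add: Lp_norm_def)
  then have "AE x in M. norm (f x) powr r = 0"
    using assms(1) by (subst (asm) integral_nonneg_eq_0_iff_AE) (auto simp: Lp_def)
  then show ?thesis by eventually_elim simp
qed

lemma powr_convex_combination:
  fixes x y u v r :: real
  assumes "x \<ge> 0" "y \<ge> 0" "u \<ge> 0" "v \<ge> 0" "u + v = 1" "r \<ge> 1"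
  shows "(u * x + v * y) powr r \<le> u * x powr r + v * y powr r"
proof -
  \<comment> \<open>If one of the two points is 0, the claim reduces to this inequality for the
    weight of the other point.\<close>
  have le: "t powr r \<le> t" if "0 \<le> t" "t \<le> 1" for t :: real
    using powr_mono'[of 1 r t] that assms(6) by simp
  consider "x = 0" | "y = 0" | "x > 0" "y > 0" using assms by linarith
  then show ?thesis
  proof cases
    case 1
    then show ?thesis using le[of v] assms by (simp add: powr_mult mult_right_mono)
  next
    case 2
    then show ?thesis using le[of u] assms by (simp add: powr_mult mult_right_mono)
  next
    case 3
    then show ?thesis
      using convex_onD[OF powr_convex[OF assms(6)], of v x y] assms
      by (simp add: eq_diff_eq[symmetric])
  qed
qed

text \<open>With norms \<open>A\<close>, \<open>B\<close> and \<open>S = A + B\<close>, the sum is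
  \<open>S\<close> times the convex combination of \<open>f / A\<close> and \<open>g / B\<close>
  with weights \<open>A / S\<close> and \<open>B / S\<close>. Convexity of the power is then
  integrated. If \<open>A\<close> or \<open>B\<close> is 0, that function vanishes almost
  everywhere.\<close>

lemma Minkowski:
  fixes f g :: "'a \<Rightarrow> 'b::{real_normed_vector, second_countable_topology}"
  assumes f: "Lp M r f" and g: "Lp M r g" and r: "r \<ge> 1"
  shows "Lp_norm M r (\<lambda>x. f x + g x) \<le> Lp_norm M r f + Lp_norm M r g"
proof -
  have [measurable]: "f \<in> borel_measurable M" "g \<in> borel_measurable M"
    and int: "integrable M (\<lambda>x. norm (f x) powr r)" "integrable M (\<lambda>x. norm (g x) powr r)"
    using assms by (auto simp: Lp_def)
  define A where "A = Lp_norm M r f"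
  define B where "B = Lp_norm M r g"
  have AB: "A \<ge> 0" "B \<ge> 0" by (auto simp: A_def B_def Lp_norm_nonneg)
  consider "A = 0" | "B = 0" | "A > 0" "B > 0" using AB by linarith
  then show ?thesis
  proof cases
    case 1
    then have "AE x in M. f x + g x = g x"
      using Lp_norm_eq_0_imp_AE[OF f] unfolding A_def by auto
    then have "Lp_norm M r (\<lambda>x. f x + g x) = Lp_norm M r g" by (intro Lp_norm_cong_AE) auto
    then show ?thesis using AB A_def by simp
  next
    case 2
    then have "AE x in M. f x + g x = f x"
      using Lp_norm_eq_0_imp_AE[OF g] unfolding B_def by auto
    then have "Lp_norm M r (\<lambda>x. f x + g x) = Lp_norm M r f" by (intro Lp_norm_cong_AE) auto
    then show ?thesis using AB B_def by simp
  next
    case 3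
    define S where "S = A + B"
    have S: "S > 0" using 3 by (simp add: S_def)
    have bound: "norm (f x + g x) powr r \<le>
        S powr r * (A / S * (norm (f x) powr r / A powr r) + B / S * (norm (g x) powr r / B powr r))" for x
    proof -
      have "norm (f x + g x) \<le> S * (A / S * (norm (f x) / A) + B / S * (norm (g x) / B))"
      proof -
        have "S * (A / S * (norm (f x) / A) + B / S * (norm (g x) / B)) = norm (f x) + norm (g x)"
          using 3 S by (simp add: field_simps)
        then show ?thesis using norm_triangle_ineq[of "f x" "g x"] by simp
      qed
      then have "norm (f x + g x) powr r \<le> (S * (A / S * (norm (f x) / A) + B / S * (norm (g x) / B))) powr r"
        using r by (intro powr_mono2) auto
      also have "\<dots> = S powr r * (A / S * (norm (f x) / A) + B / S * (norm (g x) / B)) powr r"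
        using S 3 by (intro powr_mult)
      also have "\<dots> \<le> S powr r * (A / S * (norm (f x) / A) powr r + B / S * (norm (g x) / B) powr r)"
        using 3 S r by (intro mult_left_mono powr_convex_combination) (auto simp: S_def add_divide_distrib[symmetric])
      finally show ?thesis using 3 by (simp add: powr_divide)
    qed
    have "(LINT x|M. norm (f x + g x) powr r) \<le>
      (LINT x|M. S powr r * (A / S * (norm (f x) powr r / A powr r) + B / S * (norm (g x) powr r / B powr r)))"
      using Lp_add[OF f g] r int bound by (intro integral_mono) (auto simp: Lp_def)
    also have "\<dots> = S powr r * (A / S * (A powr r / A powr r) + B / S * (B powr r / B powr r))"
      using int r by (simp add: A_def B_def Lp_norm_powr)
    also have "\<dots> = S powr r" using 3 S by (simp add: S_def add_divide_distrib[symmetric])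
    finally have "Lp_norm M r (\<lambda>x. f x + g x) \<le> (S powr r) powr (1 / r)"
      unfolding Lp_norm_def using r by (intro powr_mono2) auto
    then show ?thesis using r S by (simp add: powr_powr S_def A_def B_def)
  qed
qed

section \<open>Traces of the zero function\<close>

lemma Lp_2_imp_integrable:
  fixes f :: "'a \<Rightarrow> 'b::{banach, second_countable_topology}"
  assumes "finite_measure M" "Lp M 2 f"
  shows "integrable M f"
  unfolding integrable_iff_bounded
  using assms(2) nn_integral_norm_le_Lp_norm_2[OF assms]
  by (auto simp: Lp_def intro: le_less_trans)

lemma finite_measure_lebesgue_on:
  "U \<in> lmeasurable \<Longrightarrow> finite_measure (lebesgue_on U)"
  by (rule finite_measureI)
    (auto simp: emeasure_restrict_space fmeasurable_def space_restrict_space)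

text \<open>The choice in \<open>weak_gradient\<close> is satisfiable, by the zero field, but may
  select another representative; uniqueness identifies it up to a null set.\<close>

lemma weak_gradient_zero:
  fixes U :: "(real ^ 'n) set"
  assumes "open U" "bounded U"
  shows "Lp (lebesgue_on U) 2 (weak_gradient 2 U (\<lambda>_. 0))"
    and "AE x in lebesgue_on U. weak_gradient 2 U (\<lambda>_. 0) x = 0"
proof -
  have fin: "finite_measure (lebesgue_on U)"
    using assms by (intro finite_measure_lebesgue_on lmeasurable_open)
  have "Lp (lebesgue_on U) 2 (\<lambda>_. 0 :: real ^ 'n) \<and> has_weak_gradient U (\<lambda>_. 0) (\<lambda>_. 0)"
    by (simp add: Lp_def has_weak_gradient_def)
  then have G: "Lp (lebesgue_on U) 2 (weak_gradient 2 U (\<lambda>_. 0)) \<and>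
      has_weak_gradient U (\<lambda>_. 0) (weak_gradient 2 U (\<lambda>_. 0))"
    unfolding weak_gradient_def
    by (rule someI[of "\<lambda>G. Lp (lebesgue_on U) 2 G \<and> has_weak_gradient U (\<lambda>_. 0) G"])
  then show "Lp (lebesgue_on U) 2 (weak_gradient 2 U (\<lambda>_. 0))" by blast
  show "AE x in lebesgue_on U. weak_gradient 2 U (\<lambda>_. 0) x = 0"
    using G by (intro weak_gradient_of_zero assms(1) Lp_2_imp_integrable[OF fin]) auto
qed

lemma Lp_continuous_on_compact:
  fixes f :: "'a::topological_space \<Rightarrow> 'b::{real_normed_vector, second_countable_topology}"
  assumes "finite_measure M" "f \<in> borel_measurable M" "continuous_on K f" "compact K" "space M \<subseteq> K" "r \<ge> 0"
  shows "Lp M r f"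
proof -
  have "bounded (f ` K)" by (intro compact_imp_bounded compact_continuous_image assms)
  then obtain B where "\<And>x. x \<in> K \<Longrightarrow> norm (f x) \<le> B" unfolding bounded_iff by blast
  then show ?thesis using assms by (intro Lp_bounded[where B=B]) auto
qed

lemma borel_measurable_lebesgue_on_continuous:
  fixes f :: "'a::euclidean_space \<Rightarrow> 'b::{real_normed_vector, second_countable_topology}"
  assumes "continuous_on UNIV f"
  shows "f \<in> borel_measurable (lebesgue_on U)"
  using assms
  by (intro measurable_restrict_space1 measurable_completion)
    (simp add: borel_measurable_continuous_onI)

text \<open>The approximating functions tend to 0 in \<open>L2\<close> on \<open>K\<close> together
  with their gradients, since the weak gradient of zero vanishes almost everywhere. The region swept
  out by shifting \<open>E\<close> along \<open>e\<close> lies in \<open>K\<close>, so the trace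
  inequality makes them tend to 0 on \<open>E\<close>. There they also tend to
  \<open>g\<close>.\<close>

lemma trace_of_zero_AE:
  fixes K F E :: "(real ^ 'n) set"
  assumes n: "CARD('n) \<ge> 2" and K: "convex K" "compact K"
    and F: "closed F" "F \<subseteq> K" "F \<subseteq> {x. \<nu> \<bullet> x = c}" and e: "\<nu> \<bullet> e = 1"
    and E: "closed E" "E \<subseteq> F" "\<And>y. y \<in> E \<Longrightarrow> y + e \<in> K"
    and tr: "has_trace 2 K F (\<lambda>_. 0) g"
  shows "AE x in surface_measure F. x \<in> E \<longrightarrow> g x = 0"
proof -
  define H where "H = (hausdorff_measure (CARD('n) - 1) :: (real ^ 'n) measure)"
  define U where "U = interior K"
  define Z where "Z = cylinder \<nu> c e E"
  define M where "M = surface_measure F"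
  have M: "M = restrict_space H F" by (simp add: M_def H_def surface_measure_def)
  have [measurable_cong, simp]: "sets H = sets borel" by (simp add: H_def)
  have spH: "space H = UNIV" by (simp add: H_def)
  have [measurable]: "E \<in> sets borel" "F \<in> sets borel" using E(1) F(1) by auto
  have [measurable]: "Z \<in> sets borel" unfolding Z_def by measurable
  have bddF: "bounded F" using K(2) F(2) by (meson bounded_subset compact_imp_bounded)
  have bddE: "bounded E" using bddF E(2) by (rule bounded_subset)
  have EH: "E \<subseteq> {x. \<nu> \<bullet> x = c}" using E(2) F(3) by blast
  have spM: "space M = F" using F(1) by (simp add: M space_restrict_space spH)
  have finU: "finite_measure (lebesgue_on U)"
    unfolding U_def using K(2)
    by (intro finite_measure_lebesgue_on lmeasurable_interior compact_imp_bounded)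
  \<comment> \<open>Cauchy-Schwarz on the facet requires finite surface measure; the bounded
    cylinder over the facet provides it.\<close>
  have finM: "finite_measure M"
  proof (rule finite_measureI)
    obtain C where C: "C \<ge> 0" "\<And>A. A \<in> sets borel \<Longrightarrow> bounded A \<Longrightarrow> A \<subseteq> {x. \<nu> \<bullet> x = c} \<Longrightarrow>
       hausdorff_outer (CARD('n) - 1) A \<le> ennreal C * emeasure lborel (cylinder \<nu> c e A)"
      using hausdorff_outer_le_cylinder[OF e, of c] n by auto
    have "emeasure M (space M) = emeasure H F"
      using spM by (simp add: M emeasure_restrict_space)
    also have "\<dots> \<le> ennreal C * emeasure lborel (cylinder \<nu> c e F)"
      using emeasure_hausdorff_measure_le[of _ F] C(2)[of F] bddF F
      unfolding H_def by (meson borel_closed order_trans)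
    also have "\<dots> < \<infinity>"
      using emeasure_bounded_finite[OF cylinder_bounded[OF bddF, of \<nu> c e]]
      by (simp add: ennreal_mult_less_top)
    finally show "emeasure M (space M) \<noteq> \<infinity>" by simp
  qed
  obtain C where C: "C \<ge> 0"
    "\<And>\<Phi> d. C1_function \<Phi> d \<Longrightarrow> (\<integral>\<^sup>+x\<in>E. ennreal \<bar>\<Phi> x\<bar> \<partial>H) \<le>
      ennreal C * ((\<integral>\<^sup>+x\<in>Z. ennreal \<bar>\<Phi> x\<bar> \<partial>lborel) + ennreal (norm e) * (\<integral>\<^sup>+x\<in>Z. ennreal (norm (d x)) \<partial>lborel))"
    using hausdorff_trace_inequality[OF e n \<open>E \<in> sets borel\<close> bddE EH, folded H_def Z_def] by blast
  have "Z \<subseteq> K"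
  proof
    fix x assume x: "x \<in> Z"
    define t where "t = \<nu> \<bullet> x - c"
    define y where "y = x - t *\<^sub>R e"
    have *: "0 \<le> t" "t \<le> 1" "y \<in> E" using x by (auto simp: Z_def cylinder_def t_def y_def)
    then have "y \<in> K" "y + e \<in> K" using E F by auto
    then have "(1 - t) *\<^sub>R y + t *\<^sub>R (y + e) \<in> K" using * K(1) by (intro convexD_alt) auto
    moreover have "(1 - t) *\<^sub>R y + t *\<^sub>R (y + e) = x" by (simp add: y_def algebra_simps)
    ultimately show "x \<in> K" by simp
  qed
  \<comment> \<open>Stated for arbitrary values because it is applied to the functions and to their
    gradients. Passing from \<open>Z\<close> to the interior of \<open>K\<close> loses only part of
    the frontier, which is null for a convex set.\<close>
  have Z_le: "(\<integral>\<^sup>+x\<in>Z. ennreal (norm (f x)) \<partial>lborel) \<le> ennreal (sqrt (measure lebesgue U) * Lp_norm (lebesgue_on U) 2 f)"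
    and LpU: "Lp (lebesgue_on U) 2 f"
    if f: "continuous_on UNIV f" for f :: "real ^ 'n \<Rightarrow> 'b::{real_normed_vector, second_countable_topology}"
  proof -
    show Lp: "Lp (lebesgue_on U) 2 f"
    proof (rule Lp_continuous_on_compact[OF finU _ _ K(2)])
      show "f \<in> borel_measurable (lebesgue_on U)" by (rule borel_measurable_lebesgue_on_continuous[OF f])
      show "continuous_on K f" by (rule continuous_on_subset[OF f]) simp
      show "space (lebesgue_on U) \<subseteq> K"
        by (simp add: U_def space_restrict_space interior_subset)
    qed simp
    have "(\<integral>\<^sup>+x\<in>Z. ennreal (norm (f x)) \<partial>lborel) = (\<integral>\<^sup>+x\<in>Z. ennreal (norm (f x)) \<partial>lebesgue)"
      by (simp add: nn_integral_completion)
    also have "\<dots> \<le> (\<integral>\<^sup>+x\<in>U. ennreal (norm (f x)) \<partial>lebesgue)"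
    proof (intro nn_integral_mono_AE)
      have "AE x in lebesgue. x \<notin> frontier K"
        using negligible_convex_frontier[OF K(1)] by (intro AE_not_in) (simp add: negligible_iff_null_sets)
      then show "AE x in lebesgue. ennreal (norm (f x)) * indicator Z x \<le> ennreal (norm (f x)) * indicator U x"
      proof eventually_elim
        case (elim x)
        then have "x \<in> U" if "x \<in> Z"
          using that \<open>Z \<subseteq> K\<close> closure_subset[of K] by (auto simp: frontier_def U_def)
        then show ?case by (auto simp: indicator_def)
      qed
    qed
    also have "\<dots> = (\<integral>\<^sup>+x. ennreal (norm (f x)) \<partial>lebesgue_on U)"
      by (subst nn_integral_restrict_space) (auto simp: U_def)
    also have "\<dots> \<le> ennreal (sqrt (measure lebesgue U) * Lp_norm (lebesgue_on U) 2 f)"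
      using nn_integral_norm_le_Lp_norm_2[OF finU Lp]
      by (simp add: space_restrict_space measure_restrict_space U_def)
    finally show "(\<integral>\<^sup>+x\<in>Z. ennreal (norm (f x)) \<partial>lborel) \<le> ennreal (sqrt (measure lebesgue U) * Lp_norm (lebesgue_on U) 2 f)" .
  qed
  obtain \<Phi> d where g: "Lp M 2 g" and \<Phi>: "\<And>j :: nat. C1_function (\<Phi> j) (d j)"
    and lim: "(\<lambda>j. Lp_norm (lebesgue_on U) 2 (\<lambda>x. \<Phi> j x - 0)) \<longlonglongrightarrow> 0"
      "(\<lambda>j. Lp_norm (lebesgue_on U) 2 (\<lambda>x. d j x - weak_gradient 2 U (\<lambda>_. 0) x)) \<longlonglongrightarrow> 0"
      "(\<lambda>j. Lp_norm M 2 (\<lambda>x. \<Phi> j x - g x)) \<longlonglongrightarrow> 0"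
    using tr unfolding has_trace_def M_def U_def by blast
  have cont: "continuous_on UNIV (\<Phi> j)" "continuous_on UNIV (d j)" for j
    using C1_function_continuous[OF \<Phi>] \<Phi>[of j] by (auto simp: C1_function_def)
  have [measurable]: "\<Phi> j \<in> borel_measurable borel" for j
    using cont(1) by (rule borel_measurable_continuous_onI)
  have openU: "open U" and bddU: "bounded U"
    using K(2) compact_imp_bounded bounded_interior by (auto simp: U_def)
  have lim2: "(\<lambda>j. Lp_norm (lebesgue_on U) 2 (d j)) \<longlonglongrightarrow> 0"
  proof -
    have "Lp_norm (lebesgue_on U) 2 (\<lambda>x. d j x - weak_gradient 2 U (\<lambda>_. 0) x) = Lp_norm (lebesgue_on U) 2 (d j)" for j
      using weak_gradient_zero[OF openU bddU] borel_measurable_lebesgue_on_continuous[OF cont(2)[of j], of U]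
      by (intro Lp_norm_cong_AE) (auto simp: Lp_def)
    then show ?thesis using lim(2) by simp
  qed
  have gM [measurable]: "g \<in> borel_measurable M" using g by (simp add: Lp_def)
  have EM [measurable]: "E \<in> sets M" using E(2) by (auto simp: M sets_restrict_space intro!: image_eqI[of _ _ E])
  have \<Phi>M [measurable]: "\<Phi> j \<in> borel_measurable M" for j
    unfolding M by (rule measurable_restrict_space1) measurable
  \<comment> \<open>The distance of the approximation from \<open>g\<close> on the facet, plus the
    right-hand side of the trace inequality for the approximation. Each term tends to 0, whereas the
    integral that \<open>T j\<close> bounds does not depend on \<open>j\<close>.\<close>
  define T where "T j = sqrt (measure M F) * Lp_norm M 2 (\<lambda>x. \<Phi> j x - g x)
     + C * (sqrt (measure lebesgue U) * Lp_norm (lebesgue_on U) 2 (\<Phi> j)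
          + norm e * (sqrt (measure lebesgue U) * Lp_norm (lebesgue_on U) 2 (d j)))" for j
  have le: "(\<integral>\<^sup>+x\<in>E. ennreal \<bar>g x\<bar> \<partial>M) \<le> ennreal (T j)" for j
  proof -
    have "Lp M 2 (\<Phi> j)"
      using F(1) bddF continuous_on_subset[OF cont(1)]
      by (intro Lp_continuous_on_compact[OF finM \<Phi>M, of F]) (auto simp: spM compact_eq_bounded_closed)
    then have Lpd: "Lp M 2 (\<lambda>x. \<Phi> j x - g x)" using g by (intro Lp_diff) auto
    have "(\<integral>\<^sup>+x\<in>E. ennreal \<bar>g x\<bar> \<partial>M) \<le> (\<integral>\<^sup>+x. ennreal \<bar>\<Phi> j x - g x\<bar> + ennreal \<bar>\<Phi> j x\<bar> * indicator E x \<partial>M)"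
    proof (intro nn_integral_mono)
      fix x
      have "ennreal \<bar>g x\<bar> \<le> ennreal (\<bar>\<Phi> j x - g x\<bar> + \<bar>\<Phi> j x\<bar>)" by (intro ennreal_leI) linarith
      then show "ennreal \<bar>g x\<bar> * indicator E x \<le> ennreal \<bar>\<Phi> j x - g x\<bar> + ennreal \<bar>\<Phi> j x\<bar> * indicator E x"
        by (auto simp: indicator_def)
    qed
    also have "\<dots> = (\<integral>\<^sup>+x. ennreal \<bar>\<Phi> j x - g x\<bar> \<partial>M) + (\<integral>\<^sup>+x\<in>E. ennreal \<bar>\<Phi> j x\<bar> \<partial>M)"
      by (intro nn_integral_add) measurable
    also have "(\<integral>\<^sup>+x\<in>E. ennreal \<bar>\<Phi> j x\<bar> \<partial>M) = (\<integral>\<^sup>+x\<in>E. ennreal \<bar>\<Phi> j x\<bar> \<partial>H)"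
      unfolding M using E(2)
      by (subst nn_integral_restrict_space) (auto intro!: nn_integral_cong simp: indicator_def)
    also have "(\<integral>\<^sup>+x. ennreal \<bar>\<Phi> j x - g x\<bar> \<partial>M) \<le> ennreal (sqrt (measure M F) * Lp_norm M 2 (\<lambda>x. \<Phi> j x - g x))"
      using nn_integral_norm_le_Lp_norm_2[OF finM Lpd] by (simp add: spM)
    also have "(\<integral>\<^sup>+x\<in>E. ennreal \<bar>\<Phi> j x\<bar> \<partial>H) \<le>
        ennreal C * (ennreal (sqrt (measure lebesgue U) * Lp_norm (lebesgue_on U) 2 (\<Phi> j))
          + ennreal (norm e) * ennreal (sqrt (measure lebesgue U) * Lp_norm (lebesgue_on U) 2 (d j)))"
      using Z_le[OF cont(1)[of j]] Z_le[OF cont(2)[of j]]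
      by (intro order_trans[OF C(2)[OF \<Phi>[of j]]] mult_left_mono add_mono) auto
    finally show ?thesis
      using C(1) unfolding T_def
      by (simp add: add_left_mono add_right_mono Lp_norm_nonneg ennreal_mult ennreal_plus)
  qed
  have "T \<longlonglongrightarrow> sqrt (measure M F) * 0 + C * (sqrt (measure lebesgue U) * 0 + norm e * (sqrt (measure lebesgue U) * 0))"
    unfolding T_def using lim lim2 by (intro tendsto_intros) auto
  then have "(\<lambda>j. ennreal (T j)) \<longlonglongrightarrow> ennreal 0" by (intro tendsto_ennrealI) simp
  then have "(\<integral>\<^sup>+x\<in>E. ennreal \<bar>g x\<bar> \<partial>M) \<le> 0"
    using le by (intro LIMSEQ_le_const) auto
  then have "AE x in M. ennreal \<bar>g x\<bar> * indicator E x = 0"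
    by (subst (asm) le_zero_eq, subst (asm) nn_integral_0_iff_AE) auto
  then show ?thesis unfolding M_def by eventually_elim (auto simp: indicator_def split: if_splits)
qed

lemma Lp_cong_AE:
  fixes f g :: "'a \<Rightarrow> 'b::{real_normed_vector, second_countable_topology}"
  assumes "Lp M r f" "g \<in> borel_measurable M" "AE x in M. f x = g x"
  shows "Lp M r g"
proof -
  have "integrable M (\<lambda>x. norm (f x) powr r) \<longleftrightarrow> integrable M (\<lambda>x. norm (g x) powr r)"
    using assms by (intro integrable_cong_AE) (auto simp: Lp_def elim!: eventually_mono)
  then show ?thesis using assms by (simp add: Lp_def)
qed

text \<open>The barycentric coordinates of \<open>y\<close> on the facet sum to 1, so one of them is
  at least the reciprocal of their number. Moving that much weight from its vertex \<open>v\<close>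
  to \<open>u\<close> keeps all coordinates nonnegative. Where the coordinate of \<open>v\<close>
  vanishes the same shift leaves the simplex, so \<open>v\<close> has to depend on
  \<open>y\<close>.\<close>

lemma simplex_facet_shift:
  fixes C :: "'a::euclidean_space set"
  assumes "finite C" "u \<in> C" "y \<in> convex hull (C - {u})"
  shows "\<exists>v\<in>C - {u}. y + (1 / real (card (C - {u}))) *\<^sub>R (u - v) \<in> convex hull C"
proof -
  define D where "D = C - {u}"
  have D: "finite D" "u \<notin> D" "C = insert u D" using assms by (auto simp: D_def)
  define N where "N = real (card D)"
  obtain l where l: "\<forall>w\<in>D. 0 \<le> l w" "sum l D = 1" "(\<Sum>w\<in>D. l w *\<^sub>R w) = y"
    using assms(3) convex_hull_finite[OF D(1)] by (auto simp: D_def)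
  have "D \<noteq> {}" using l(2) by auto
  then have N: "N > 0" using D(1) by (simp add: N_def card_gt_0_iff)
  obtain v where v: "v \<in> D" "l v \<ge> 1 / N"
  proof (rule ccontr)
    assume "\<not> thesis"
    then have "\<forall>w\<in>D. l w < 1 / N" using that not_le by blast
    then have "sum l D < (\<Sum>w\<in>D. 1 / N)"
      using D(1) \<open>D \<noteq> {}\<close> by (intro sum_strict_mono) auto
    then show False using l(2) N by (simp add: N_def)
  qed
  define l' where "l' w = (if w = u then 1 / N else l w - (if w = v then 1 / N else 0))" for w
  have l'D: "l' w = l w - (if w = v then 1 / N else 0)" if "w \<in> D" for w
    using that D(2) by (auto simp: l'_def)
  have "sum l' C = 1 / N + (\<Sum>w\<in>D. l w - (if w = v then 1 / N else 0))"
    using D l'D by (simp add: l'_def)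
  also have "\<dots> = 1" using l(2) D(1) v(1) by (simp add: sum_subtractf)
  finally have 1: "sum l' C = 1" .
  have "(\<Sum>w\<in>C. l' w *\<^sub>R w) = (1 / N) *\<^sub>R u + (\<Sum>w\<in>D. l w *\<^sub>R w - (if w = v then (1 / N) *\<^sub>R v else 0))"
    using D l'D by (simp add: l'_def) (auto intro!: sum.cong simp: scaleR_diff_left)
  also have "\<dots> = y + (1 / N) *\<^sub>R (u - v)"
    using l(3) D(1) v(1) by (simp add: sum_subtractf algebra_simps)
  finally have 2: "(\<Sum>w\<in>C. l' w *\<^sub>R w) = y + (1 / N) *\<^sub>R (u - v)" .
  have 3: "\<forall>w\<in>C. 0 \<le> l' w" using l(1) v N D by (auto simp: l'_def)
  show ?thesis
    unfolding D_def[symmetric] N_def[symmetric] convex_hull_finite[OF assms(1)]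
    using v(1) 1 2 3 by (intro bexI[of _ v]) blast+
qed

text \<open>The closed sets \<open>E v\<close>, where a fixed multiple of \<open>u - v\<close> is an
  admissible shift, cover the facet by the barycentric argument. The trace vanishes almost
  everywhere on each of them, and there are finitely many.\<close>

lemma trace_of_zero_facet_AE:
  fixes K F :: "(real ^ 'n) set"
  assumes n: "CARD('n) \<ge> 2" and K: "m simplex K" and F: "F facet_of K"
    and tr: "has_trace 2 K F (\<lambda>_. 0) g"
  shows "AE x in surface_measure F. g x = 0"
proof -
  obtain C where C: "finite C" "\<not> affine_dependent C" "K = convex hull C"
    using K unfolding simplex by blast
  obtain u where u: "u \<in> C" "F = convex hull (C - {u})"
    using F facet_of_convex_hull_affine_independent[OF C(2)] C(3) by blast
  have convK: "convex K" "compact K" using C by (auto intro: finite_imp_compact_convex_hull)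
  have clF: "closed F" using C(1) u(2) by (simp add: compact_imp_closed finite_imp_compact_convex_hull)
  have "polyhedron K" using C by (simp add: polyhedron_convex_hull)
  then obtain a b where ab: "a \<noteq> 0" "K \<subseteq> {x. a \<bullet> x \<le> b}" "F = K \<inter> {x. a \<bullet> x = b}"
    using facet_of_polyhedron F by metis
  have "u \<notin> F"
    using C(2) u convex_hull_subset_affine_hull[of "C - {u}"] unfolding affine_dependent_def by blast
  then have au: "a \<bullet> u \<noteq> b" using ab(3) C(3) u(1) by (simp add: hull_inc)
  define N where "N = real (card (C - {u}))"
  define E where "E v = F \<inter> {y. y + (1 / N) *\<^sub>R (u - v) \<in> K}" for v
  have "AE x in surface_measure F. x \<in> E v \<longrightarrow> g x = 0" if v: "v \<in> C - {u}" for v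
  proof -
    have "v \<in> F" unfolding u(2) using v by (rule hull_inc)
    then have av: "a \<bullet> v = b" using ab(3) by auto
    have "N > 0" using v C(1) by (auto simp: N_def card_gt_0_iff)
    define e where "e = (1 / N) *\<^sub>R (u - v)"
    have ae: "a \<bullet> e \<noteq> 0" using au av \<open>N > 0\<close> by (simp add: e_def inner_diff_right)
    \<comment> \<open>The facet normal rescaled to \<open>\<nu> \<bullet> e = 1\<close>. As
      \<open>a\<close> points out of \<open>K\<close> and \<open>e\<close> into it,
      \<open>a \<bullet> e\<close> is negative and \<open>\<nu>\<close> is an inward normal; the
      level of the hyperplane becomes \<open>b / (a \<bullet> e)\<close>.\<close>
    define \<nu> where "\<nu> = (1 / (a \<bullet> e)) *\<^sub>R a"
    have clE: "closed (E v)"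
    proof -
      have "closed ((\<lambda>y. y + e) -` K)"
        using convK by (intro continuous_closed_vimage compact_imp_closed) (auto intro!: continuous_intros)
      moreover have "E v = F \<inter> (\<lambda>y. y + e) -` K" by (auto simp: E_def e_def)
      ultimately show ?thesis using clF by (auto intro: closed_Int)
    qed
    show ?thesis
    proof (rule trace_of_zero_AE[OF n convK clF _ _ _ clE _ _ tr])
      show "F \<subseteq> K" using ab(3) by blast
      show "F \<subseteq> {x. \<nu> \<bullet> x = b / (a \<bullet> e)}" using ab(3) by (auto simp: \<nu>_def)
      show "\<nu> \<bullet> e = 1" using ae by (simp add: \<nu>_def)
      show "E v \<subseteq> F" by (simp add: E_def)
      show "y + e \<in> K" if "y \<in> E v" for y using that by (simp add: E_def e_def)
    qed
  qed
  then have "AE x in surface_measure F. \<forall>v\<in>C - {u}. x \<in> E v \<longrightarrow> g x = 0"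
    using C(1) by (subst AE_ball_countable) (auto intro: countable_finite)
  moreover have "AE x in surface_measure F. x \<in> F"
    using AE_space[of "surface_measure F"] by (simp add: surface_measure_def space_restrict_space)
  ultimately show ?thesis
  proof eventually_elim
    case (elim x)
    then obtain v where "v \<in> C - {u}" "x \<in> E v"
      using simplex_facet_shift[OF C(1) u(1), of x] C(3) u(2) by (auto simp: E_def N_def)
    then show ?case using elim by blast
  qed
qed

text \<open>The constant sequence 0 witnesses that zero has a trace, so the function selected by
  \<open>trace_on\<close> really is one and vanishes almost everywhere on the facet, in particular
  on \<open>\<Gamma>\<close>.\<close>

lemma zero_in_broken_W1:
  fixes T :: "(real ^ 'n) set set"
  assumes n: "CARD('n) \<ge> 2" and T: "\<And>K. K \<in> T \<Longrightarrow> \<exists>m. m simplex K"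
  shows "(\<lambda>_. 0) \<in> broken_W1 2 \<Omega> \<Gamma> T"
proof -
  have "AE x in surface_measure F. x \<in> \<Gamma> \<longrightarrow> trace_on 2 K F (\<lambda>_. 0) x = 0"
    if K: "K \<in> T" and F: "F facet_of K" for K F
  proof -
    obtain m where m: "m simplex K" using T[OF K] by blast
    then have "compact K" unfolding simplex by (auto intro: finite_imp_compact_convex_hull)
    then have bdd: "bounded (interior K)" using compact_imp_bounded bounded_interior by blast
    have 0: "Lp_norm M 2 (\<lambda>x. 0 :: 'b::real_normed_vector) = 0" for M :: "(real ^ 'n) measure"
      by (simp add: Lp_norm_def)
    have "Lp_norm (lebesgue_on (interior K)) 2 (\<lambda>x. 0 - weak_gradient 2 (interior K) (\<lambda>_. 0) x)
        = Lp_norm (lebesgue_on (interior K)) 2 (\<lambda>x. 0 :: real ^ 'n)"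
      using weak_gradient_zero[OF open_interior bdd]
      by (intro Lp_norm_cong_AE) (auto simp: Lp_def)
    then have "has_trace 2 K F (\<lambda>_. 0) (\<lambda>_. 0)"
      unfolding has_trace_def
      by (intro conjI exI[of _ "\<lambda>_ _. 0"]) (auto simp: Lp_def C1_function_def 0)
    then have "has_trace 2 K F (\<lambda>_. 0) (trace_on 2 K F (\<lambda>_. 0))"
      unfolding trace_on_def by (rule someI[of "has_trace 2 K F (\<lambda>_. 0)"])
    from trace_of_zero_facet_AE[OF n m F this] show ?thesis by eventually_elim simp
  qed
  moreover have "W1 2 U (\<lambda>_. 0)" for U :: "(real ^ 'n) set"
    unfolding W1_def by (auto simp: Lp_def has_weak_gradient_def intro!: exI[of _ "\<lambda>_. 0"])
  ultimately show ?thesis by (auto simp: broken_W1_def Lp_def)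
qed

lemma Lp_norm_6_le_norm_Psi:
  fixes T :: "(real ^ 'n) set set"
  assumes n: "CARD('n) \<ge> 2" and T: "\<And>K. K \<in> T \<Longrightarrow> \<exists>m. m simplex K"
    and "\<alpha> > 0" "C_emb \<ge> 0" and emb: "sobolev_embedding_constant \<Omega> \<Gamma>u T C_emb"
    and \<phi>: "Lp (lebesgue_on \<Omega>) 6 \<phi>"
    and B: "B \<ge> 1" "B \<ge> C_emb * \<alpha> powr (-1/2)"
  shows "Lp_norm (lebesgue_on \<Omega>) 6 \<phi> \<le> B * norm_Psi \<Omega> \<Gamma>u T \<alpha> \<phi>"
proof -
  define S where "S = {Lp_norm (lebesgue_on \<Omega>) 6 \<psi>1 + \<alpha> powr (1/2) * broken_seminorm 2 T \<psi>2 | \<psi>1 \<psi>2.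
          Lp (lebesgue_on \<Omega>) 6 \<psi>1 \<and> \<psi>2 \<in> broken_W1 2 \<Omega> \<Gamma>u T \<and>
          (AE x in lebesgue_on \<Omega>. \<phi> x = \<psi>1 x + \<psi>2 x)}"
  have "Lp_norm (lebesgue_on \<Omega>) 6 \<phi> / B \<le> Inf S"
  proof (rule cInf_greatest)
    show "S \<noteq> {}"
    proof -
      have "(\<lambda>_. 0) \<in> broken_W1 2 \<Omega> \<Gamma>u T" by (rule zero_in_broken_W1[OF n T])
      then have "Lp_norm (lebesgue_on \<Omega>) 6 \<phi> + \<alpha> powr (1/2) * broken_seminorm 2 T (\<lambda>_. 0) \<in> S"
        unfolding S_def using \<phi>
        by (intro CollectI exI[of _ \<phi>] exI[of _ "\<lambda>_. 0"]) simp
      then show ?thesis by blast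
    qed
    fix s assume "s \<in> S"
    then obtain \<psi>1 \<psi>2 where s: "s = Lp_norm (lebesgue_on \<Omega>) 6 \<psi>1 + \<alpha> powr (1/2) * broken_seminorm 2 T \<psi>2"
      and \<psi>1: "Lp (lebesgue_on \<Omega>) 6 \<psi>1" and \<psi>2: "\<psi>2 \<in> broken_W1 2 \<Omega> \<Gamma>u T"
      and eq: "AE x in lebesgue_on \<Omega>. \<phi> x = \<psi>1 x + \<psi>2 x" by (auto simp: S_def)
    have m2: "\<psi>2 \<in> borel_measurable (lebesgue_on \<Omega>)" using \<psi>2 by (auto simp: broken_W1_def Lp_def)
    \<comment> \<open>Membership in the broken space gives only \<open>L2\<close>, and a bound on
      \<open>Lp_norm\<close> does not show integrability. The sixth power is integrable because
      \<open>\<psi>2\<close> agrees with \<open>\<phi> - \<psi>1\<close> almost everywhere.\<close>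
    have L2: "Lp (lebesgue_on \<Omega>) 6 \<psi>2"
    proof (rule Lp_cong_AE[OF Lp_diff[OF \<phi> \<psi>1] m2])
      show "AE x in lebesgue_on \<Omega>. \<phi> x - \<psi>1 x = \<psi>2 x" using eq by eventually_elim simp
    qed simp
    have nn: "broken_seminorm 2 T \<psi>2 \<ge> 0" by (simp add: broken_seminorm_def)
    have "Lp_norm (lebesgue_on \<Omega>) 6 \<phi> = Lp_norm (lebesgue_on \<Omega>) 6 (\<lambda>x. \<psi>1 x + \<psi>2 x)"
      using \<phi> \<psi>1 m2 eq by (intro Lp_norm_cong_AE) (auto simp: Lp_def)
    also have "\<dots> \<le> Lp_norm (lebesgue_on \<Omega>) 6 \<psi>1 + Lp_norm (lebesgue_on \<Omega>) 6 \<psi>2"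
      by (rule Minkowski[OF \<psi>1 L2]) simp
    also have "\<dots> \<le> Lp_norm (lebesgue_on \<Omega>) 6 \<psi>1 + C_emb * broken_seminorm 2 T \<psi>2"
      using emb \<psi>2 by (simp add: sobolev_embedding_constant_def)
    \<comment> \<open>The factor \<open>\<alpha> powr (-1/2) * \<alpha> powr (1/2)\<close>, equal to
      1, is inserted to match the weight in \<open>norm_Psi\<close>; \<open>B\<close> dominates the
      two remaining coefficients.\<close>
    also have "\<dots> = 1 * Lp_norm (lebesgue_on \<Omega>) 6 \<psi>1
        + (C_emb * \<alpha> powr (-1/2)) * (\<alpha> powr (1/2) * broken_seminorm 2 T \<psi>2)"
    proof -
      have "\<alpha> powr (-1/2) * \<alpha> powr (1/2) = 1" using \<open>\<alpha> > 0\<close> by (simp add: powr_add[symmetric])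
      then show ?thesis by simp
    qed
    also have "\<dots> \<le> B * Lp_norm (lebesgue_on \<Omega>) 6 \<psi>1 + B * (\<alpha> powr (1/2) * broken_seminorm 2 T \<psi>2)"
      using B nn by (intro add_mono mult_right_mono) (auto simp: Lp_norm_nonneg)
    also have "\<dots> = B * s" by (simp add: s distrib_left)
    finally show "Lp_norm (lebesgue_on \<Omega>) 6 \<phi> / B \<le> s" using B(1) by (simp add: divide_le_eq mult.commute)
  qed
  then show ?thesis using B(1) unfolding norm_Psi_def S_def by (simp add: divide_le_eq mult.commute)
qed

section \<open>Contractions of finite-dimensional function spaces\<close>

text \<open>Span, subspace and independence are taken in the space of all functions with pointwise
  operations, so that spaces depending on the mesh can remain sets.\<close>

interpretation fn: vector_space "\<lambda>c (f :: 'a \<Rightarrow> 'b::real_vector) x. c *\<^sub>R f x"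
  by unfold_locales (auto simp: fun_eq_iff plus_fun_def scaleR_add_right scaleR_add_left)

lemma sum_fun_apply: "(\<Sum>i\<in>A. F i) x = (\<Sum>i\<in>A. F i x)" for F :: "'i \<Rightarrow> 'a \<Rightarrow> 'b::real_vector"
  by (induction A rule: infinite_finite_induct) auto

lemma fn_subspaceI:
  fixes S :: "('a \<Rightarrow> 'b::real_vector) set"
  assumes "(\<lambda>_. 0) \<in> S" "\<And>u v. u \<in> S \<Longrightarrow> v \<in> S \<Longrightarrow> (\<lambda>x. u x + v x) \<in> S"
    "\<And>c u. u \<in> S \<Longrightarrow> (\<lambda>x. c *\<^sub>R u x) \<in> S"
  shows "fn.subspace S"
  using assms unfolding fn.subspace_def zero_fun_def plus_fun_def by blast

lemma fn_subspaceD: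
  fixes S :: "('a \<Rightarrow> 'b::real_vector) set"
  assumes "fn.subspace S"
  shows "(\<lambda>_. 0) \<in> S" "u \<in> S \<Longrightarrow> v \<in> S \<Longrightarrow> (\<lambda>x. u x + v x) \<in> S"
    "u \<in> S \<Longrightarrow> (\<lambda>x. c *\<^sub>R u x) \<in> S" "u \<in> S \<Longrightarrow> v \<in> S \<Longrightarrow> (\<lambda>x. u x - v x) \<in> S"
proof -
  show "(\<lambda>_. 0) \<in> S" using fn.subspace_0[OF assms] by (simp add: zero_fun_def)
  show "u \<in> S \<Longrightarrow> v \<in> S \<Longrightarrow> (\<lambda>x. u x + v x) \<in> S" using fn.subspace_add[OF assms, of u v] by (simp add: plus_fun_def)
  show "u \<in> S \<Longrightarrow> (\<lambda>x. c *\<^sub>R u x) \<in> S" by (rule fn.subspace_scale[OF assms])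
  show "u \<in> S \<Longrightarrow> v \<in> S \<Longrightarrow> (\<lambda>x. u x - v x) \<in> S" using fn.subspace_diff[OF assms, of u v] by (simp add: fun_diff_def)
qed

text \<open>The axioms are restricted to \<open>V\<close> because the intended norm is built from
  derivatives and integrals that behave linearly only on suitable functions.\<close>

locale fn_norm =
  fixes V :: "('a \<Rightarrow> 'b::real_vector) set" and N :: "('a \<Rightarrow> 'b) \<Rightarrow> real"
  assumes sub: "fn.subspace V"
    and tri: "u \<in> V \<Longrightarrow> v \<in> V \<Longrightarrow> N (u + v) \<le> N u + N v"
    and hom: "u \<in> V \<Longrightarrow> N (\<lambda>x. c *\<^sub>R u x) = \<bar>c\<bar> * N u"
    and def0: "u \<in> V \<Longrightarrow> N u = 0 \<Longrightarrow> u = 0"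
begin

lemma N_0: "N 0 = 0"
  using hom[of 0 0] fn.subspace_0[OF sub] by (simp add: zero_fun_def)

lemma N_minus: "u \<in> V \<Longrightarrow> N (- u) = N u"
  using hom[of u "-1"] by (simp add: fun_Compl_def)

lemma N_diff_commute: "u \<in> V \<Longrightarrow> v \<in> V \<Longrightarrow> N (u - v) = N (v - u)"
  using N_minus[of "u - v"] fn.subspace_diff[OF sub] by simp

lemma N_nonneg: "u \<in> V \<Longrightarrow> N u \<ge> 0"
  using tri[of u "- u"] N_minus[of u] N_0 fn.subspace_neg[OF sub, of u] by simp

lemma N_triangle: "u \<in> V \<Longrightarrow> v \<in> V \<Longrightarrow> w \<in> V \<Longrightarrow> N (u - w) \<le> N (u - v) + N (v - w)"
  using tri[of "u - v" "v - w"] fn.subspace_diff[OF sub] by simp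

definition complete_in :: "('a \<Rightarrow> 'b) set \<Rightarrow> bool" where
  "complete_in S \<longleftrightarrow> (\<forall>s. (\<forall>n. s n \<in> S) \<and> (\<forall>\<epsilon>>0. \<exists>n0. \<forall>m\<ge>n0. \<forall>n\<ge>n0. N (s m - s n) < \<epsilon>) \<longrightarrow>
      (\<exists>l\<in>S. (\<lambda>n. N (s n - l)) \<longlonglongrightarrow> 0))"

text \<open>A new vector \<open>b\<close> has positive distance from the complete span of
  \<open>B\<close>. This bounds the coefficient of \<open>b\<close> by the norm, so a Cauchy
  sequence splits into a Cauchy sequence of coefficients and one in the old span.\<close>

lemma complete_in_span_insert:
  assumes S: "complete_in (fn.span B)" and B: "B \<subseteq> V" and b: "b \<in> V"
  shows "complete_in (fn.span (insert b B))"
proof (cases "b \<in> fn.span B")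
  case True
  then show ?thesis using S by (simp add: fn.span_redundant)
next
  case False
  have BV: "fn.span B \<subseteq> V" by (rule fn.span_minimal[OF B sub])
  have bBV: "fn.span (insert b B) \<subseteq> V" using B b by (intro fn.span_minimal sub) auto
  note diffV = fn.subspace_diff[OF sub] and scaleV = fn.subspace_scale[OF sub]
  \<comment> \<open>If the distance were 0, points of the span approaching \<open>b\<close> would
    form a Cauchy sequence; its limit in the span would have distance 0 from \<open>b\<close>, hence
    equal \<open>b\<close>.\<close>
  obtain \<delta> where \<delta>: "\<delta> > 0" "\<And>y. y \<in> fn.span B \<Longrightarrow> \<delta> \<le> N (b - y)"
  proof (rule ccontr)
    assume "\<not> thesis"
    then have "\<not> (\<forall>y\<in>fn.span B. 1 / real (Suc n) \<le> N (b - y))" for n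
      using that[of "1 / real (Suc n)"] by (simp del: of_nat_Suc) blast
    then have "\<exists>y\<in>fn.span B. N (b - y) < 1 / real (Suc n)" for n
      by (simp add: not_le del: of_nat_Suc)
    then obtain y where y: "\<And>n. y n \<in> fn.span B" "\<And>n. N (b - y n) < 1 / real (Suc n)" by metis
    have yV: "y n \<in> V" for n using y BV by blast
    have "\<exists>n0. \<forall>m\<ge>n0. \<forall>n\<ge>n0. N (y m - y n) < \<epsilon>" if "\<epsilon> > 0" for \<epsilon>
    proof -
      obtain n0 where n0: "1 / real (Suc n0) < \<epsilon> / 2"
        using reals_Archimedean[of "\<epsilon> / 2"] \<open>\<epsilon> > 0\<close> by (auto simp: inverse_eq_divide)
      have small: "N (b - y n) < \<epsilon> / 2" if "n \<ge> n0" for n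
      proof -
        have "1 / real (Suc n) \<le> 1 / real (Suc n0)" using that by (intro divide_left_mono) auto
        then show ?thesis using y(2)[of n] n0 by linarith
      qed
      have "N (y m - y n) < \<epsilon>" if "m \<ge> n0" "n \<ge> n0" for m n
        using N_triangle[OF yV[of m] b yV[of n]] N_diff_commute[OF yV[of m] b] small[OF that(1)] small[OF that(2)]
        by simp
      then show ?thesis by blast
    qed
    then obtain l where l: "l \<in> fn.span B" "(\<lambda>n. N (y n - l)) \<longlonglongrightarrow> 0"
      using S y(1) unfolding complete_in_def by blast
    have lV: "l \<in> V" using l BV by blast
    have "N (b - l) \<le> 1 / real (Suc n) + N (y n - l)" for n
      using N_triangle[OF b yV lV, of n] y(2)[of n] by linarith
    moreover have "(\<lambda>n. 1 / real (Suc n) + N (y n - l)) \<longlonglongrightarrow> 0 + 0"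
      by (intro tendsto_add l LIMSEQ_Suc[OF lim_1_over_n])
    ultimately have "N (b - l) \<le> 0" by (intro LIMSEQ_le_const) auto
    then have "b - l = 0" using N_nonneg[of "b - l"] def0[of "b - l"] diffV[OF b lV] by auto
    then show False using False l by simp
  qed
  \<comment> \<open>For \<open>c \<noteq> 0\<close> factor out \<open>c\<close>: what remains is the
    distance from \<open>b\<close> to a point of the span.\<close>
  have coeff: "\<delta> * \<bar>c\<bar> \<le> N (y + (\<lambda>x. c *\<^sub>R b x))" if y: "y \<in> fn.span B" for y c
  proof (cases "c = 0")
    case True
    then show ?thesis using N_nonneg[of y] y BV by (auto simp: plus_fun_def)
  next
    case False
    have *: "(\<lambda>x. (- 1 / c) *\<^sub>R y x) \<in> fn.span B" using y by (rule fn.span_scale)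
    then have **: "b - (\<lambda>x. (- 1 / c) *\<^sub>R y x) \<in> V" using b BV by (intro diffV) auto
    have eq: "y + (\<lambda>x. c *\<^sub>R b x) = (\<lambda>x. c *\<^sub>R (b - (\<lambda>x. (- 1 / c) *\<^sub>R y x)) x)"
      using False by (auto simp: fun_eq_iff algebra_simps)
    show ?thesis unfolding eq hom[OF **] mult.commute[of \<delta>] by (intro mult_left_mono \<delta>(2) *) simp
  qed
  show ?thesis
    unfolding complete_in_def
  proof (intro allI impI, elim conjE)
    fix s :: "nat \<Rightarrow> 'a \<Rightarrow> 'b" assume s: "\<forall>n. s n \<in> fn.span (insert b B)"
      and cauchy: "\<forall>\<epsilon>>0. \<exists>n0. \<forall>m\<ge>n0. \<forall>n\<ge>n0. N (s m - s n) < \<epsilon>"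
    have "\<exists>c. s n - (\<lambda>x. c *\<^sub>R b x) \<in> fn.span B" for n
      using s fn.span_breakdown_eq[of "s n" b B] by blast
    then obtain c where c: "\<And>n. s n - (\<lambda>x. c n *\<^sub>R b x) \<in> fn.span B" by metis
    define y where "y n = s n - (\<lambda>x. c n *\<^sub>R b x)" for n
    have y: "y n \<in> fn.span B" for n using c by (simp add: y_def)
    have yV: "y n \<in> V" and sV: "s n \<in> V" for n using y s BV bBV by blast+
    have "\<delta> * \<bar>c m - c n\<bar> \<le> N (s m - s n)" for m n
    proof -
      have "s m - s n = (y m - y n) + (\<lambda>x. (c m - c n) *\<^sub>R b x)"
        by (auto simp: y_def fun_eq_iff algebra_simps)
      then show ?thesis using coeff[OF fn.span_diff[OF y y]] by metis
    qed
    then have cdiff: "\<bar>c m - c n\<bar> \<le> N (s m - s n) / \<delta>" for m n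
      using \<delta>(1) by (simp add: field_simps)
    have "Cauchy c"
    proof (rule metric_CauchyI)
      fix \<epsilon> :: real assume "\<epsilon> > 0"
      then obtain n0 where "\<forall>m\<ge>n0. \<forall>n\<ge>n0. N (s m - s n) < \<epsilon> * \<delta>" using cauchy \<delta>(1) by (meson mult_pos_pos)
      then have "N (s m - s n) / \<delta> < \<epsilon>" if "m \<ge> n0" "n \<ge> n0" for m n
        using that \<delta>(1) by (simp add: pos_divide_less_eq)
      then show "\<exists>M. \<forall>m\<ge>M. \<forall>n\<ge>M. dist (c m) (c n) < \<epsilon>"
        using cdiff by (metis dist_real_def le_less_trans)
    qed
    then obtain c0 where c0: "c \<longlonglongrightarrow> c0" using Cauchy_convergent convergentD by blast
    have bV: "(\<lambda>x. k *\<^sub>R b x) \<in> V" for k using b by (rule scaleV)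
    have "\<exists>n0. \<forall>m\<ge>n0. \<forall>n\<ge>n0. N (y m - y n) < \<epsilon>" if "\<epsilon> > 0" for \<epsilon>
    proof -
      \<comment> \<open>By the coefficient bound, removing the component along \<open>b\<close>
        increases a difference by at most the factor \<open>1 + N b / \<delta>\<close>;
        \<open>\<eta>\<close> compensates for it.\<close>
      define \<eta> where "\<eta> = \<epsilon> / (1 + N b / \<delta>)"
      have pos: "1 + N b / \<delta> > 0" using N_nonneg[OF b] \<delta>(1) by (simp add: add_pos_nonneg)
      then have "\<eta> > 0" using \<open>\<epsilon> > 0\<close> by (simp add: \<eta>_def)
      then obtain n0 where n0: "\<forall>m\<ge>n0. \<forall>n\<ge>n0. N (s m - s n) < \<eta>" using cauchy by blast
      have "N (y m - y n) < \<epsilon>" if "m \<ge> n0" "n \<ge> n0" for m n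
      proof -
        have "y m - y n = (s m - s n) + (\<lambda>x. (c n - c m) *\<^sub>R b x)"
          by (auto simp: y_def fun_eq_iff algebra_simps)
        then have "N (y m - y n) \<le> N (s m - s n) + \<bar>c n - c m\<bar> * N b"
          using tri[OF diffV[OF sV[of m] sV[of n]] bV[of "c n - c m"]] by (simp add: hom[OF b])
        also have "\<dots> \<le> N (s m - s n) + (N (s m - s n) / \<delta>) * N b"
          using cdiff[of m n] N_nonneg[OF b] by (intro add_left_mono mult_right_mono) (auto simp: abs_minus_commute)
        also have "\<dots> = N (s m - s n) * (1 + N b / \<delta>)" by (simp add: algebra_simps)
        also have "\<dots> < \<eta> * (1 + N b / \<delta>)" using n0 that pos by (intro mult_strict_right_mono) auto
        also have "\<dots> = \<epsilon>" using pos by (simp add: \<eta>_def)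
        finally show ?thesis .
      qed
      then show ?thesis by blast
    qed
    then obtain l where l: "l \<in> fn.span B" "(\<lambda>n. N (y n - l)) \<longlonglongrightarrow> 0"
      using S y unfolding complete_in_def by blast
    have lV: "l \<in> V" using l BV by blast
    define L where "L = l + (\<lambda>x. c0 *\<^sub>R b x)"
    have LS: "L \<in> fn.span (insert b B)"
    proof -
      have "l \<in> fn.span (insert b B)" using l(1) fn.span_mono[of B "insert b B"] by blast
      then show ?thesis
        unfolding L_def by (intro fn.span_add fn.span_scale[OF fn.span_base]) auto
    qed
    have "(\<lambda>n. N (s n - L)) \<longlonglongrightarrow> 0"
    proof (rule Lim_null_comparison)
      show "\<forall>\<^sub>F n in sequentially. norm (N (s n - L)) \<le> N (y n - l) + \<bar>c n - c0\<bar> * N b"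
      proof (intro always_eventually allI)
        fix n
        have "s n - L = (y n - l) + (\<lambda>x. (c n - c0) *\<^sub>R b x)"
          by (auto simp: L_def y_def fun_eq_iff algebra_simps)
        then have "N (s n - L) \<le> N (y n - l) + \<bar>c n - c0\<bar> * N b"
          using tri[OF diffV[OF yV[of n] lV] bV[of "c n - c0"]] by (simp add: hom[OF b])
        moreover have "N (s n - L) \<ge> 0" using LS bBV by (intro N_nonneg diffV sV) auto
        ultimately show "norm (N (s n - L)) \<le> N (y n - l) + \<bar>c n - c0\<bar> * N b" by simp
      qed
      have "(\<lambda>n. N (y n - l) + \<bar>c n - c0\<bar> * N b) \<longlonglongrightarrow> 0 + \<bar>c0 - c0\<bar> * N b"
        by (intro tendsto_intros l c0)
      then show "(\<lambda>n. N (y n - l) + \<bar>c n - c0\<bar> * N b) \<longlonglongrightarrow> 0" by simp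
    qed
    then show "\<exists>l\<in>fn.span (insert b B). (\<lambda>n. N (s n - l)) \<longlonglongrightarrow> 0" using LS by blast
  qed
qed

text \<open>The generators \<open>G\<close> may lie outside \<open>V\<close>, where \<open>N\<close>
  obeys no axioms. They only bound the size of a basis chosen inside \<open>V\<close>, and the
  induction runs over that basis.\<close>

lemma complete_if_finite_dimensional:
  assumes "finite G" "V \<subseteq> fn.span G"
  shows "complete_in V"
proof -
  obtain B where B: "B \<subseteq> V" "fn.independent B" "V \<subseteq> fn.span B"
    using fn.maximal_independent_subset[of V] by blast
  have "finite B" using fn.independent_span_bound[OF assms(1) B(2)] B(1) assms(2) by blast
  then have "complete_in (fn.span B)" using B(1)
  proof (induction B)
    case empty
    then show ?case by (auto simp: complete_in_def N_0)
  next
    case (insert b B)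
    then show ?case by (intro complete_in_span_insert) auto
  qed
  moreover have "fn.span B = V" using fn.span_minimal[OF B(1) sub] B(3) by blast
  ultimately show ?thesis by simp
qed

lemma contraction_fixed_point:
  assumes "finite G" "V \<subseteq> fn.span G"
    and S: "\<And>u. u \<in> V \<Longrightarrow> S u \<in> V"
    and contr: "\<And>u v. u \<in> V \<Longrightarrow> v \<in> V \<Longrightarrow> N (S u - S v) \<le> L * N (u - v)" and L: "L < 1"
  shows "\<exists>!u. u \<in> V \<and> S u = u"
proof -
  \<comment> \<open>\<open>Metric_space\<close> demands nonnegativity and symmetry for all
    arguments, also outside the carrier; the value 0 there provides both.\<close>
  define d where "d u v = (if u \<in> V \<and> v \<in> V then N (u - v) else 0)" for u v
  have M: "Metric_space V d"
  proof
    show "0 \<le> d u v" for u v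
      using N_nonneg fn.subspace_diff[OF sub] by (auto simp: d_def)
    show "d u v = d v u" for u v using N_diff_commute by (auto simp: d_def)
    show "d u v = 0 \<longleftrightarrow> u = v" if "u \<in> V" "v \<in> V" for u v
      using that def0[of "u - v"] fn.subspace_diff[OF sub] N_0 by (auto simp: d_def)
    show "d u w \<le> d u v + d v w" if "u \<in> V" "v \<in> V" "w \<in> V" for u v w
      using that N_triangle by (simp add: d_def)
  qed
  have "Metric_space.mcomplete V d"
    unfolding Metric_space.mcomplete_def[OF M]
  proof (intro allI impI)
    fix s assume "Metric_space.MCauchy V d s"
    then have *: "\<forall>n. s n \<in> V" and cauchy: "\<forall>\<epsilon>>0. \<exists>n0. \<forall>m n. n0 \<le> m \<longrightarrow> n0 \<le> n \<longrightarrow> d (s m) (s n) < \<epsilon>"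
      unfolding Metric_space.MCauchy_def[OF M] by blast+
    from * have s: "s n \<in> V" for n by blast
    from cauchy have "\<forall>\<epsilon>>0. \<exists>n0. \<forall>m\<ge>n0. \<forall>n\<ge>n0. N (s m - s n) < \<epsilon>"
      using s by (simp add: d_def)
    then obtain l where l: "l \<in> V" "(\<lambda>n. N (s n - l)) \<longlonglongrightarrow> 0"
      using complete_if_finite_dimensional[OF assms(1,2)] s unfolding complete_in_def by blast
    have "limitin (Metric_space.mtopology V d) s l sequentially"
      unfolding Metric_space.limitin_metric[OF M]
    proof (intro conjI allI impI l(1))
      fix \<epsilon> :: real assume "\<epsilon> > 0"
      with l(2) have "\<forall>\<^sub>F n in sequentially. N (s n - l) < \<epsilon>" by (rule order_tendstoD)
      then show "\<forall>\<^sub>F n in sequentially. s n \<in> V \<and> d (s n) l < \<epsilon>"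
        using s l(1) by (simp add: d_def)
    qed
    then show "\<exists>l. limitin (Metric_space.mtopology V d) s l sequentially" by blast
  qed
  moreover have "V \<noteq> {}" using fn.subspace_0[OF sub] by blast
  ultimately obtain u where u: "u \<in> V" "S u = u"
    using Metric_space.Banach_fixedpoint_thm[OF M, of S L] S contr L by (auto simp: d_def)
  have "v = u" if v: "v \<in> V" "S v = v" for v
  proof -
    have uv: "v - u \<in> V" using u v by (intro fn.subspace_diff[OF sub])
    have "N (v - u) \<le> L * N (v - u)" using contr[OF v(1) u(1)] u v by simp
    then have "(1 - L) * N (v - u) \<le> 0" by (simp add: algebra_simps)
    then have "N (v - u) = 0" using L N_nonneg[OF uv] by (simp add: mult_le_0_iff)
    then show ?thesis using def0[OF uv] by simp
  qed
  then show ?thesis using u by blast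
qed

end

section \<open>Piecewise polynomials\<close>

text \<open>The vector-valued counterpart of \<open>C1_function\<close>. Continuity of the
  derivative is asked for in each direction separately, which is the form used to see that the
  divergence is piecewise continuous.\<close>

definition C1_maps :: "('a::real_normed_vector \<Rightarrow> 'b::real_normed_vector) set" where
  "C1_maps = {p. \<exists>D. (\<forall>x. (p has_derivative D x) (at x)) \<and> (\<forall>h. continuous_on UNIV (\<lambda>x. D x h))}"

lemma C1_maps_continuous: "p \<in> C1_maps \<Longrightarrow> continuous_on UNIV p"
  unfolding C1_maps_def by (auto intro: has_derivative_continuous_on)

lemma subspace_C1_maps: "fn.subspace C1_maps"
proof (rule fn_subspaceI)
  show "(\<lambda>_. 0) \<in> C1_maps" by (auto simp: C1_maps_def intro!: exI[of _ "\<lambda>_ _. 0"])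
next
  fix u v :: "'a \<Rightarrow> 'b" assume "u \<in> C1_maps" "v \<in> C1_maps"
  then obtain D E where "\<And>x. (u has_derivative D x) (at x)" "\<And>h. continuous_on UNIV (\<lambda>x. D x h)"
    "\<And>x. (v has_derivative E x) (at x)" "\<And>h. continuous_on UNIV (\<lambda>x. E x h)"
    by (auto simp: C1_maps_def)
  then show "(\<lambda>x. u x + v x) \<in> C1_maps" unfolding C1_maps_def
    by (auto intro!: exI[of _ "\<lambda>x h. D x h + E x h"] has_derivative_add continuous_on_add)
next
  fix c and u :: "'a \<Rightarrow> 'b" assume "u \<in> C1_maps"
  then obtain D where "\<And>x. (u has_derivative D x) (at x)" "\<And>h. continuous_on UNIV (\<lambda>x. D x h)"
    by (auto simp: C1_maps_def)
  then show "(\<lambda>x. c *\<^sub>R u x) \<in> C1_maps" unfolding C1_maps_def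
    by (auto intro!: exI[of _ "\<lambda>x h. c *\<^sub>R D x h"] has_derivative_scaleR_right continuous_on_scaleR continuous_on_const)
qed

lemma C1_function_scaleR_C1_map:
  assumes "C1_function \<phi> d" "p \<in> C1_maps"
  shows "(\<lambda>x. \<phi> x *\<^sub>R p x) \<in> C1_maps"
proof -
  obtain D where D: "\<And>x. (p has_derivative D x) (at x)" "\<And>h. continuous_on UNIV (\<lambda>x. D x h)"
    using assms(2) by (auto simp: C1_maps_def)
  have d: "\<And>x. (\<phi> has_derivative (\<lambda>h. d x \<bullet> h)) (at x)" "continuous_on UNIV d"
    using assms(1) by (auto simp: C1_function_def)
  show ?thesis unfolding C1_maps_def
    by (intro CollectI exI[of _ "\<lambda>x h. \<phi> x *\<^sub>R D x h + (d x \<bullet> h) *\<^sub>R p x"] conjI allI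
        has_derivative_scaleR d D continuous_intros C1_function_continuous[OF assms(1)] C1_maps_continuous assms)
qed

lemma C1_function_monomial:
  fixes \<beta> :: "'n::finite \<Rightarrow> nat"
  shows "\<exists>d. C1_function (monomial \<beta>) d"
proof -
  have "\<exists>d. C1_function (\<lambda>x :: real ^ 'n. x $ i ^ \<beta> i) d" for i :: 'n
  proof -
    have 1: "C1_function (\<lambda>x :: real ^ 'n. x $ i) (\<lambda>_. axis i 1)"
      unfolding C1_function_def inner_axis'
      by (simp add: bounded_linear_imp_has_derivative bounded_linear_vec_nth)
    have "C1_function (\<lambda>x :: real ^ 'n. (x $ i) ^ \<beta> i) (\<lambda>x. (real (\<beta> i) * (x $ i) ^ (\<beta> i - 1)) *\<^sub>R axis i 1)"
      by (rule C1_function_compose[OF 1]) (auto intro!: derivative_eq_intros continuous_intros)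
    then show ?thesis by blast
  qed
  then show ?thesis unfolding monomial_def[abs_def] by (intro C1_function_prod) auto
qed

lemma finite_multiindices: "finite {\<beta> :: 'n::finite \<Rightarrow> nat. sum \<beta> UNIV \<le> k}"
proof (rule finite_subset)
  show "{\<beta> :: 'n \<Rightarrow> nat. sum \<beta> UNIV \<le> k} \<subseteq> PiE UNIV (\<lambda>_. {..k})"
  proof
    fix \<beta> :: "'n \<Rightarrow> nat" assume "\<beta> \<in> {\<beta>. sum \<beta> UNIV \<le> k}"
    moreover have "\<beta> i \<le> sum \<beta> UNIV" for i by (rule member_le_sum) auto
    ultimately show "\<beta> \<in> PiE UNIV (\<lambda>_. {..k})" by (auto intro: order_trans)
  qed
  show "finite (PiE (UNIV :: 'n set) (\<lambda>_. {..k}))" by (intro finite_PiE) auto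
qed

lemma subspace_polynomials: "fn.subspace (polynomials k)"
proof (rule fn_subspaceI)
  show "(\<lambda>_. 0) \<in> polynomials k" by (auto simp: polynomials_def intro!: exI[of _ "\<lambda>_. 0"])
next
  fix u v :: "real ^ 'n \<Rightarrow> real" assume "u \<in> polynomials k" "v \<in> polynomials k"
  then obtain c d where "\<And>x. u x = (\<Sum>\<beta> | sum \<beta> UNIV \<le> k. c \<beta> * monomial \<beta> x)"
    "\<And>x. v x = (\<Sum>\<beta> | sum \<beta> UNIV \<le> k. d \<beta> * monomial \<beta> x)" by (auto simp: polynomials_def)
  then show "(\<lambda>x. u x + v x) \<in> polynomials k"
    unfolding polynomials_def
    by (intro CollectI exI[of _ "\<lambda>\<beta>. c \<beta> + d \<beta>"]) (simp add: sum.distrib algebra_simps)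
next
  fix a and u :: "real ^ 'n \<Rightarrow> real" assume "u \<in> polynomials k"
  then obtain c where "\<And>x. u x = (\<Sum>\<beta> | sum \<beta> UNIV \<le> k. c \<beta> * monomial \<beta> x)" by (auto simp: polynomials_def)
  then show "(\<lambda>x. a *\<^sub>R u x) \<in> polynomials k"
    unfolding polynomials_def
    by (intro CollectI exI[of _ "\<lambda>\<beta>. a * c \<beta>"]) (simp add: sum_distrib_left mult.assoc)
qed

lemma subspace_homogeneous_polynomials: "fn.subspace (homogeneous_polynomials k)"
proof (rule fn_subspaceI)
  show "(\<lambda>_. 0) \<in> homogeneous_polynomials k" by (auto simp: homogeneous_polynomials_def intro!: exI[of _ "\<lambda>_. 0"])
next
  fix u v :: "real ^ 'n \<Rightarrow> real" assume "u \<in> homogeneous_polynomials k" "v \<in> homogeneous_polynomials k"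
  then obtain c d where "\<And>x. u x = (\<Sum>\<beta> | sum \<beta> UNIV = k. c \<beta> * monomial \<beta> x)"
    "\<And>x. v x = (\<Sum>\<beta> | sum \<beta> UNIV = k. d \<beta> * monomial \<beta> x)" by (auto simp: homogeneous_polynomials_def)
  then show "(\<lambda>x. u x + v x) \<in> homogeneous_polynomials k"
    unfolding homogeneous_polynomials_def
    by (intro CollectI exI[of _ "\<lambda>\<beta>. c \<beta> + d \<beta>"]) (simp add: sum.distrib algebra_simps)
next
  fix a and u :: "real ^ 'n \<Rightarrow> real" assume "u \<in> homogeneous_polynomials k"
  then obtain c where "\<And>x. u x = (\<Sum>\<beta> | sum \<beta> UNIV = k. c \<beta> * monomial \<beta> x)" by (auto simp: homogeneous_polynomials_def)
  then show "(\<lambda>x. a *\<^sub>R u x) \<in> homogeneous_polynomials k"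
    unfolding homogeneous_polynomials_def
    by (intro CollectI exI[of _ "\<lambda>\<beta>. a * c \<beta>"]) (simp add: sum_distrib_left mult.assoc)
qed

lemma polynomials_continuous: "p \<in> polynomials k \<Longrightarrow> continuous_on UNIV p"
proof -
  assume "p \<in> polynomials k"
  then obtain c where c: "p = (\<lambda>x. \<Sum>\<beta> | sum \<beta> UNIV \<le> k. c \<beta> * monomial \<beta> x)" by (auto simp: polynomials_def)
  have "continuous_on UNIV (monomial \<beta>)" for \<beta> :: "'a \<Rightarrow> nat"
    using C1_function_monomial C1_function_continuous by blast
  then show ?thesis unfolding c by (intro continuous_intros)
qed

lemma subspace_RT_local: "fn.subspace (RT_local k)"
proof (rule fn_subspaceI)
  note sp = subspace_polynomials and sh = subspace_homogeneous_polynomials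
  show "(\<lambda>_. 0) \<in> RT_local k"
    using fn_subspaceD(1)[OF sp] fn_subspaceD(1)[OF sh] unfolding RT_local_def
    by (intro CollectI exI[of _ "\<lambda>_. 0"]) auto
  fix u v :: "real ^ 'n \<Rightarrow> real ^ 'n" and c assume u: "u \<in> RT_local k"
  then obtain p q where pq: "\<And>i. (\<lambda>x. p x $ i) \<in> polynomials k" "q \<in> homogeneous_polynomials k"
    "\<And>x. u x = p x + q x *\<^sub>R x" by (auto simp: RT_local_def)
  show "(\<lambda>x. c *\<^sub>R u x) \<in> RT_local k"
    unfolding RT_local_def using fn_subspaceD(3)[OF sp pq(1), of c] fn_subspaceD(3)[OF sh pq(2), of c] pq(3)
    by (intro CollectI exI[of _ "\<lambda>x. c *\<^sub>R p x"] exI[of _ "\<lambda>x. c *\<^sub>R q x"]) (auto simp: scaleR_add_right)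
  assume "v \<in> RT_local k"
  then obtain p' q' where pq': "\<And>i. (\<lambda>x. p' x $ i) \<in> polynomials k" "q' \<in> homogeneous_polynomials k"
    "\<And>x. v x = p' x + q' x *\<^sub>R x" by (auto simp: RT_local_def)
  show "(\<lambda>x. u x + v x) \<in> RT_local k"
    unfolding RT_local_def using fn_subspaceD(2)[OF sp pq(1) pq'(1)] fn_subspaceD(2)[OF sh pq(2) pq'(2)] pq(3) pq'(3)
    by (intro CollectI exI[of _ "\<lambda>x. p x + p' x"] exI[of _ "\<lambda>x. q x + q' x"]) (auto simp: algebra_simps)
qed

text \<open>What matters is that the set is finite and spans. The second family admits all degrees
  up to \<open>k\<close>, so one finiteness statement about multi-indices covers both
  families.\<close>

definition RT_generators :: "nat \<Rightarrow> (real ^ 'n \<Rightarrow> real ^ 'n) set" where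
  "RT_generators k =
     (\<lambda>(\<beta>, i) x. monomial \<beta> x *\<^sub>R axis i 1) ` ({\<beta>. sum \<beta> UNIV \<le> k} \<times> UNIV) \<union>
     (\<lambda>\<beta> x. monomial \<beta> x *\<^sub>R x) ` {\<beta>. sum \<beta> UNIV \<le> k}"

lemma finite_RT_generators: "finite (RT_generators k)"
  unfolding RT_generators_def using finite_multiindices by auto

lemma RT_local_subset_span: "RT_local k \<subseteq> fn.span (RT_generators k)"
proof
  fix v :: "real ^ 'n \<Rightarrow> real ^ 'n" assume "v \<in> RT_local k"
  then obtain p q where pq: "\<And>i. (\<lambda>x. p x $ i) \<in> polynomials k" "q \<in> homogeneous_polynomials k"
    "\<And>x. v x = p x + q x *\<^sub>R x" by (auto simp: RT_local_def)
  define B where "B = {\<beta> :: 'n \<Rightarrow> nat. sum \<beta> UNIV \<le> k}"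
  have "\<exists>c. \<forall>x. p x $ i = (\<Sum>\<beta>\<in>B. c \<beta> * monomial \<beta> x)" for i
    using pq(1)[of i] by (simp add: polynomials_def B_def)
  then obtain c where c: "\<And>i x. p x $ i = (\<Sum>\<beta>\<in>B. c i \<beta> * monomial \<beta> x)" by metis
  obtain d where d: "\<And>x. q x = (\<Sum>\<beta> | sum \<beta> UNIV = k. d \<beta> * monomial \<beta> x)"
    using pq(2) by (auto simp: homogeneous_polynomials_def)
  have "v = (\<Sum>i\<in>UNIV. \<Sum>\<beta>\<in>B. (\<lambda>x. c i \<beta> *\<^sub>R (monomial \<beta> x *\<^sub>R axis i 1)))
      + (\<Sum>\<beta> | sum \<beta> UNIV = k. (\<lambda>x. d \<beta> *\<^sub>R (monomial \<beta> x *\<^sub>R x)))"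
  proof
    fix x
    have "p x = (\<Sum>i\<in>UNIV. p x $ i *\<^sub>R axis i 1)"
      using basis_expansion[of "p x"] by (simp add: scalar_mult_eq_scaleR)
    then show "v x = ((\<Sum>i\<in>UNIV. \<Sum>\<beta>\<in>B. (\<lambda>x. c i \<beta> *\<^sub>R (monomial \<beta> x *\<^sub>R axis i 1)))
      + (\<Sum>\<beta> | sum \<beta> UNIV = k. (\<lambda>x. d \<beta> *\<^sub>R (monomial \<beta> x *\<^sub>R x)))) x"
      by (simp add: pq(3) c d sum_fun_apply scaleR_sum_left)
  qed
  also have "\<dots> \<in> fn.span (RT_generators k)"
  proof (intro fn.span_add fn.span_sum fn.span_scale fn.span_base)
    show "(\<lambda>x. monomial \<beta> x *\<^sub>R axis i 1) \<in> RT_generators k" if "\<beta> \<in> B" for \<beta> and i :: 'n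
      using that by (auto simp: RT_generators_def B_def)
    show "(\<lambda>x. monomial \<beta> x *\<^sub>R x) \<in> RT_generators k" if "\<beta> \<in> {\<beta>. sum \<beta> UNIV = k}" for \<beta> :: "'n \<Rightarrow> nat"
      using that by (auto simp: RT_generators_def)
  qed
  finally show "v \<in> fn.span (RT_generators k)" .
qed

text \<open>C1 maps form a subspace, so the generators suffice; each is a monomial times a constant
  vector or the identity.\<close>

lemma RT_local_C1: "RT_local k \<subseteq> C1_maps"
proof -
  have "(\<lambda>x. a) \<in> C1_maps" for a :: "real ^ 'n"
    by (auto simp: C1_maps_def intro!: exI[of _ "\<lambda>_ _. 0"])
  moreover have "(\<lambda>x. x) \<in> (C1_maps :: (real ^ 'n \<Rightarrow> real ^ 'n) set)"
    by (auto simp: C1_maps_def intro!: exI[of _ "\<lambda>_ h. h"])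
  ultimately have "RT_generators k \<subseteq> (C1_maps :: (real ^ 'n \<Rightarrow> real ^ 'n) set)"
    using C1_function_scaleR_C1_map C1_function_monomial unfolding RT_generators_def by fast
  then show ?thesis
    using RT_local_subset_span fn.span_minimal[OF _ subspace_C1_maps] by blast
qed

lemma subspace_piecewise:
  assumes "fn.subspace P"
  shows "fn.subspace (piecewise T P)"
proof (rule fn_subspaceI)
  note P = fn_subspaceD[OF assms]
  show "(\<lambda>_. 0) \<in> piecewise T P" using P(1) by (auto simp: piecewise_def)
  fix u v :: "real ^ 'a \<Rightarrow> 'b" and c assume u: "u \<in> piecewise T P"
  show "(\<lambda>x. c *\<^sub>R u x) \<in> piecewise T P"
    unfolding piecewise_def
  proof (intro CollectI conjI ballI allI impI)
    fix K assume "K \<in> T"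
    then obtain p where "p \<in> P" "\<forall>x\<in>interior K. u x = p x" using u by (auto simp: piecewise_def)
    then show "\<exists>p\<in>P. \<forall>x\<in>interior K. c *\<^sub>R u x = p x" using P(3) by (intro bexI[of _ "\<lambda>x. c *\<^sub>R p x"]) auto
  qed (use u in \<open>auto simp: piecewise_def\<close>)
  assume v: "v \<in> piecewise T P"
  show "(\<lambda>x. u x + v x) \<in> piecewise T P"
    unfolding piecewise_def
  proof (intro CollectI conjI ballI allI impI)
    fix K assume "K \<in> T"
    then obtain p q where "p \<in> P" "\<forall>x\<in>interior K. u x = p x" "q \<in> P" "\<forall>x\<in>interior K. v x = q x"
      using u v unfolding piecewise_def by blast
    then show "\<exists>p\<in>P. \<forall>x\<in>interior K. u x + v x = p x" using P(2) by (intro bexI[of _ "\<lambda>x. p x + q x"]) auto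
  qed (use u v in \<open>auto simp: piecewise_def\<close>)
qed

lemma piecewise_mono: "P \<subseteq> P' \<Longrightarrow> piecewise T P \<subseteq> piecewise T P'"
  unfolding piecewise_def by blast

text \<open>The set \<open>Z\<close> in the induction collects the elements already treated, so that the interiors of
  the elements need not be disjoint.\<close>

lemma piecewise_finite_dimensional:
  fixes T :: "(real ^ 'n) set set" and P :: "(real ^ 'n \<Rightarrow> 'b::real_vector) set"
  assumes "finite T" and G0: "finite G0" "P \<subseteq> fn.span G0"
  shows "\<exists>G. finite G \<and> piecewise T P \<subseteq> fn.span G"
proof -
  have "\<exists>G. finite G \<and> (\<forall>v. (\<forall>K\<in>T. \<exists>p\<in>P. \<forall>x\<in>interior K - Z. v x = p x) \<and>
      (\<forall>x. x \<notin> (\<Union>K\<in>T. interior K - Z) \<longrightarrow> v x = 0) \<longrightarrow> v \<in> fn.span G)" for Z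
    using assms(1)
  proof (induction T arbitrary: Z)
    case empty
    have "v = 0" if "\<forall>x. v x = 0" for v :: "real ^ 'n \<Rightarrow> 'b" using that by (auto simp: fun_eq_iff)
    then show ?case by (intro exI[of _ "{}"]) auto
  next
    case (insert K T)
    obtain G1 where G1: "finite G1" "\<And>v. (\<forall>L\<in>T. \<exists>p\<in>P. \<forall>x\<in>interior L - (Z \<union> interior K). v x = p x) \<Longrightarrow>
      (\<forall>x. x \<notin> (\<Union>L\<in>T. interior L - (Z \<union> interior K)) \<longrightarrow> v x = 0) \<Longrightarrow> v \<in> fn.span G1"
      using insert.IH[of "Z \<union> interior K"] by blast
    define A where "A = interior K - Z"
    \<comment> \<open>Restriction to the part of \<open>K\<close> not yet treated is linear, so it
      maps the span of \<open>G0\<close> into the span of finitely many restricted generators. The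
      rest of \<open>v\<close> lives on the other elements and is left to the induction
      hypothesis.\<close>
    define res where "res f x = indicator A x *\<^sub>R f x" for f :: "real ^ 'n \<Rightarrow> 'b" and x
    have res_span: "res p \<in> fn.span (res ` G0)" if "p \<in> fn.span G0" for p
      using that
    proof (induction rule: fn.span_induct_alt)
      case base
      have "res 0 = 0" by (simp add: res_def fun_eq_iff)
      then show ?case using fn.span_zero by metis
    next
      case (step c g f)
      have eq: "res ((\<lambda>x. c *\<^sub>R g x) + f) = (\<lambda>x. c *\<^sub>R res g x) + res f"
        by (auto simp: res_def fun_eq_iff scaleR_add_right)
      show ?case unfolding eq using step by (intro fn.span_add fn.span_scale[OF fn.span_base]) auto
    qed
    show ?case
    proof (intro exI[of _ "res ` G0 \<union> G1"] conjI allI impI)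
      show "finite (res ` G0 \<union> G1)" using G0 G1 by simp
      fix v assume v: "(\<forall>L\<in>insert K T. \<exists>p\<in>P. \<forall>x\<in>interior L - Z. v x = p x) \<and>
        (\<forall>x. x \<notin> (\<Union>L\<in>insert K T. interior L - Z) \<longrightarrow> v x = 0)"
      then obtain p where p: "p \<in> P" "\<forall>x\<in>interior K - Z. v x = p x" by blast
      define w where "w x = (if x \<in> A then 0 else v x)" for x
      have "v = res p + w" using p(2) by (auto simp: res_def w_def A_def fun_eq_iff)
      moreover have "w \<in> fn.span G1"
      proof (rule G1(2))
        show "\<forall>L\<in>T. \<exists>p\<in>P. \<forall>x\<in>interior L - (Z \<union> interior K). w x = p x"
        proof
          fix L assume "L \<in> T"
          then obtain q where "q \<in> P" "\<forall>x\<in>interior L - Z. v x = q x" using v by blast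
          then show "\<exists>p\<in>P. \<forall>x\<in>interior L - (Z \<union> interior K). w x = p x"
            by (intro bexI[of _ q]) (auto simp: w_def A_def)
        qed
        show "\<forall>x. x \<notin> (\<Union>L\<in>T. interior L - (Z \<union> interior K)) \<longrightarrow> w x = 0"
          using v by (auto simp: w_def A_def)
      qed
      ultimately show "v \<in> fn.span (res ` G0 \<union> G1)"
        using res_span[of p] p(1) G0(2) fn.span_mono[of "res ` G0" "res ` G0 \<union> G1"] fn.span_mono[of G1 "res ` G0 \<union> G1"]
        by (auto intro!: fn.span_add)
    qed
  qed
  from this[of "{}"] show ?thesis unfolding piecewise_def by auto
qed

section \<open>Meshes and the velocity space\<close>

text \<open>The features of a mesh behind measurability, norms and dimension. That the elements are
  simplices enters separately, where facets are shifted into elements.\<close>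

locale polytopal_mesh =
  fixes \<Omega> :: "(real ^ 'n) set" and T :: "(real ^ 'n) set set"
  assumes domain: "open \<Omega>" "bounded \<Omega>"
    and finite_mesh: "finite T" and covers: "\<Union>T = closure \<Omega>"
    and element: "\<And>K. K \<in> T \<Longrightarrow> convex K" "\<And>K. K \<in> T \<Longrightarrow> compact K" "\<And>K. K \<in> T \<Longrightarrow> interior K \<noteq> {}"
begin

abbreviation "pw_continuous \<equiv> piecewise T {p. continuous_on UNIV p}"

lemma finite_measure_domain: "finite_measure (lebesgue_on \<Omega>)"
  using domain by (intro finite_measure_lebesgue_on lmeasurable_open)

lemma pw_continuous_measurable:
  fixes f :: "real ^ 'n \<Rightarrow> 'b::real_normed_vector"
  assumes "f \<in> pw_continuous"
  shows "f \<in> borel_measurable borel"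
proof (rule measurable_piecewise_restrict)
  define I where "I = (\<Union>K\<in>T. interior K)"
  show "countable (insert (- I) (interior ` T))" using finite_mesh by (auto intro: countable_finite)
  have "open I" unfolding I_def by auto
  then show "X \<inter> space borel \<in> sets borel" if "X \<in> insert (- I) (interior ` T)" for X
    using that by auto
  show "space borel \<subseteq> \<Union>(insert (- I) (interior ` T))" by (auto simp: I_def)
  show "f \<in> borel_measurable (restrict_space borel X)" if "X \<in> insert (- I) (interior ` T)" for X
  proof (cases "X = - I")
    case True
    then have "f x = 0" if "x \<in> space (restrict_space borel X)" for x
      using assms that by (auto simp: piecewise_def I_def space_restrict_space)
    then show ?thesis by (subst measurable_cong[of _ _ "\<lambda>_. 0"]) auto
  next
    case False
    then obtain K where K: "K \<in> T" "X = interior K" using \<open>X \<in> insert (- I) (interior ` T)\<close> by blast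
    then obtain p where p: "continuous_on UNIV p" "\<And>x. x \<in> X \<Longrightarrow> f x = p x"
      using assms by (auto simp: piecewise_def)
    have "p \<in> borel_measurable (restrict_space borel X)"
      using p(1) by (intro measurable_restrict_space1 borel_measurable_continuous_onI)
    moreover have "f \<in> borel_measurable (restrict_space borel X) \<longleftrightarrow> p \<in> borel_measurable (restrict_space borel X)"
      using p(2) by (intro measurable_cong) (auto simp: space_restrict_space)
    ultimately show ?thesis by simp
  qed
qed

lemma pw_continuous_lebesgue_measurable [measurable]:
  fixes f :: "real ^ 'n \<Rightarrow> 'b::real_normed_vector"
  assumes "f \<in> pw_continuous"
  shows "f \<in> borel_measurable (lebesgue_on \<Omega>)"
  using pw_continuous_measurable[OF assms]
  by (intro measurable_restrict_space1 measurable_completion) simp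

lemma pw_continuous_bounded:
  fixes f :: "real ^ 'n \<Rightarrow> 'b::real_normed_vector"
  assumes "f \<in> pw_continuous"
  obtains B where "\<And>x. norm (f x) \<le> B"
proof -
  have "\<exists>B. \<forall>x\<in>interior K. norm (f x) \<le> B" if K: "K \<in> T" for K
  proof -
    obtain p where p: "continuous_on UNIV p" "\<And>x. x \<in> interior K \<Longrightarrow> f x = p x"
      using assms K by (auto simp: piecewise_def)
    have "bounded (p ` K)"
      by (intro compact_imp_bounded compact_continuous_image element K continuous_on_subset[OF p(1)]) simp
    then show ?thesis using p(2) interior_subset[of K] by (fastforce simp: bounded_iff)
  qed
  then obtain b where b: "\<And>K x. K \<in> T \<Longrightarrow> x \<in> interior K \<Longrightarrow> norm (f x) \<le> b K" by metis
  have "norm (f x) \<le> (\<Sum>K\<in>T. \<bar>b K\<bar>)" for x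
  proof (cases "\<exists>K\<in>T. x \<in> interior K")
    case True
    then obtain K where K: "K \<in> T" "x \<in> interior K" by blast
    have "norm (f x) \<le> \<bar>b K\<bar>" using b[OF K] by simp
    also have "\<dots> \<le> (\<Sum>K\<in>T. \<bar>b K\<bar>)" using K finite_mesh by (intro member_le_sum) auto
    finally show ?thesis .
  next
    case False
    then have "f x = 0" using assms by (auto simp: piecewise_def)
    then show ?thesis by (simp add: sum_nonneg)
  qed
  then show ?thesis using that by blast
qed

lemma pw_continuous_Lp:
  fixes f :: "real ^ 'n \<Rightarrow> 'b::{real_normed_vector, second_countable_topology}"
  assumes "f \<in> pw_continuous" "r \<ge> 0"
  shows "Lp (lebesgue_on \<Omega>) r f"
proof -
  obtain B where "\<And>x. norm (f x) \<le> B" using pw_continuous_bounded[OF assms(1)] by blast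
  then show ?thesis
    using assms by (intro Lp_bounded[OF finite_measure_domain, where B=B] pw_continuous_lebesgue_measurable)
qed

text \<open>A nonzero value inside an element persists on an open set. That set meets
  \<open>\<Omega>\<close>, because elements lie in its closure, and so has positive measure. Off the
  open elements the chosen representative is 0, which gives equality of functions and hence
  definiteness of the norm.\<close>

lemma pw_continuous_AE_0_imp_0:
  fixes f :: "real ^ 'n \<Rightarrow> 'b::real_normed_vector"
  assumes f: "f \<in> pw_continuous" and ae: "AE x in lebesgue_on \<Omega>. f x = 0"
  shows "f = 0"
proof -
  have "f x = 0" if K: "K \<in> T" and x: "x \<in> interior K" for K x
  proof (rule ccontr)
    assume "f x \<noteq> 0"
    obtain p where p: "continuous_on UNIV p" "\<And>x. x \<in> interior K \<Longrightarrow> f x = p x"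
      using f K by (auto simp: piecewise_def)
    define O' where "O' = interior K \<inter> p -` (- {0})"
    have "open O'" unfolding O'_def using p(1)
      by (intro open_Int open_interior open_vimage) auto
    moreover have "x \<in> O'" using x \<open>f x \<noteq> 0\<close> p(2) by (auto simp: O'_def)
    moreover have "x \<in> closure \<Omega>" using K x covers interior_subset by blast
    ultimately have "O' \<inter> \<Omega> \<noteq> {}" by (auto simp: closure_iff_nhds_not_empty)
    moreover have "open (O' \<inter> \<Omega>)" using \<open>open O'\<close> domain by auto
    moreover have "negligible (O' \<inter> \<Omega>)"
    proof -
      have "AE x in lebesgue. x \<in> \<Omega> \<longrightarrow> f x = 0"
        using ae domain by (subst (asm) AE_restrict_space_iff) auto
      then have "AE x in lebesgue. x \<notin> O' \<inter> \<Omega>"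
        by eventually_elim (auto simp: O'_def p(2))
      then show ?thesis using \<open>open (O' \<inter> \<Omega>)\<close>
        unfolding negligible_iff_null_sets by (subst AE_iff_null_sets) auto
    qed
    ultimately show False using open_not_negligible by blast
  qed
  moreover have "f x = 0" if "x \<notin> (\<Union>K\<in>T. interior K)" for x using f that by (auto simp: piecewise_def)
  ultimately show ?thesis by (fastforce simp: fun_eq_iff)
qed

lemma pw_C1_continuous: "piecewise T C1_maps \<subseteq> pw_continuous"
  using C1_maps_continuous by (intro piecewise_mono) auto

lemma pw_C1_has_derivative:
  fixes v :: "real ^ 'n \<Rightarrow> 'b::real_normed_vector"
  assumes "v \<in> piecewise T C1_maps" "K \<in> T"
  obtains D where "\<And>x. x \<in> interior K \<Longrightarrow> (v has_derivative D x) (at x)" "\<And>h. continuous_on UNIV (\<lambda>x. D x h)"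
proof -
  obtain p where p: "p \<in> C1_maps" "\<And>x. x \<in> interior K \<Longrightarrow> v x = p x"
    using assms by (auto simp: piecewise_def)
  then obtain D where D: "\<And>x. (p has_derivative D x) (at x)" "\<And>h. continuous_on UNIV (\<lambda>x. D x h)"
    by (auto simp: C1_maps_def)
  have "(v has_derivative D x) (at x)" if "x \<in> interior K" for x
    using has_derivative_transform_within_open[OF D(1) open_interior that] p(2) by simp
  then show ?thesis using that D(2) by blast
qed

section \<open>Elementwise divergence and div-conformity\<close>

lemma divergence_pw_continuous:
  assumes "v \<in> piecewise T C1_maps"
  shows "divergence T v \<in> pw_continuous"
  unfolding piecewise_def
proof (intro CollectI conjI ballI allI impI)
  fix K assume K: "K \<in> T"
  obtain D where D: "\<And>x. x \<in> interior K \<Longrightarrow> (v has_derivative D x) (at x)" "\<And>h. continuous_on UNIV (\<lambda>x. D x h)"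
    using pw_C1_has_derivative[OF assms K] by blast
  show "\<exists>p\<in>{p. continuous_on UNIV p}. \<forall>x\<in>interior K. divergence T v x = p x"
  proof (intro bexI[of _ "\<lambda>x. \<Sum>i\<in>UNIV. D x (axis i 1) $ i"] ballI CollectI)
    show "continuous_on UNIV (\<lambda>x. \<Sum>i\<in>UNIV. D x (axis i 1) $ i)" by (intro continuous_intros D(2))
    show "divergence T v x = (\<Sum>i\<in>UNIV. D x (axis i 1) $ i)" if "x \<in> interior K" for x
      using that K frechet_derivative_at[OF D(1)[OF that]] by (auto simp: divergence_def)
  qed
qed (simp add: divergence_def)

lemma divergence_add:
  assumes "u \<in> piecewise T C1_maps" "v \<in> piecewise T C1_maps"
  shows "divergence T (\<lambda>x. u x + v x) = (\<lambda>x. divergence T u x + divergence T v x)"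
proof
  fix x
  show "divergence T (\<lambda>x. u x + v x) x = divergence T u x + divergence T v x"
  proof (cases "x \<in> (\<Union>K\<in>T. interior K)")
    case True
    then obtain K where K: "K \<in> T" "x \<in> interior K" by blast
    obtain D E where D: "(u has_derivative D) (at x)" and E: "(v has_derivative E) (at x)"
      using pw_C1_has_derivative[OF assms(1) K(1)] pw_C1_has_derivative[OF assms(2) K(1)] K(2) by metis
    show ?thesis
      using True unfolding divergence_def frechet_derivative_at[OF has_derivative_add[OF D E], symmetric]
        frechet_derivative_at[OF D, symmetric] frechet_derivative_at[OF E, symmetric]
      by (simp add: sum.distrib)
  qed (simp add: divergence_def)
qed

lemma divergence_scaleR:
  assumes "u \<in> piecewise T C1_maps"
  shows "divergence T (\<lambda>x. c *\<^sub>R u x) = (\<lambda>x. c *\<^sub>R divergence T u x)"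
proof
  fix x
  show "divergence T (\<lambda>x. c *\<^sub>R u x) x = c *\<^sub>R divergence T u x"
  proof (cases "x \<in> (\<Union>K\<in>T. interior K)")
    case True
    then obtain K where K: "K \<in> T" "x \<in> interior K" by blast
    obtain D where D: "(u has_derivative D) (at x)"
      using pw_C1_has_derivative[OF assms(1) K(1)] K(2) by metis
    show ?thesis
      using True unfolding divergence_def frechet_derivative_at[OF D, symmetric]
        frechet_derivative_at[OF has_derivative_scaleR_right[OF D, of c], symmetric]
      by (simp add: sum_distrib_left)
  qed (simp add: divergence_def)
qed

lemma integrable_domain_bounded:
  fixes f :: "real ^ 'n \<Rightarrow> real"
  assumes "f \<in> borel_measurable (lebesgue_on \<Omega>)" "\<And>x. x \<in> \<Omega> \<Longrightarrow> \<bar>f x\<bar> \<le> B"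
  shows "integrable (lebesgue_on \<Omega>) f"
  using assms
  by (intro finite_measure.integrable_const_bound[OF finite_measure_domain, of _ B] AE_I2)
    (auto simp: space_restrict_space)

lemma continuous_bounded_on_domain:
  fixes g :: "real ^ 'n \<Rightarrow> 'b::real_normed_vector"
  assumes "continuous_on UNIV g"
  obtains B where "\<And>x. x \<in> \<Omega> \<Longrightarrow> norm (g x) \<le> B"
proof -
  have "bounded (g ` closure \<Omega>)"
    using domain by (intro compact_imp_bounded compact_continuous_image continuous_on_subset[OF assms]) auto
  then show ?thesis using that closure_subset[of \<Omega>] by (fastforce simp: bounded_iff)
qed

text \<open>Bochner integrals of sums split only for integrable summands. Bounded functions on a
  domain of finite measure supply this, and the weak divergence becomes additive.\<close>

lemma weak_divergence_integrable:
  assumes v: "v \<in> pw_continuous" and g: "g \<in> pw_continuous" and t: "test_function \<Omega> \<phi> d\<phi>"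
  shows "integrable (lebesgue_on \<Omega>) (\<lambda>x. v x \<bullet> d\<phi> x)" "integrable (lebesgue_on \<Omega>) (\<lambda>x. \<phi> x * g x)"
proof -
  have c: "continuous_on UNIV \<phi>" "continuous_on UNIV d\<phi>"
    using t C1_function_continuous by (auto simp: test_function_def C1_function_def)
  have m [measurable]: "\<phi> \<in> borel_measurable (lebesgue_on \<Omega>)" "d\<phi> \<in> borel_measurable (lebesgue_on \<Omega>)"
      "v \<in> borel_measurable (lebesgue_on \<Omega>)" "g \<in> borel_measurable (lebesgue_on \<Omega>)"
    using c v g by (auto intro: borel_measurable_lebesgue_on_continuous pw_continuous_lebesgue_measurable)
  obtain Bv where Bv: "\<And>x. norm (v x) \<le> Bv" using pw_continuous_bounded[OF v] by blast
  obtain Bg where Bg: "\<And>x. norm (g x) \<le> Bg" using pw_continuous_bounded[OF g] by blast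
  obtain B1 where B1: "\<And>x. x \<in> \<Omega> \<Longrightarrow> norm (\<phi> x) \<le> B1" using continuous_bounded_on_domain[OF c(1)] by blast
  obtain B2 where B2: "\<And>x. x \<in> \<Omega> \<Longrightarrow> norm (d\<phi> x) \<le> B2" using continuous_bounded_on_domain[OF c(2)] by blast
  show "integrable (lebesgue_on \<Omega>) (\<lambda>x. v x \<bullet> d\<phi> x)"
  proof (rule integrable_domain_bounded)
    show "\<bar>v x \<bullet> d\<phi> x\<bar> \<le> Bv * B2" if "x \<in> \<Omega>" for x
      using Cauchy_Schwarz_ineq2[of "v x" "d\<phi> x"] mult_mono[OF Bv[of x] B2[OF that]] order_trans[OF norm_ge_zero Bv]
      by (meson norm_ge_zero order_trans)
  qed measurable
  show "integrable (lebesgue_on \<Omega>) (\<lambda>x. \<phi> x * g x)"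
  proof (rule integrable_domain_bounded)
    show "\<bar>\<phi> x * g x\<bar> \<le> B1 * Bg" if "x \<in> \<Omega>" for x
      using mult_mono[OF B1[OF that] Bg[of x]] order_trans[OF norm_ge_zero B1[OF that]] by (simp add: abs_mult)
  qed measurable
qed

lemma RT_local_pw_C1: "piecewise T (RT_local k) \<subseteq> piecewise T C1_maps"
  by (intro piecewise_mono RT_local_C1)

lemma subspace_RT: "fn.subspace (RT k \<Omega> T)"
proof (rule fn_subspaceI)
  have "fn.subspace (piecewise T (RT_local k))" by (intro subspace_piecewise subspace_RT_local)
  note sub = fn_subspaceD[OF this]
  have "(\<lambda>_. 0 :: real ^ 'n) \<in> piecewise T C1_maps"
    by (rule fn_subspaceD(1)[OF subspace_piecewise[OF subspace_C1_maps]])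
  from divergence_scaleR[OF this, of 0] have "divergence T (\<lambda>_. 0) = (\<lambda>_. 0)" by simp
  then show "(\<lambda>_. 0) \<in> RT k \<Omega> T" using sub(1) by (simp add: RT_def has_weak_divergence_def)
next
  have "fn.subspace (piecewise T (RT_local k))" by (intro subspace_piecewise subspace_RT_local)
  note sub = fn_subspaceD[OF this]
  fix u v assume uv: "u \<in> RT k \<Omega> T" "v \<in> RT k \<Omega> T"
  then have uv': "u \<in> piecewise T C1_maps" "v \<in> piecewise T C1_maps" using RT_local_pw_C1 by (auto simp: RT_def)
  have "has_weak_divergence \<Omega> (\<lambda>x. u x + v x) (divergence T (\<lambda>x. u x + v x))"
    unfolding has_weak_divergence_def
  proof (intro allI impI)
    fix \<phi> d\<phi> assume t: "test_function \<Omega> \<phi> d\<phi>"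
    note int = weak_divergence_integrable[OF subsetD[OF pw_C1_continuous] divergence_pw_continuous t]
    show "(LINT x|lebesgue_on \<Omega>. (u x + v x) \<bullet> d\<phi> x) = - (LINT x|lebesgue_on \<Omega>. \<phi> x * divergence T (\<lambda>x. u x + v x) x)"
      using uv t int[OF uv'(1) uv'(1)] int[OF uv'(2) uv'(2)] unfolding divergence_add[OF uv']
      by (simp add: inner_add_left distrib_left RT_def has_weak_divergence_def)
  qed
  then show "(\<lambda>x. u x + v x) \<in> RT k \<Omega> T" using uv sub(2) by (simp add: RT_def)
next
  have "fn.subspace (piecewise T (RT_local k))" by (intro subspace_piecewise subspace_RT_local)
  note sub = fn_subspaceD[OF this]
  fix c u assume u: "u \<in> RT k \<Omega> T"
  then have u': "u \<in> piecewise T C1_maps" using RT_local_pw_C1 by (auto simp: RT_def)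
  have "has_weak_divergence \<Omega> (\<lambda>x. c *\<^sub>R u x) (divergence T (\<lambda>x. c *\<^sub>R u x))"
    using u unfolding divergence_scaleR[OF u']
    by (simp add: RT_def has_weak_divergence_def mult.left_commute[of _ c])
  then show "(\<lambda>x. c *\<^sub>R u x) \<in> RT k \<Omega> T" using u sub(3) by (simp add: RT_def)
qed

text \<open>\<open>normal_trace\<close> is a \<open>Lim\<close>, which respects sums and multiples
  only where limits exist. The piece on an element is continuous on the whole space, so the limit
  from inside exists up to the boundary.\<close>

lemma pw_tendsto_on_facet:
  fixes v :: "real ^ 'n \<Rightarrow> 'b::real_normed_vector"
  assumes v: "v \<in> pw_continuous" and K: "K \<in> T" and x: "x \<in> K"
  obtains l where "(v \<longlongrightarrow> l) (at x within interior K)"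
proof -
  obtain p where p: "continuous_on UNIV p" "\<And>x. x \<in> interior K \<Longrightarrow> v x = p x"
    using v K by (auto simp: piecewise_def)
  have "(p \<longlongrightarrow> p x) (at x within interior K)"
    using p(1) by (meson UNIV_I continuous_on_def subset_UNIV tendsto_within_subset)
  moreover have "\<forall>\<^sub>F y in at x within interior K. p y = v y"
    using p(2) by (auto simp: eventually_at_filter)
  ultimately have "(v \<longlongrightarrow> p x) (at x within interior K)" by (rule Lim_transform_eventually)
  then show ?thesis using that by blast
qed

text \<open>\<open>Lim\<close> is determined only along a nontrivial filter. A convex set with
  nonempty interior lies in the closure of that interior, and points of the open interior are limit
  points of it too.\<close>

lemma at_within_element_nontrivial:
  assumes K: "K \<in> T" and x: "x \<in> K"
  shows "at x within interior K \<noteq> bot"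
proof -
  have "x \<in> closure (interior K)"
    using x convex_closure_interior[OF element(1)[OF K] element(3)[OF K]] closure_subset[of K] by auto
  then have "x islimpt interior K"
    using interior_limit_point[of x "interior K"] by (auto simp: closure_def)
  then show ?thesis using trivial_limit_within by blast
qed

lemma normal_trace_add:
  assumes "u \<in> pw_continuous" "v \<in> pw_continuous" "K \<in> T" "x \<in> K"
  shows "normal_trace K F (\<lambda>x. u x + v x) x = normal_trace K F u x + normal_trace K F v x"
proof -
  obtain l m where "(u \<longlongrightarrow> l) (at x within interior K)" "(v \<longlongrightarrow> m) (at x within interior K)"
    using pw_tendsto_on_facet assms by metis
  then show ?thesis
    using tendsto_add[of u l "at x within interior K" v m] at_within_element_nontrivial[OF assms(3,4)]
    unfolding normal_trace_def by (simp add: tendsto_Lim inner_add_left)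
qed

lemma normal_trace_scaleR:
  assumes "u \<in> pw_continuous" "K \<in> T" "x \<in> K"
  shows "normal_trace K F (\<lambda>x. c *\<^sub>R u x) x = c * normal_trace K F u x"
proof -
  obtain l where "(u \<longlongrightarrow> l) (at x within interior K)"
    using pw_tendsto_on_facet assms by metis
  then show ?thesis
    using tendsto_scaleR[OF tendsto_const, of u l "at x within interior K" c] at_within_element_nontrivial[OF assms(2,3)]
    unfolding normal_trace_def by (simp add: tendsto_Lim)
qed

section \<open>The velocity space as a finite-dimensional normed space\<close>

lemma RT0_pw_C1: "v \<in> RT0 k \<Omega> \<Gamma> T \<Longrightarrow> v \<in> piecewise T C1_maps"
  using RT_local_pw_C1 by (auto simp: RT0_def RT_def)

lemma AE_surface_measure_in:
  assumes "K \<in> T" "F facet_of K"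
  shows "AE x in surface_measure F. x \<in> K"
proof -
  have "F \<subseteq> K" using assms(2) by (rule facet_of_imp_subset)
  then have "x \<in> K" if "x \<in> space (surface_measure F)" for x
    using that by (auto simp: surface_measure_def space_restrict_space)
  then show ?thesis by (rule AE_I2)
qed

lemma subspace_RT0: "fn.subspace (RT0 k \<Omega> \<Gamma> T)"
proof (rule fn_subspaceI)
  note sub = fn_subspaceD[OF subspace_RT]
  have "(\<lambda>_. 0) \<in> (pw_continuous :: (real ^ 'n \<Rightarrow> real ^ 'n) set)"
    using fn_subspaceD(1)[OF subspace_piecewise[OF subspace_C1_maps]] pw_C1_continuous by blast
  then have "normal_trace K F (\<lambda>_. 0) x = 0" if "K \<in> T" "x \<in> K" for K F x
    using normal_trace_scaleR[of "\<lambda>_. 0" K x F 0] that by simp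
  then have "AE x in surface_measure F. x \<in> \<Gamma> \<longrightarrow> normal_trace K F (\<lambda>_. 0) x = 0" if "K \<in> T" "F facet_of K" for K F
    using AE_surface_measure_in[OF that] that(1) by (auto elim!: eventually_mono)
  then show "(\<lambda>_. 0) \<in> RT0 k \<Omega> \<Gamma> T" using sub(1) by (simp add: RT0_def)
next
  note sub = fn_subspaceD[OF subspace_RT]
  fix u v assume uv: "u \<in> RT0 k \<Omega> \<Gamma> T" "v \<in> RT0 k \<Omega> \<Gamma> T"
  then have uv': "u \<in> pw_continuous" "v \<in> pw_continuous" using RT0_pw_C1 pw_C1_continuous by blast+
  have "AE x in surface_measure F. x \<in> \<Gamma> \<longrightarrow> normal_trace K F (\<lambda>x. u x + v x) x = 0" if KF: "K \<in> T" "F facet_of K" for K F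
  proof -
    have "AE x in surface_measure F. x \<in> \<Gamma> \<longrightarrow> normal_trace K F u x = 0"
      "AE x in surface_measure F. x \<in> \<Gamma> \<longrightarrow> normal_trace K F v x = 0" using uv KF by (auto simp: RT0_def)
    with AE_surface_measure_in[OF KF] show ?thesis
      by eventually_elim (simp add: normal_trace_add[OF uv' KF(1)])
  qed
  then show "(\<lambda>x. u x + v x) \<in> RT0 k \<Omega> \<Gamma> T" using uv sub(2) by (simp add: RT0_def)
next
  note sub = fn_subspaceD[OF subspace_RT]
  fix c u assume u: "u \<in> RT0 k \<Omega> \<Gamma> T"
  then have u': "u \<in> pw_continuous" using RT0_pw_C1 pw_C1_continuous by blast
  have "AE x in surface_measure F. x \<in> \<Gamma> \<longrightarrow> normal_trace K F (\<lambda>x. c *\<^sub>R u x) x = 0" if KF: "K \<in> T" "F facet_of K" for K F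
  proof -
    have "AE x in surface_measure F. x \<in> \<Gamma> \<longrightarrow> normal_trace K F u x = 0" using u KF by (auto simp: RT0_def)
    with AE_surface_measure_in[OF KF] show ?thesis
      by eventually_elim (simp add: normal_trace_scaleR[OF u' KF(1)])
  qed
  then show "(\<lambda>x. c *\<^sub>R u x) \<in> RT0 k \<Omega> \<Gamma> T" using u sub(3) by (simp add: RT0_def)
qed

text \<open>The triangle inequality is Minkowski in each of the three terms. Definiteness comes from
  the first one, whose weight is positive because \<open>\<kappa> > 0\<close>.\<close>

lemma fn_norm_V:
  assumes \<kappa>: "\<kappa> > 0"
  shows "fn_norm (RT0 k \<Omega> \<Gamma> T) (norm_V \<Omega> T \<kappa> F)"
proof
  show "fn.subspace (RT0 k \<Omega> \<Gamma> T)" by (rule subspace_RT0)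
next
  fix u v assume "u \<in> RT0 k \<Omega> \<Gamma> T" "v \<in> RT0 k \<Omega> \<Gamma> T"
  then have uv: "u \<in> piecewise T C1_maps" "v \<in> piecewise T C1_maps" using RT0_pw_C1 by auto
  then have Lp: "Lp (lebesgue_on \<Omega>) r u" "Lp (lebesgue_on \<Omega>) r v"
    "Lp (lebesgue_on \<Omega>) r (divergence T u)" "Lp (lebesgue_on \<Omega>) r (divergence T v)" if "r \<ge> 0" for r
    using that pw_continuous_Lp divergence_pw_continuous pw_C1_continuous by blast+
  have "norm_V \<Omega> T \<kappa> F (\<lambda>x. u x + v x) \<le>
    \<kappa> powr (-1/2) * (Lp_norm (lebesgue_on \<Omega>) 2 u + Lp_norm (lebesgue_on \<Omega>) 2 v) +
    (Lp_norm (lebesgue_on \<Omega>) 2 (divergence T u) + Lp_norm (lebesgue_on \<Omega>) 2 (divergence T v)) +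
     F powr (1/3) * (Lp_norm (lebesgue_on \<Omega>) 3 u + Lp_norm (lebesgue_on \<Omega>) 3 v)"
    unfolding norm_V_def divergence_add[OF uv]
    by (intro add_mono mult_left_mono Minkowski Lp) auto
  then show "norm_V \<Omega> T \<kappa> F (u + v) \<le> norm_V \<Omega> T \<kappa> F u + norm_V \<Omega> T \<kappa> F v"
    by (simp add: plus_fun_def norm_V_def algebra_simps)
next
  fix u c assume "u \<in> RT0 k \<Omega> \<Gamma> T"
  then have u: "u \<in> piecewise T C1_maps" using RT0_pw_C1 by auto
  show "norm_V \<Omega> T \<kappa> F (\<lambda>x. c *\<^sub>R u x) = \<bar>c\<bar> * norm_V \<Omega> T \<kappa> F u"
    unfolding norm_V_def divergence_scaleR[OF u] by (subst (1 2 3) Lp_norm_scaleR) (auto simp: algebra_simps)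
next
  fix u assume u: "u \<in> RT0 k \<Omega> \<Gamma> T" and 0: "norm_V \<Omega> T \<kappa> F u = 0"
  have "\<kappa> powr (-1/2) * Lp_norm (lebesgue_on \<Omega>) 2 u \<le> norm_V \<Omega> T \<kappa> F u"
    by (simp add: norm_V_def Lp_norm_nonneg)
  moreover have "\<kappa> powr (-1/2) > 0" using \<kappa> by simp
  ultimately have "Lp_norm (lebesgue_on \<Omega>) 2 u = 0"
    using Lp_norm_nonneg[of "lebesgue_on \<Omega>" 2 u] 0 by (simp add: mult_le_0_iff)
  moreover have u': "u \<in> pw_continuous" using u RT0_pw_C1 pw_C1_continuous by blast
  ultimately show "u = 0"
    using Lp_norm_eq_0_imp_AE[OF pw_continuous_Lp[OF u', of 2]] by (intro pw_continuous_AE_0_imp_0) auto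
qed

lemma RT0_finite_dimensional: "\<exists>G. finite G \<and> RT0 k \<Omega> \<Gamma> T \<subseteq> fn.span G"
  using piecewise_finite_dimensional[OF finite_mesh finite_RT_generators RT_local_subset_span]
  by (fastforce simp: RT0_def RT_def)

lemma Pk_Lp: "\<phi> \<in> Pk k T \<Longrightarrow> r \<ge> 0 \<Longrightarrow> Lp (lebesgue_on \<Omega>) r \<phi>"
proof (rule pw_continuous_Lp)
  assume "\<phi> \<in> Pk k T"
  then show "\<phi> \<in> pw_continuous"
    using piecewise_mono[of "polynomials k" "{p. continuous_on UNIV p}" T] polynomials_continuous
    unfolding Pk_def by blast
qed

end

section \<open>The coupled problem\<close>

lemma polytopal_mesh_if_regular:
  assumes "bounded_lipschitz_domain \<Omega>" "regular_simplicial_mesh \<sigma> \<Omega> T"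
  shows "polytopal_mesh \<Omega> T"
proof
  show "open \<Omega>" "bounded \<Omega>" using assms(1) by (auto simp: bounded_lipschitz_domain_def)
  show "finite T" "\<Union>T = closure \<Omega>"
    using assms(2) by (auto simp: regular_simplicial_mesh_def triangulation_def)
  fix K assume "K \<in> T"
  then have K: "int CARD('a) simplex K" using assms(2) by (simp add: regular_simplicial_mesh_def)
  then show "convex K" "compact K" unfolding simplex by (auto intro: finite_imp_compact_convex_hull)
  \<comment> \<open>Full affine dimension makes the interior equal to the relative interior, which
    is nonempty for a nonempty convex set.\<close>
  have "aff_dim K = int DIM(real ^ 'a)" using aff_dim_simplex[OF K] by simp
  then have "interior K = rel_interior K" "K \<noteq> {}" by (auto simp: interior_rel_interior_gen)
  then show "interior K \<noteq> {}" using rel_interior_eq_empty[OF \<open>convex K\<close>] by simp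
qed

text \<open>\<open>S_DF\<close> keeps only the first component of a pair defined by
  \<open>THE\<close>. Unique existence of the pair turns the description into a usable
  characterisation and recovers the pressure.\<close>

lemma S_DF_solution:
  assumes "DF_well_posed k \<Omega> \<Gamma>u \<Gamma>p T \<kappa> F f C_DF C_DFu" "\<phi> \<in> Pk k T"
  obtains p where "S_DF k \<Omega> \<Gamma>u T \<kappa> F f \<phi> \<in> RT0 k \<Omega> \<Gamma>u T" "p \<in> Pk k T"
    "DF_equations k \<Omega> \<Gamma>u T \<kappa> F (f \<phi>) (S_DF k \<Omega> \<Gamma>u T \<kappa> F f \<phi>) p"
    "\<And>u' p'. u' \<in> RT0 k \<Omega> \<Gamma>u T \<Longrightarrow> p' \<in> Pk k T \<Longrightarrow> DF_equations k \<Omega> \<Gamma>u T \<kappa> F (f \<phi>) u' p' \<Longrightarrow>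
       u' = S_DF k \<Omega> \<Gamma>u T \<kappa> F f \<phi> \<and> p' = p"
proof -
  let ?P = "\<lambda>(u, p). u \<in> RT0 k \<Omega> \<Gamma>u T \<and> p \<in> Pk k T \<and> DF_equations k \<Omega> \<Gamma>u T \<kappa> F (f \<phi>) u p"
  have ex: "\<exists>!s. ?P s" using assms unfolding DF_well_posed_def by blast
  define s where "s = (THE s. ?P s)"
  have s: "?P s" unfolding s_def by (rule theI'[OF ex])
  have S: "S_DF k \<Omega> \<Gamma>u T \<kappa> F f \<phi> = fst s" by (simp add: S_DF_def s_def)
  show ?thesis
  proof (rule that[of "snd s", unfolded S])
    fix u' p' assume "u' \<in> RT0 k \<Omega> \<Gamma>u T" "p' \<in> Pk k T" "DF_equations k \<Omega> \<Gamma>u T \<kappa> F (f \<phi>) u' p'"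
    then have "?P (u', p')" by simp
    then have "(u', p') = s" using ex s by blast
    then show "u' = fst s \<and> p' = snd s" by auto
  qed (use s in \<open>simp_all add: case_prod_beta\<close>)
qed

lemma S_ADR_solution:
  assumes "ADR_well_posed k \<Omega> \<Gamma>u \<Gamma>p T \<alpha> \<rho> m C_ADR" "u \<in> RT0 k \<Omega> \<Gamma>u T"
  obtains \<zeta> where "\<zeta> \<in> RT0 k \<Omega> \<Gamma>p T" "S_ADR k \<Omega> \<Gamma>p T \<alpha> \<rho> m u \<in> Pk k T"
    "ADR_equations k \<Omega> \<Gamma>p T \<alpha> \<rho> m u \<zeta> (S_ADR k \<Omega> \<Gamma>p T \<alpha> \<rho> m u)"
    "\<And>\<zeta>' \<phi>'. \<zeta>' \<in> RT0 k \<Omega> \<Gamma>p T \<Longrightarrow> \<phi>' \<in> Pk k T \<Longrightarrow> ADR_equations k \<Omega> \<Gamma>p T \<alpha> \<rho> m u \<zeta>' \<phi>' \<Longrightarrow>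
       \<zeta>' = \<zeta> \<and> \<phi>' = S_ADR k \<Omega> \<Gamma>p T \<alpha> \<rho> m u"
proof -
  let ?P = "\<lambda>(\<zeta>, \<phi>). \<zeta> \<in> RT0 k \<Omega> \<Gamma>p T \<and> \<phi> \<in> Pk k T \<and> ADR_equations k \<Omega> \<Gamma>p T \<alpha> \<rho> m u \<zeta> \<phi>"
  have ex: "\<exists>!s. ?P s" using assms unfolding ADR_well_posed_def by blast
  define s where "s = (THE s. ?P s)"
  have s: "?P s" unfolding s_def by (rule theI'[OF ex])
  have S: "S_ADR k \<Omega> \<Gamma>p T \<alpha> \<rho> m u = snd s" by (simp add: S_ADR_def s_def)
  show ?thesis
  proof (rule that[of "fst s", unfolded S])
    fix \<zeta>' \<phi>' assume "\<zeta>' \<in> RT0 k \<Omega> \<Gamma>p T" "\<phi>' \<in> Pk k T" "ADR_equations k \<Omega> \<Gamma>p T \<alpha> \<rho> m u \<zeta>' \<phi>'"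
    then have "?P (\<zeta>', \<phi>')" by simp
    then have "(\<zeta>', \<phi>') = s" using ex s by blast
    then show "\<zeta>' = fst s \<and> \<phi>' = snd s" by auto
  qed (use s in \<open>simp_all add: case_prod_beta\<close>)
qed

text \<open>Velocities of coupled solutions are exactly the fixed points of the composed map: given
  the velocity, the two decoupled problems determine flux, concentration and pressure.\<close>

lemma (in polytopal_mesh) coupled_unique_solution:
  assumes "\<kappa> > 0" and DF: "DF_well_posed k \<Omega> \<Gamma>u \<Gamma>p T \<kappa> F f C_DF C_DFu"
    and ADR: "ADR_well_posed k \<Omega> \<Gamma>u \<Gamma>p T \<alpha> \<rho> m C_ADR"
    and contr: "\<And>u v. u \<in> RT0 k \<Omega> \<Gamma>u T \<Longrightarrow> v \<in> RT0 k \<Omega> \<Gamma>u T \<Longrightarrow>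
      norm_V \<Omega> T \<kappa> F (\<lambda>x. S_DF k \<Omega> \<Gamma>u T \<kappa> F f (S_ADR k \<Omega> \<Gamma>p T \<alpha> \<rho> m u) x - S_DF k \<Omega> \<Gamma>u T \<kappa> F f (S_ADR k \<Omega> \<Gamma>p T \<alpha> \<rho> m v) x)
        \<le> L * norm_V \<Omega> T \<kappa> F (\<lambda>x. u x - v x)"
    and L: "L < 1"
  shows "\<exists>!(u, p, \<zeta>, \<phi>). u \<in> RT0 k \<Omega> \<Gamma>u T \<and> p \<in> Pk k T \<and> \<zeta> \<in> RT0 k \<Omega> \<Gamma>p T \<and> \<phi> \<in> Pk k T \<and>
          DF_equations k \<Omega> \<Gamma>u T \<kappa> F (f \<phi>) u p \<and> ADR_equations k \<Omega> \<Gamma>p T \<alpha> \<rho> m u \<zeta> \<phi>"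
proof -
  define R where "R = S_ADR k \<Omega> \<Gamma>p T \<alpha> \<rho> m"
  define S where "S = S_DF k \<Omega> \<Gamma>u T \<kappa> F f"
  define V where "V = RT0 k \<Omega> \<Gamma>u T"
  interpret fn_norm V "norm_V \<Omega> T \<kappa> F" unfolding V_def by (rule fn_norm_V) fact
  obtain G where G: "finite G" "V \<subseteq> fn.span G" using RT0_finite_dimensional unfolding V_def by blast
  have Rin: "R u \<in> Pk k T" if "u \<in> V" for u
    unfolding R_def by (rule S_ADR_solution[OF ADR that[unfolded V_def]])
  have Sin: "S \<phi> \<in> V" if "\<phi> \<in> Pk k T" for \<phi>
    unfolding S_def V_def by (rule S_DF_solution[OF DF that])
  have "\<exists>!u. u \<in> V \<and> S (R u) = u"
    using contr L Rin Sin
    by (intro contraction_fixed_point[OF G, of "\<lambda>u. S (R u)" L]) (auto simp: S_def R_def V_def fun_diff_def)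
  then obtain u where u: "u \<in> V" "S (R u) = u" "\<And>v. v \<in> V \<Longrightarrow> S (R v) = v \<Longrightarrow> v = u" by blast
  obtain \<zeta> where \<zeta>: "\<zeta> \<in> RT0 k \<Omega> \<Gamma>p T" "ADR_equations k \<Omega> \<Gamma>p T \<alpha> \<rho> m u \<zeta> (R u)"
    "\<And>\<zeta>' \<phi>'. \<zeta>' \<in> RT0 k \<Omega> \<Gamma>p T \<Longrightarrow> \<phi>' \<in> Pk k T \<Longrightarrow> ADR_equations k \<Omega> \<Gamma>p T \<alpha> \<rho> m u \<zeta>' \<phi>' \<Longrightarrow> \<zeta>' = \<zeta> \<and> \<phi>' = R u"
    using S_ADR_solution[OF ADR u(1)[unfolded V_def], folded R_def] by (metis (lifting))
  obtain p where p: "p \<in> Pk k T" "DF_equations k \<Omega> \<Gamma>u T \<kappa> F (f (R u)) (S (R u)) p"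
    "\<And>u' p'. u' \<in> RT0 k \<Omega> \<Gamma>u T \<Longrightarrow> p' \<in> Pk k T \<Longrightarrow> DF_equations k \<Omega> \<Gamma>u T \<kappa> F (f (R u)) u' p' \<Longrightarrow> u' = S (R u) \<and> p' = p"
    using S_DF_solution[OF DF Rin[OF u(1)], folded S_def] by (metis (lifting))
  show ?thesis
  proof (rule ex1I[of _ "(u, p, \<zeta>, R u)"])
    show "case (u, p, \<zeta>, R u) of (u, p, \<zeta>, \<phi>) \<Rightarrow> u \<in> RT0 k \<Omega> \<Gamma>u T \<and> p \<in> Pk k T \<and> \<zeta> \<in> RT0 k \<Omega> \<Gamma>p T \<and> \<phi> \<in> Pk k T \<and>
          DF_equations k \<Omega> \<Gamma>u T \<kappa> F (f \<phi>) u p \<and> ADR_equations k \<Omega> \<Gamma>p T \<alpha> \<rho> m u \<zeta> \<phi>"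
      using u(1,2) \<zeta>(1,2) p(1,2) Rin[OF u(1)] by (simp add: V_def)
    fix s assume s: "case s of (u, p, \<zeta>, \<phi>) \<Rightarrow> u \<in> RT0 k \<Omega> \<Gamma>u T \<and> p \<in> Pk k T \<and> \<zeta> \<in> RT0 k \<Omega> \<Gamma>p T \<and> \<phi> \<in> Pk k T \<and>
          DF_equations k \<Omega> \<Gamma>u T \<kappa> F (f \<phi>) u p \<and> ADR_equations k \<Omega> \<Gamma>p T \<alpha> \<rho> m u \<zeta> \<phi>"
    obtain u' p' \<zeta>' \<phi>' where s_eq: "s = (u', p', \<zeta>', \<phi>')" by (cases s)
    have s': "u' \<in> RT0 k \<Omega> \<Gamma>u T" "p' \<in> Pk k T" "\<zeta>' \<in> RT0 k \<Omega> \<Gamma>p T" "\<phi>' \<in> Pk k T"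
      "DF_equations k \<Omega> \<Gamma>u T \<kappa> F (f \<phi>') u' p'" "ADR_equations k \<Omega> \<Gamma>p T \<alpha> \<rho> m u' \<zeta>' \<phi>'"
      using s by (auto simp: s_eq)
    \<comment> \<open>Uniqueness in the transport problem fixes the concentration as
      \<open>R u'\<close>; uniqueness in the flow problem then makes \<open>u'\<close> a fixed
      point.\<close>
    have \<phi>': "\<phi>' = R u'"
      by (rule S_ADR_solution[OF ADR s'(1), folded R_def]) (use s' in blast)
    have "u' = S (R u')"
      unfolding \<phi>'[symmetric] by (rule S_DF_solution[OF DF s'(4), folded S_def]) (use s' in blast)
    with s'(1) have uu: "u' = u" by (intro u(3)) (simp_all add: V_def)
    have \<phi>\<zeta>: "\<zeta>' = \<zeta> \<and> \<phi>' = R u" by (rule \<zeta>(3)[OF s'(3,4) s'(6)[unfolded uu]])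
    have "DF_equations k \<Omega> \<Gamma>u T \<kappa> F (f (R u)) u' p'" using s'(5) \<phi>\<zeta> by simp
    then have "u' = S (R u) \<and> p' = p" by (rule p(3)[OF s'(1,2)])
    then show "s = (u, p, \<zeta>, R u)" using uu \<phi>\<zeta> s_eq by blast
  qed
qed

lemma max_square_mono:
  fixes x y :: real
  assumes "0 \<le> x" "x \<le> y"
  shows "max x (x\<^sup>2) \<le> max y (y\<^sup>2)"
  using assms by (intro max.mono power_mono)

text \<open>\<open>C\<close> is used as the constant of the \<open>L6\<close> estimate, as a factor
  at least 1 on the norm of \<open>f\<close> at zero, and as a bound for \<open>C_DF\<close>. The
  first two uses bound the norm of the forcing by \<open>D\<close>; the stability bound is monotone
  in that norm.\<close>

lemma (in polytopal_mesh) coupled_a_priori_bound: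
  assumes n: "CARD('n) \<ge> 2" and T: "\<And>K. K \<in> T \<Longrightarrow> \<exists>m. m simplex K"
    and pos: "\<alpha> > 0" "\<alpha>1 > 0" "C_emb > 0" "C_DF > 0"
    and emb: "sobolev_embedding_constant \<Omega> \<Gamma>u T C_emb"
    and f: "\<And>\<phi>. Lp (lebesgue_on \<Omega>) 6 \<phi> \<Longrightarrow> Lp_norm (lebesgue_on \<Omega>) 2 (f \<phi>)
             \<le> Lp_norm (lebesgue_on \<Omega>) 2 (f (\<lambda>_. 0)) + \<alpha>1 * Lp_norm (lebesgue_on \<Omega>) 6 \<phi>"
    and DF: "DF_well_posed k \<Omega> \<Gamma>u \<Gamma>p T \<kappa> F f C_DF C_DFu"
    and ADR: "ADR_well_posed k \<Omega> \<Gamma>u \<Gamma>p T \<alpha> \<rho> m C_ADR"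
    and sol: "u \<in> RT0 k \<Omega> \<Gamma>u T" "p \<in> Pk k T" "\<zeta> \<in> RT0 k \<Omega> \<Gamma>p T" "\<phi> \<in> Pk k T"
      "DF_equations k \<Omega> \<Gamma>u T \<kappa> F (f \<phi>) u p" "ADR_equations k \<Omega> \<Gamma>p T \<alpha> \<rho> m u \<zeta> \<phi>"
    and C: "C \<ge> C_DF" "C \<ge> 1" "C \<ge> C_emb * \<alpha> powr (-1/2)"
    and D: "D = C * (Lp_norm (lebesgue_on \<Omega>) 2 (f (\<lambda>_. 0)) + C_ADR * \<alpha>1 * Lp_norm (lebesgue_on \<Omega>) (6/5) m)"
  shows "norm_V \<Omega> T \<kappa> F u + norm_Q \<Omega> \<Gamma>p T \<kappa> F p + norm_W \<Omega> T \<alpha> \<zeta> + norm_Psi \<Omega> \<Gamma>u T \<alpha> \<phi>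
      \<le> C_ADR * Lp_norm (lebesgue_on \<Omega>) (6/5) m + C * max D (D\<^sup>2)"
proof -
  define x where "x = Lp_norm (lebesgue_on \<Omega>) 2 (f \<phi>)"
  define f0 where "f0 = Lp_norm (lebesgue_on \<Omega>) 2 (f (\<lambda>_. 0))"
  define m0 where "m0 = Lp_norm (lebesgue_on \<Omega>) (6/5) m"
  have nonneg: "x \<ge> 0" "f0 \<ge> 0" by (simp_all add: x_def f0_def Lp_norm_nonneg)
  have adr: "norm_W \<Omega> T \<alpha> \<zeta> + norm_Psi \<Omega> \<Gamma>u T \<alpha> \<phi> \<le> C_ADR * m0"
    using ADR sol unfolding ADR_well_posed_def m0_def by blast
  moreover have "norm_W \<Omega> T \<alpha> \<zeta> \<ge> 0" by (simp add: norm_W_def Lp_norm_nonneg)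
  ultimately have psi: "norm_Psi \<Omega> \<Gamma>u T \<alpha> \<phi> \<le> C_ADR * m0" by linarith
  have L6: "Lp (lebesgue_on \<Omega>) 6 \<phi>" using sol(4) by (rule Pk_Lp) simp
  have "Lp_norm (lebesgue_on \<Omega>) 6 \<phi> \<le> C * norm_Psi \<Omega> \<Gamma>u T \<alpha> \<phi>"
    using pos C by (intro Lp_norm_6_le_norm_Psi[OF n T _ _ emb L6]) auto
  also have "\<dots> \<le> C * (C_ADR * m0)" using psi C by (intro mult_left_mono) auto
  finally have "x \<le> f0 + \<alpha>1 * (C * (C_ADR * m0))"
    using f[OF L6] pos unfolding x_def f0_def by (meson add_left_mono less_imp_le mult_left_mono order_trans)
  also have "\<dots> \<le> C * f0 + \<alpha>1 * (C * (C_ADR * m0))"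
    using mult_right_mono[OF C(2) nonneg(2)] by simp
  also have "\<dots> = D" by (simp add: D f0_def m0_def algebra_simps)
  finally have "max x (x\<^sup>2) \<le> max D (D\<^sup>2)" using nonneg by (intro max_square_mono)
  moreover have "norm_V \<Omega> T \<kappa> F u + norm_Q \<Omega> \<Gamma>p T \<kappa> F p \<le> C_DF * max x (x\<^sup>2)"
    using DF sol unfolding DF_well_posed_def x_def by blast
  moreover have "C_DF * max x (x\<^sup>2) \<le> C * max x (x\<^sup>2)"
    using C(1) nonneg by (intro mult_right_mono) (auto simp: max_def)
  moreover have "C * max x (x\<^sup>2) \<le> C * max D (D\<^sup>2)"
    using C(2) calculation(1) by (intro mult_left_mono) auto
  ultimately show ?thesis using adr unfolding m0_def by linarith
qed

text \<open>Independence of the parameters is expressed by the order of quantifiers: the stability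
  constants are fixed before the tuple from \<open>\<P>\<close>, whereas \<open>C_d\<close> and
  \<open>a_DF\<close> are chosen after it.\<close>

theorem theorem4p4:
  fixes \<Omega> \<Gamma>u \<Gamma>p :: "(real ^ 'n) set"
    and k :: nat
    and \<alpha> \<alpha>1 \<sigma> C_DF C_DFu C_ADR C_emb :: real
    and m :: "real ^ 'n \<Rightarrow> real"
    and f :: "(real ^ 'n \<Rightarrow> real) \<Rightarrow> real ^ 'n \<Rightarrow> real ^ 'n"
    and \<P> :: "(real \<times> real \<times> real \<times> (real ^ 'n) set set) set"
  assumes "CARD('n) \<in> {2, 3}"
    and "bounded_lipschitz_domain \<Omega>"
    and "boundary_decomposition \<Omega> \<Gamma>u \<Gamma>p"
    and "\<alpha> > 0" and "\<alpha>1 > 0"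
    and "C_DF > 0" and "C_DFu > 0" and "C_ADR > 0" and "C_emb > 0"
    and "Lp (lebesgue_on \<Omega>) (6/5) m"
    and "\<And>\<phi>. Lp (lebesgue_on \<Omega>) 6 \<phi> \<Longrightarrow>
           Lp (lebesgue_on \<Omega>) 2 (f \<phi>) \<and>
           Lp_norm (lebesgue_on \<Omega>) 2 (f \<phi>)
             \<le> Lp_norm (lebesgue_on \<Omega>) 2 (f (\<lambda>_. 0)) + \<alpha>1 * Lp_norm (lebesgue_on \<Omega>) 6 \<phi>"
    and "\<And>\<kappa> F \<rho> T. (\<kappa>, F, \<rho>, T) \<in> \<P> \<Longrightarrow>
           \<kappa> > 0 \<and> F > 0 \<and> \<rho> > 0 \<and> regular_simplicial_mesh \<sigma> \<Omega> T"
    and "\<And>\<kappa> F \<rho> T. (\<kappa>, F, \<rho>, T) \<in> \<P> \<Longrightarrow> DF_well_posed k \<Omega> \<Gamma>u \<Gamma>p T \<kappa> F f C_DF C_DFu"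
    and "\<And>\<kappa> F \<rho> T. (\<kappa>, F, \<rho>, T) \<in> \<P> \<Longrightarrow> ADR_well_posed k \<Omega> \<Gamma>u \<Gamma>p T \<alpha> \<rho> m C_ADR"
    and "\<And>\<kappa> F \<rho> T. (\<kappa>, F, \<rho>, T) \<in> \<P> \<Longrightarrow> sobolev_embedding_constant \<Omega> \<Gamma>u T C_emb"
  shows "\<forall>(\<kappa>, F, \<rho>, T)\<in>\<P>. \<forall>C_d a_DF.
    (let V = RT0 k \<Omega> \<Gamma>u T; W = RT0 k \<Omega> \<Gamma>p T; Q = Pk k T; \<Psi> = Pk k T;
         L = lipschitz_factor \<Omega> \<alpha> F m \<alpha>1 C_emb C_d a_DF;
         S = S_DF k \<Omega> \<Gamma>u T \<kappa> F f \<circ> S_ADR k \<Omega> \<Gamma>p T \<alpha> \<rho> m;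
         f0 = Lp_norm (lebesgue_on \<Omega>) 2 (f (\<lambda>_. 0));
         m0 = Lp_norm (lebesgue_on \<Omega>) (6/5) m
     in
       ADR_inf_sup_constant k \<Omega> \<Gamma>u \<Gamma>p T \<alpha> \<rho> C_d \<longrightarrow>
       DF_monotonicity_constant k \<Omega> \<Gamma>u T \<kappa> F a_DF \<longrightarrow>
       (\<forall>u\<in>V. \<forall>v\<in>V. norm_V \<Omega> T \<kappa> F (\<lambda>x. S u x - S v x) \<le> L * norm_V \<Omega> T \<kappa> F (\<lambda>x. u x - v x)) \<longrightarrow>
       C_DFu * (f0 + C_ADR * \<alpha>1 * m0) < 1 / 2 \<longrightarrow>
       L < 1 \<longrightarrow>
       (\<exists>!(u, p, \<zeta>, \<phi>). u \<in> V \<and> p \<in> Q \<and> \<zeta> \<in> W \<and> \<phi> \<in> \<Psi> \<and>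
          DF_equations k \<Omega> \<Gamma>u T \<kappa> F (f \<phi>) u p \<and> ADR_equations k \<Omega> \<Gamma>p T \<alpha> \<rho> m u \<zeta> \<phi>) \<and>
       (\<forall>u\<in>V. \<forall>p\<in>Q. \<forall>\<zeta>\<in>W. \<forall>\<phi>\<in>\<Psi>.
          DF_equations k \<Omega> \<Gamma>u T \<kappa> F (f \<phi>) u p \<and> ADR_equations k \<Omega> \<Gamma>p T \<alpha> \<rho> m u \<zeta> \<phi> \<longrightarrow>
          (\<forall>C. C \<ge> C_DFu \<and> C \<ge> C_DF \<and> C \<ge> 1 \<and> C \<ge> C_emb * \<alpha> powr (-1/2) \<longrightarrow>
             (let D = C * (f0 + C_ADR * \<alpha>1 * m0)
              in norm_V \<Omega> T \<kappa> F u + norm_Q \<Omega> \<Gamma>p T \<kappa> F p + norm_W \<Omega> T \<alpha> \<zeta> + norm_Psi \<Omega> \<Gamma>u T \<alpha> \<phi>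
                   \<le> C_ADR * m0 + C * max D (D\<^sup>2)))))"
proof (clarify, unfold Let_def comp_def, intro impI conjI)
  fix \<kappa> F \<rho> :: real and T C_d a_DF
  assume P: "(\<kappa>, F, \<rho>, T) \<in> \<P>"
  let ?L = "lipschitz_factor \<Omega> \<alpha> F m \<alpha>1 C_emb C_d a_DF"
  have reg: "regular_simplicial_mesh \<sigma> \<Omega> T" and \<kappa>: "\<kappa> > 0" using assms(12)[OF P] by auto
  interpret polytopal_mesh \<Omega> T using assms(2) reg by (rule polytopal_mesh_if_regular)
  have simp_T: "\<exists>m. m simplex K" if "K \<in> T" for K
    using reg that by (auto simp: regular_simplicial_mesh_def)
  note DF = assms(13)[OF P] and ADR = assms(14)[OF P] and emb = assms(15)[OF P]
  show "\<exists>!(u, p, \<zeta>, \<phi>). u \<in> RT0 k \<Omega> \<Gamma>u T \<and> p \<in> Pk k T \<and> \<zeta> \<in> RT0 k \<Omega> \<Gamma>p T \<and> \<phi> \<in> Pk k T \<and>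
          DF_equations k \<Omega> \<Gamma>u T \<kappa> F (f \<phi>) u p \<and> ADR_equations k \<Omega> \<Gamma>p T \<alpha> \<rho> m u \<zeta> \<phi>"
    if "\<forall>u\<in>RT0 k \<Omega> \<Gamma>u T. \<forall>v\<in>RT0 k \<Omega> \<Gamma>u T.
          norm_V \<Omega> T \<kappa> F (\<lambda>x. S_DF k \<Omega> \<Gamma>u T \<kappa> F f (S_ADR k \<Omega> \<Gamma>p T \<alpha> \<rho> m u) x
            - S_DF k \<Omega> \<Gamma>u T \<kappa> F f (S_ADR k \<Omega> \<Gamma>p T \<alpha> \<rho> m v) x)
          \<le> ?L * norm_V \<Omega> T \<kappa> F (\<lambda>x. u x - v x)" "?L < 1"
    using that by (intro coupled_unique_solution[OF \<kappa> DF ADR, of ?L]) auto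
  show "\<forall>u\<in>RT0 k \<Omega> \<Gamma>u T. \<forall>p\<in>Pk k T. \<forall>\<zeta>\<in>RT0 k \<Omega> \<Gamma>p T. \<forall>\<phi>\<in>Pk k T.
      DF_equations k \<Omega> \<Gamma>u T \<kappa> F (f \<phi>) u p \<and> ADR_equations k \<Omega> \<Gamma>p T \<alpha> \<rho> m u \<zeta> \<phi> \<longrightarrow>
      (\<forall>C. C \<ge> C_DFu \<and> C \<ge> C_DF \<and> C \<ge> 1 \<and> C \<ge> C_emb * \<alpha> powr (-1/2) \<longrightarrow>
         norm_V \<Omega> T \<kappa> F u + norm_Q \<Omega> \<Gamma>p T \<kappa> F p + norm_W \<Omega> T \<alpha> \<zeta> + norm_Psi \<Omega> \<Gamma>u T \<alpha> \<phi>
         \<le> C_ADR * Lp_norm (lebesgue_on \<Omega>) (6/5) m +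
            C * max (C * (Lp_norm (lebesgue_on \<Omega>) 2 (f (\<lambda>_. 0)) + C_ADR * \<alpha>1 * Lp_norm (lebesgue_on \<Omega>) (6/5) m))
                   ((C * (Lp_norm (lebesgue_on \<Omega>) 2 (f (\<lambda>_. 0)) + C_ADR * \<alpha>1 * Lp_norm (lebesgue_on \<Omega>) (6/5) m))\<^sup>2))"
    \<comment> \<open>Unfolding \<open>Let_def\<close> has replaced \<open>D\<close> by its value,
      so its defining equation in the bound is closed by \<open>refl\<close>.\<close>
    using assms(1,4,5,6,9) assms(11)
    by (intro ballI impI allI coupled_a_priori_bound[OF _ simp_T _ _ _ _ emb _ DF ADR _ _ _ _ _ _ _ _ _ refl]) auto
qed

end
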